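(* Let $U\subset\mathbb R^d$ be open and $\mathbf f:U\to\mathbb R^n$ continuous and good. The following are equivalent: (i) the set $\{\mathbf x\in U:\mathbf f(\mathbf x)\text{ is not VWA}\}$ is dense in $U$; (ii) $\mathbf f$ is extremal; (iii) for a.e. $\mathbf x_0\in U$ and every $r>0$ there is a ball $B\subset U$ centered at $\mathbf x_0$ of radius less than $r$ satisfying condition ( * ); (iv) every ball $B\subset U$ satisfies condition ( * ). Here condition ( * ) for a ball $B$ is: for every $\beta>0$ there exists $T>0$ such that for every $t\ge T$ and every $\Gamma\in\mathcal S_{n+1}$, $\sup_{\mathbf x\in B}\|g_tu_{\mathbf f(\mathbf x)}\Gamma\|\ge e^{-\beta t}$.
   Context: A function $f:V\to\mathbb R$ is $(C,\alpha)$-good on $V$ if for every open ball $B\subset V$ and $\varepsilon>0$, $|\{\mathbf x\in B:|f(\mathbf x)|<\varepsilon\sup_B|f|\}|\le C\varepsilon^\alpha|B|$. $\mathbf f=(f_1,\dots,f_n)$ is good at $\mathbf x_0$ if there are a neighborhood $V$ of $\mathbf x_0$ and $C,\alpha>0$ such that every linear combination of $1,f_1,\dots,f_n$ is $(C,\alpha)$-good on $V$; $\mathbf f$ is good if it is good at a.e. point of $U$. $\mathbf y\in\mathbb R^n$ is VWA (very well approximable) if for some $v>n$ there are infinitely many $\mathbf q\in\mathbb Z^n$ with $|\mathbf y\mathbf q+p|\le\|\mathbf q\|^{-v}$ for some $p\in\mathbb Z$ (sup-norm); $\mathbf f$ is extremal if $\mathbf f(\mathbf x)$ is not VWA for a.e.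 $\mathbf x\in U$. With $\mathbf e_I$ the wedge of standard basis vectors $\mathbf e_i$, $i\in I\subset\{0,\dots,n\}$ (increasing order), $\|\sum_Iw_I\mathbf e_I\|=\max|w_I|$; $\mathcal S_{n+1}$ is the set of nonzero subgroups of $\mathbb Z^{n+1}$ of rank $\le n$, and for $\Gamma$ with basis $\mathbf v_1,\dots,\mathbf v_j$, $\|g\Gamma\|=\|g\mathbf v_1\wedge\dots\wedge g\mathbf v_j\|$. $u_{\mathbf y}=\begin{pmatrix}1&\mathbf y\\0&I_n\end{pmatrix}$, $g_t=\mathrm{diag}(e^t,e^{-t/n},\dots,e^{-t/n})$. *)

theory Defs
  imports "HOL-Analysis.Analysis"
begin

text \<open>Conventions. The domain is R^d, modelled as the type real^'d (Lebesgue measure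
  lebesgue, Euclidean open balls). The map f : U -> R^n is given by its component
  functions f i, i in {1..n}. Vectors of R^(n+1) resp. Z^(n+1) are functions
  nat => real resp. nat => int, coordinates indexed by {0..n} (standard basis e_0,...,e_n);
  (n+1)x(n+1) matrices are functions nat => nat => real indexed by {0..n}.\<close>

definition C_alpha_good_on ::
  "real \<Rightarrow> real \<Rightarrow> ('a::euclidean_space) set \<Rightarrow> ('a \<Rightarrow> real) \<Rightarrow> bool" where
  "C_alpha_good_on C \<alpha> V h \<longleftrightarrow>
     (\<forall>z r \<epsilon>. 0 < r \<longrightarrow> ball z r \<subseteq> V \<longrightarrow> 0 < \<epsilon> \<longrightarrow>
        measure lebesgue {x \<in> ball z r. ereal \<bar>h x\<bar> < ereal \<epsilon> * (SUP y\<in>ball z r. ereal \<bar>h y\<bar>)}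
          \<le> C * \<epsilon> powr \<alpha> * measure lebesgue (ball z r))"

definition lin_comb :: "nat \<Rightarrow> (nat \<Rightarrow> 'a \<Rightarrow> real) \<Rightarrow> (nat \<Rightarrow> real) \<Rightarrow> 'a \<Rightarrow> real" where
  "lin_comb n f c x = c 0 + (\<Sum>i\<in>{1..n}. c i * f i x)"

definition good_at ::
  "nat \<Rightarrow> ('a::euclidean_space) set \<Rightarrow> (nat \<Rightarrow> 'a \<Rightarrow> real) \<Rightarrow> 'a \<Rightarrow> bool" where
  "good_at n U f x0 \<longleftrightarrow>
     (\<exists>V C \<alpha>. open V \<and> x0 \<in> V \<and> V \<subseteq> U \<and> 0 < C \<and> 0 < \<alpha> \<and>
        (\<forall>c. C_alpha_good_on C \<alpha> V (lin_comb n f c)))"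

definition good :: "nat \<Rightarrow> ('a::euclidean_space) set \<Rightarrow> (nat \<Rightarrow> 'a \<Rightarrow> real) \<Rightarrow> bool" where
  "good n U f \<longleftrightarrow> (AE x in lebesgue. x \<in> U \<longrightarrow> good_at n U f x)"

definition sup_norm_int :: "nat \<Rightarrow> (nat \<Rightarrow> int) \<Rightarrow> real" where
  "sup_norm_int n q = Max (insert 0 {real_of_int \<bar>q i\<bar> | i. i \<in> {1..n}})"

definition VWA :: "nat \<Rightarrow> (nat \<Rightarrow> real) \<Rightarrow> bool" where
  "VWA n y \<longleftrightarrow>
     (\<exists>v > real n. infinite {q :: nat \<Rightarrow> int. (\<forall>i. i \<notin> {1..n} \<longrightarrow> q i = 0) \<and>
        (\<exists>p::int. \<bar>(\<Sum>i\<in>{1..n}. y i * real_of_int (q i)) + real_of_int p\<bar>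
                    \<le> sup_norm_int n q powr (- v))})"

definition extremal :: "nat \<Rightarrow> ('a::euclidean_space) set \<Rightarrow> (nat \<Rightarrow> 'a \<Rightarrow> real) \<Rightarrow> bool" where
  "extremal n U f \<longleftrightarrow> (AE x in lebesgue. x \<in> U \<longrightarrow> \<not> VWA n (\<lambda>i. f i x))"

definition mat_mult :: "nat \<Rightarrow> (nat \<Rightarrow> nat \<Rightarrow> real) \<Rightarrow> (nat \<Rightarrow> nat \<Rightarrow> real) \<Rightarrow> nat \<Rightarrow> nat \<Rightarrow> real" where
  "mat_mult n A B i j = (\<Sum>k\<le>n. A i k * B k j)"

definition mat_vec :: "nat \<Rightarrow> (nat \<Rightarrow> nat \<Rightarrow> real) \<Rightarrow> (nat \<Rightarrow> real) \<Rightarrow> nat \<Rightarrow> real" where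
  "mat_vec n A v i = (if i \<le> n then (\<Sum>k\<le>n. A i k * v k) else 0)"

definition u_mat :: "nat \<Rightarrow> (nat \<Rightarrow> real) \<Rightarrow> nat \<Rightarrow> nat \<Rightarrow> real" where
  "u_mat n y i j = (if i \<le> n \<and> j \<le> n then
       (if i = j then 1 else if i = 0 \<and> 1 \<le> j then y j else 0) else 0)"

definition g_mat :: "nat \<Rightarrow> real \<Rightarrow> nat \<Rightarrow> nat \<Rightarrow> real" where
  "g_mat n t i j = (if i \<le> n \<and> j \<le> n \<and> i = j then
       (if i = 0 then exp t else exp (- t / real n)) else 0)"

definition ldet :: "nat \<Rightarrow> (nat \<Rightarrow> nat \<Rightarrow> real) \<Rightarrow> real" where
  "ldet j M = (\<Sum>p | p permutes {..<j}. of_int (sign p) * (\<Prod>a<j. M a (p a)))"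

text \<open>Norm of w_0 wedge ... wedge w_(j-1) in the wedge power of R^(n+1): the maximum of the
  absolute values of the coefficients w_I with respect to the basis e_I (I subset of {0..n},
  card I = j, increasing order); w_I is the j x j minor with rows I.\<close>
definition wedge_norm :: "nat \<Rightarrow> nat \<Rightarrow> (nat \<Rightarrow> nat \<Rightarrow> real) \<Rightarrow> real" where
  "wedge_norm n j w = Max {\<bar>ldet j (\<lambda>a k. w k (sorted_list_of_set I ! a))\<bar> |
                           I. I \<subseteq> {0..n} \<and> card I = j}"

definition is_zbasis :: "nat \<Rightarrow> (nat \<Rightarrow> int) set \<Rightarrow> (nat \<Rightarrow> int) list \<Rightarrow> bool" where
  "is_zbasis n \<Gamma> vs \<longleftrightarrow>
     (\<forall>v\<in>set vs. \<forall>i. n < i \<longrightarrow> v i = 0) \<and>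
     (\<forall>c::nat \<Rightarrow> int. (\<forall>i. (\<Sum>k<length vs. c k * (vs ! k) i) = 0) \<longrightarrow> (\<forall>k<length vs. c k = 0)) \<and>
     \<Gamma> = {(\<lambda>i. \<Sum>k<length vs. c k * (vs ! k) i) | c :: nat \<Rightarrow> int. True}"

text \<open>S_(n+1): nonzero subgroups of Z^(n+1) of rank at most n (every subgroup of
  Z^(n+1) is free, its rank being the length of a basis).\<close>
definition S_set :: "nat \<Rightarrow> (nat \<Rightarrow> int) set set" where
  "S_set n = {\<Gamma>. \<exists>vs. is_zbasis n \<Gamma> vs \<and> 1 \<le> length vs \<and> length vs \<le> n}"

text \<open>norm of g Gamma, computed from a basis (independent of the choice of basis).\<close>
definition subgroup_norm :: "nat \<Rightarrow> (nat \<Rightarrow> nat \<Rightarrow> real) \<Rightarrow> (nat \<Rightarrow> int) set \<Rightarrow> real" where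
  "subgroup_norm n g \<Gamma> =
     (let vs = (SOME vs. is_zbasis n \<Gamma> vs) in
       wedge_norm n (length vs) (\<lambda>k. mat_vec n g (\<lambda>i. real_of_int ((vs ! k) i))))"

definition cond_star :: "nat \<Rightarrow> (nat \<Rightarrow> 'a \<Rightarrow> real) \<Rightarrow> 'a set \<Rightarrow> bool" where
  "cond_star n f B \<longleftrightarrow>
     (\<forall>\<beta>>0. \<exists>T>0. \<forall>t\<ge>T. \<forall>\<Gamma>\<in>S_set n.
        (SUP x\<in>B. ereal (subgroup_norm n (mat_mult n (g_mat n t) (u_mat n (\<lambda>i. f i x))) \<Gamma>))
          \<ge> ereal (exp (- \<beta> * t)))"

end

theory Submission
  imports Defs "Jordan_Normal_Form.Determinant"
begin

text \<open>
  Extremality is read off the orbits \<open>g\<^sub>t u\<^bsub>f(x)\<^esub> \<int>\<^bsup>n+1\<^esup>\<close>: the vector \<open>f(x)\<close> is very well approximable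
  exactly when these lattices contain, for some \<open>\<gamma> > 0\<close> and arbitrarily large \<open>t\<close>, nonzero vectors
  of size \<open>e\<^bsup>-\<gamma>t\<^esup>\<close>.

  If condition (iv) fails on a ball, then for arbitrarily large \<open>t\<close> a single subgroup \<open>\<Gamma>\<close> has exponentially
  small covolume at all points of the ball simultaneously; a pigeonhole form of Minkowski's theorem
  turns this into short vectors, so no point of the ball escapes being very well approximable. This
  contradicts density.

  Conversely, let the covolume condition hold on a small ball around a point where \<open>f\<close> is good. All covolume functions
  are maxima of absolute values of linear combinations of \<open>1, f\<^sub>1, \<dots>, f\<^sub>n\<close> and hence good. By the
  quantitative nondivergence argument of Kleinbock and Margulis, outside a set of measure
  \<open>O(e\<^bsup>-\<alpha>\<beta>t\<^esup>)\<close> there is a flag of primitive subgroups with controlled covolumes such that every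
  subgroup compatible with the flag has large covolume; such a flag excludes short vectors.
  Borel--Cantelli over integer \<open>t\<close> finishes the proof.
\<close>

section \<open>Determinants of real matrices indexed by natural numbers\<close>

text \<open>Goodness enters only in deducing extremality from condition (iii); the other
  implications rest on the flow, geometry of numbers and openness of U. The obstacle there: the
  hypothesis makes each covolume large only somewhere on the ball, at a point depending on the
  subgroup, and infinitely many subgroups compete at each time t, so exceptional sets cannot be
  summed over subgroups. An induction over ranks avoids this. A bad point receives one subgroup
  together with a ball on which it stays small, while on the doubled ball every subgroup is large
  somewhere. Near that point only subgroups strictly comparable with the chosen one still matter,
  and they avoid its rank. So at most n rounds occur, and a round costs a constant factor, never a
  count of subgroups. Two thresholds are needed: subgroups compatible with the flag stay above
  \<open>\<rho>\<close>, flag members only above a smaller \<open>\<epsilon>\<close>, being small by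
  choice. The ratio of the two decays exponentially, which makes the bad sets summable. Rates
  deteriorate on the way, harmlessly: very good approximability asks for some positive rate.\<close>

lemma ldet_eq_det: "ldet j M = det (mat j j (\<lambda>(a, b). M a b))"
proof -
  have "(\<Prod>a<j. M a (p a)) = (\<Prod>a = 0..<j. mat j j (\<lambda>(a, b). M a b) $$ (a, p a))"
    if "p permutes {..<j}" for p
    using that by (intro prod.cong) (auto simp: permutes_in_image lessThan_atLeast0)
  then show ?thesis
    unfolding ldet_def by (subst det_def'[of _ j]) (auto simp: lessThan_atLeast0 intro!: sum.cong)
qed

lemma ldet_cong:
  assumes "\<And>a b. a < j \<Longrightarrow> b < j \<Longrightarrow> M a b = N a b"
  shows "ldet j M = ldet j N"
  unfolding ldet_eq_det by (rule arg_cong[where f = det]) (auto simp: assms)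

lemma ldet_mult:
  "ldet j (\<lambda>a b. \<Sum>k<j. M a k * N k b) = ldet j M * ldet j N"
proof -
  have "mat j j (\<lambda>(a, b). \<Sum>k<j. M a k * N k b) = mat j j (\<lambda>(a, b). M a b) * mat j j (\<lambda>(a, b). N a b)"
    by (rule eq_matI) (auto simp: scalar_prod_def lessThan_atLeast0)
  then show ?thesis unfolding ldet_eq_det by (subst det_mult[symmetric]) auto
qed

lemma ldet_transpose: "ldet j (\<lambda>a b. M b a) = ldet j M"
proof -
  have "mat j j (\<lambda>(a, b). M b a) = transpose_mat (mat j j (\<lambda>(a, b). M a b))"
    by (rule eq_matI) auto
  then show ?thesis unfolding ldet_eq_det by (simp only: det_transpose[of _ j] mat_carrier)
qed

lemma ldet_lower_triangular:
  assumes "\<And>a b. a < b \<Longrightarrow> b < j \<Longrightarrow> M a b = 0"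
  shows "ldet j M = (\<Prod>a<j. M a a)"
proof -
  have "ldet j M = prod_list (diag_mat (mat j j (\<lambda>(a, b). M a b)))"
    unfolding ldet_eq_det by (rule det_lower_triangular[of j]) (auto simp: assms)
  then show ?thesis by (simp add: prod_list_diag_prod lessThan_atLeast0)
qed

lemma ldet_upper_triangular:
  assumes "\<And>a b. a < b \<Longrightarrow> b < j \<Longrightarrow> M b a = 0"
  shows "ldet j M = (\<Prod>a<j. M a a)"
  using ldet_lower_triangular[of j "\<lambda>a b. M b a"] assms ldet_transpose[of j M] by simp

lemma ldet_identical_rows:
  assumes "a < j" "b < j" "a \<noteq> b" "\<And>k. k < j \<Longrightarrow> M a k = M b k"
  shows "ldet j M = 0"
  unfolding ldet_eq_det
  by (rule det_identical_rows[of _ j a b]) (use assms in \<open>auto intro!: eq_vecI\<close>)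

lemma ldet_permute_rows:
  assumes "p permutes {..<j}"
  shows "\<bar>ldet j (\<lambda>a b. M (p a) b)\<bar> = \<bar>ldet j M\<bar>"
proof -
  have p: "p permutes {0..<j}" using assms by (simp add: lessThan_atLeast0)
  have "ldet j (\<lambda>a b. M (p a) b) = signof p * ldet j M"
    unfolding ldet_eq_det
    by (subst det_permute_rows[OF _ p, symmetric, of _ ])
       (use p in \<open>auto intro!: arg_cong[where f = det] eq_matI simp: permutes_in_image\<close>)
  then show ?thesis by (auto simp: abs_mult sign_def)
qed

text \<open>The cofactors of the last row do not see that row, so one coefficient vector serves
  every \<open>r\<close>. Its last entry is the leading minor, by which \<open>indep_extend\<close>
  divides.\<close>

lemma ldet_last_row_expansion:
  "\<exists>cof. cof j = ldet j M \<and>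
     (\<forall>r. ldet (Suc j) (\<lambda>a b. if a = j then r b else M a b) = (\<Sum>k\<le>j. r k * cof k))"
proof -
  define cof where "cof k = cofactor (mat (Suc j) (Suc j) (\<lambda>(a, b). M a b)) j k" for k
  have eq: "mat_delete (mat (Suc j) (Suc j) (\<lambda>(a, b). if a = j then r b else M a b)) j k =
      mat_delete (mat (Suc j) (Suc j) (\<lambda>(a, b). M a b)) j k" if "k < Suc j" for r k
    by (rule eq_matI) (auto simp: mat_delete_def)
  have "mat_delete (mat (Suc j) (Suc j) (\<lambda>(a, b). M a b)) j j = mat j j (\<lambda>(a, b). M a b)"
    by (rule eq_matI) (auto simp: mat_delete_def)
  then have 1: "cof j = ldet j M"
    by (simp add: cof_def cofactor_def ldet_eq_det)
  have "ldet (Suc j) (\<lambda>a b. if a = j then r b else M a b) = (\<Sum>k<Suc j. r k * cof k)" for r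
    unfolding ldet_eq_det
    by (subst laplace_expansion_row[of _ "Suc j" j])
       (auto simp: cof_def cofactor_def eq intro!: sum.cong)
  then show ?thesis using 1 by (intro exI[of _ cof]) (auto simp: lessThan_Suc_atMost)
qed

lemma ldet_row_linear:
  assumes "i < j"
  shows "\<exists>cof. \<forall>r. ldet j (\<lambda>a b. if a = i then r b else M a b) = (\<Sum>k<j. r k * cof k)"
proof -
  define cof where "cof k = cofactor (mat j j (\<lambda>(a, b). M a b)) i k" for k
  have eq: "mat_delete (mat j j (\<lambda>(a, b). if a = i then r b else M a b)) i k =
      mat_delete (mat j j (\<lambda>(a, b). M a b)) i k" if "k < j" for r k
    using assms by (intro eq_matI) (auto simp: mat_delete_def)
  have "ldet j (\<lambda>a b. if a = i then r b else M a b) = (\<Sum>k<j. r k * cof k)" for r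
    unfolding ldet_eq_det
    by (subst laplace_expansion_row[of _ j i])
       (use assms in \<open>auto simp: cof_def cofactor_def eq intro!: sum.cong\<close>)
  then show ?thesis by blast
qed

text \<open>Each cofactor of the last column is, up to sign, a determinant of the first
  \<open>j\<close> columns with one row skipped; \<open>\<tau>\<close> encodes the skipping.\<close>

lemma ldet_last_column_bound:
  assumes "\<And>\<tau>. \<bar>ldet j (\<lambda>a b. M (\<tau> a) b)\<bar> \<le> D" and "\<And>a. a \<le> j \<Longrightarrow> \<bar>M a j\<bar> \<le> c"
  shows "\<bar>ldet (Suc j) M\<bar> \<le> real (Suc j) * c * D"
proof -
  define A where "A = mat (Suc j) (Suc j) (\<lambda>(a, b). M a b)"
  have A: "A \<in> carrier_mat (Suc j) (Suc j)" by (simp add: A_def)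
  have c: "0 \<le> c" using assms(2)[of 0] by simp
  have "\<bar>A $$ (a, j) * cofactor A a j\<bar> \<le> c * D" if "a < Suc j" for a
  proof -
    have "mat_delete A a j = mat j j (\<lambda>(x, y). M (if x < a then x else Suc x) y)"
      by (rule eq_matI) (auto simp: mat_delete_def A_def)
    then have "\<bar>cofactor A a j\<bar> = \<bar>ldet j (\<lambda>x y. M (if x < a then x else Suc x) y)\<bar>"
      by (simp add: cofactor_def ldet_eq_det abs_mult power_abs)
    then have "\<bar>cofactor A a j\<bar> \<le> D" using assms(1)[of "\<lambda>x. if x < a then x else Suc x"] by simp
    moreover have "\<bar>A $$ (a, j)\<bar> \<le> c" using assms(2)[of a] that by (simp add: A_def)
    ultimately show ?thesis using c by (auto simp: abs_mult intro!: mult_mono)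
  qed
  then have "\<bar>\<Sum>a<Suc j. A $$ (a, j) * cofactor A a j\<bar> \<le> (\<Sum>a<Suc j. c * D)"
    by (intro order.trans[OF sum_abs] sum_mono) auto
  then show ?thesis
    using laplace_expansion_column[OF A, of j] by (simp add: ldet_eq_det A_def[symmetric] mult.assoc)
qed

text \<open>One step of Gaussian elimination: M = E R with E unit upper triangular and the last
  column of R zero above the pivot. What remains is the Schur complement of the pivot.\<close>

lemma ldet_pivot:
  assumes p: "M j j \<noteq> 0"
  shows "ldet (Suc j) M = M j j * ldet j (\<lambda>a b. M a b - M a j / M j j * M j b)"
proof -
  define E where "E a k = (if a = k then 1 else if k = j then M a j / M j j else (0::real))" for a k :: nat
  define R where "R k b = (if k = j then M j b else M k b - M k j / M j j * M j b)" for k b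
  have M: "(\<Sum>k<Suc j. E a k * R k b) = M a b" if "a < Suc j" for a b
  proof (cases "a = j")
    case True
    then have "(\<Sum>k<j. E a k * R k b) = 0"
      by (intro sum.neutral) (auto simp: E_def)
    then show ?thesis using True by (simp add: R_def E_def)
  next
    case False
    then have a: "a < j" using that by simp
    have "(\<Sum>k<j. E a k * R k b) = (\<Sum>k<j. (if k = a then R a b else 0))"
      by (rule sum.cong) (auto simp: E_def)
    then have "(\<Sum>k<Suc j. E a k * R k b) = (\<Sum>k<j. (if k = a then R a b else 0)) + M a j / M j j * R j b"
      using a by (simp add: E_def)
    then show ?thesis using a by (simp add: R_def)
  qed
  have "ldet (Suc j) M = ldet (Suc j) (\<lambda>a b. \<Sum>k<Suc j. E a k * R k b)"
    by (rule ldet_cong) (use M in auto)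
  also have "\<dots> = ldet (Suc j) E * ldet (Suc j) R" by (rule ldet_mult)
  also have "ldet (Suc j) E = 1"
  proof -
    have "ldet (Suc j) E = (\<Prod>a<Suc j. E a a)"
      by (rule ldet_upper_triangular) (auto simp: E_def)
    then show ?thesis by (simp add: E_def)
  qed
  also have "ldet (Suc j) R = M j j * ldet j (\<lambda>a b. M a b - M a j / M j j * M j b)"
  proof -
    obtain cof where cof: "cof j = ldet j (\<lambda>a b. R b a)"
      "\<And>r. ldet (Suc j) (\<lambda>a b. if a = j then r b else R b a) = (\<Sum>k\<le>j. r k * cof k)"
      using ldet_last_row_expansion[of j "\<lambda>a b. R b a"] by blast
    have "ldet (Suc j) R = ldet (Suc j) (\<lambda>a b. if a = j then (if b = j then M j j else 0) else R b a)"
      by (subst ldet_transpose[symmetric], rule ldet_cong) (use p in \<open>auto simp: R_def\<close>)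
    also have "\<dots> = (\<Sum>k\<le>j. (if k = j then M j j else 0) * cof k)" by (rule cof)
    also have "\<dots> = (\<Sum>k\<le>j. if k = j then M j j * cof j else 0)" by (rule sum.cong) auto
    also have "\<dots> = M j j * cof j" by simp
    also have "cof j = ldet j R" unfolding cof(1) by (rule ldet_transpose)
    also have "ldet j R = ldet j (\<lambda>a b. M a b - M a j / M j j * M j b)"
      by (rule ldet_cong) (auto simp: R_def)
    finally show ?thesis .
  qed
  finally show ?thesis by simp
qed

lemma ldet_Ints:
  assumes "\<And>a b. a < j \<Longrightarrow> b < j \<Longrightarrow> M a b \<in> \<int>"
  shows "ldet j M \<in> \<int>"
  unfolding ldet_def
proof (intro Ints_sum Ints_mult Ints_of_int Ints_prod)
  fix p a assume "p \<in> {p. p permutes {..<j}}" "a \<in> {..<j}"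
  then show "M a (p a) \<in> \<int>" using permutes_in_image[of p "{..<j}" a] by (intro assms) auto
qed

section \<open>Minors, wedge norms and linear independence\<close>

lemma ldet_kernel_trivial:
  assumes "ldet j M \<noteq> 0" "\<And>a. a < j \<Longrightarrow> (\<Sum>k<j. M a k * c k) = 0" "k < j"
  shows "c k = 0"
proof (rule ccontr)
  assume "c k \<noteq> 0"
  let ?A = "mat j j (\<lambda>(a, b). M a b)"
  have "vec j c \<noteq> 0\<^sub>v j"
    using \<open>c k \<noteq> 0\<close> \<open>k < j\<close> by (metis index_vec index_zero_vec(1))
  moreover have "?A *\<^sub>v vec j c = 0\<^sub>v j"
    by (rule eq_vecI) (use assms(2) in \<open>auto simp: scalar_prod_def lessThan_atLeast0\<close>)
  ultimately have "\<exists>v. v \<in> carrier_vec j \<and> v \<noteq> 0\<^sub>v j \<and> ?A *\<^sub>v v = 0\<^sub>v j"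
    by (intro exI[of _ "vec j c"]) auto
  then have "det ?A = 0" using det_0_iff_vec_prod_zero_field[of ?A j] by simp
  then show False using assms(1) by (simp add: ldet_eq_det)
qed

lemma ldet_zero_column:
  assumes "b < j" "\<And>a. a < j \<Longrightarrow> M a b = 0"
  shows "ldet j M = 0"
  unfolding ldet_def
proof (rule sum.neutral, clarify)
  fix p assume p: "p permutes {..<j}"
  obtain a where "p a = b" using permutes_surj[OF p] by (metis surjD)
  moreover then have "a < j" using permutes_in_image[OF p, of a] assms(1) by simp
  ultimately have "(\<Prod>a<j. M a (p a)) = 0" using assms(2) by (intro prod_zero bexI[of _ a]) auto
  then show "of_int (sign p) * (\<Prod>a<j. M a (p a)) = 0" by simp
qed

text \<open>
  A family of vectors is a function \<open>w\<close> with \<open>w k i\<close> the \<open>i\<close>-th coordinate of the \<open>k\<close>-th vector.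
  The rows of a minor are chosen by a map \<open>\<sigma>\<close> of \<open>{..<j}\<close> into \<open>{..n}\<close> that need not be increasing.
\<close>

definition minor :: "nat \<Rightarrow> (nat \<Rightarrow> nat \<Rightarrow> real) \<Rightarrow> (nat \<Rightarrow> nat) \<Rightarrow> real" where
  "minor j w \<sigma> = ldet j (\<lambda>a k. w k (\<sigma> a))"

definition row_choice :: "nat \<Rightarrow> nat \<Rightarrow> (nat \<Rightarrow> nat) \<Rightarrow> bool" where
  "row_choice n j \<sigma> \<longleftrightarrow> \<sigma> ` {..<j} \<subseteq> {..n}"

lemma minor_not_inj: "\<not> inj_on \<sigma> {..<j} \<Longrightarrow> minor j w \<sigma> = 0"
proof -
  assume "\<not> inj_on \<sigma> {..<j}"
  then obtain a b where "a < j" "b < j" "a \<noteq> b" "\<sigma> a = \<sigma> b" by (auto simp: inj_on_def)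
  then show ?thesis unfolding minor_def by (intro ldet_identical_rows[of a j b]) auto
qed

text \<open>Sorting the chosen rows permutes them, which costs only a sign. This links freely chosen
  rows with the increasing ones in the norm.\<close>

lemma minor_sorted:
  assumes "inj_on \<sigma> {..<j}"
  shows "\<bar>minor j w (\<lambda>a. sorted_list_of_set (\<sigma> ` {..<j}) ! a)\<bar> = \<bar>minor j w \<sigma>\<bar>"
proof -
  let ?I = "\<sigma> ` {..<j}"
  let ?xs = "sorted_list_of_set ?I"
  have len: "length ?xs = j" using assms by (simp add: card_image)
  have nth: "bij_betw (\<lambda>a. ?xs ! a) {..<j} ?I"
    by (rule bij_betw_nth) (use len in auto)
  have inv: "bij_betw (the_inv_into {..<j} \<sigma>) ?I {..<j}"
    by (rule bij_betw_the_inv_into) (use assms in \<open>auto simp: bij_betw_def\<close>)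
  define p where "p a = (if a < j then the_inv_into {..<j} \<sigma> (?xs ! a) else a)" for a
  have "bij_betw (the_inv_into {..<j} \<sigma> \<circ> (\<lambda>a. ?xs ! a)) {..<j} {..<j}"
    by (rule bij_betw_trans[OF nth inv])
  then have "bij_betw p {..<j} {..<j}"
    by (rule bij_betw_cong[THEN iffD1, rotated]) (auto simp: p_def)
  then have p: "p permutes {..<j}" by (rule bij_imp_permutes) (auto simp: p_def)
  have "\<sigma> (p a) = ?xs ! a" if "a < j" for a
    using that bij_betwE[OF nth] assms by (auto simp: p_def intro!: f_the_inv_into_f)
  then have "minor j w (\<lambda>a. ?xs ! a) = ldet j (\<lambda>a k. w k (\<sigma> (p a)))"
    unfolding minor_def by (intro ldet_cong) auto
  then show ?thesis using ldet_permute_rows[OF p, of "\<lambda>a k. w k (\<sigma> a)"] by (simp add: minor_def)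
qed

lemma wedge_norm_alt:
  "wedge_norm n j w = Max {\<bar>minor j w (\<lambda>a. sorted_list_of_set I ! a)\<bar> | I. I \<subseteq> {0..n} \<and> card I = j}"
  by (simp add: wedge_norm_def minor_def)

lemma finite_minors: "finite {\<bar>minor j w (\<lambda>a. sorted_list_of_set I ! a)\<bar> | I. I \<subseteq> {0..n} \<and> card I = j}"
  by (rule finite_subset[of _ "(\<lambda>I. \<bar>minor j w (\<lambda>a. sorted_list_of_set I ! a)\<bar>) ` Pow {0..n}"]) auto

lemma wedge_norm_attained:
  assumes "j \<le> Suc n"
  obtains \<sigma> where "row_choice n j \<sigma>" "inj_on \<sigma> {..<j}" "wedge_norm n j w = \<bar>minor j w \<sigma>\<bar>"
proof -
  obtain I0 where "I0 \<subseteq> {0..n}" "card I0 = j"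
    using obtain_subset_with_card_n[of j "{0..n}"] assms by auto
  then have "{\<bar>minor j w (\<lambda>a. sorted_list_of_set I ! a)\<bar> | I. I \<subseteq> {0..n} \<and> card I = j} \<noteq> {}" by blast
  from Max_in[OF finite_minors this] obtain I where I: "I \<subseteq> {0..n}" "card I = j"
    "wedge_norm n j w = \<bar>minor j w (\<lambda>a. sorted_list_of_set I ! a)\<bar>"
    unfolding wedge_norm_alt by blast
  have "finite I" using I(1) finite_subset by blast
  then have "bij_betw (\<lambda>a. sorted_list_of_set I ! a) {..<j} I"
    by (intro bij_betw_nth) (use I in auto)
  then show ?thesis using that[OF _ _ I(3)] I(1) unfolding row_choice_def bij_betw_def
    by (metis atLeast0AtMost)
qed

lemma wedge_norm_nonneg: "j \<le> Suc n \<Longrightarrow> 0 \<le> wedge_norm n j w"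
  by (rule wedge_norm_attained[of j n w]) auto

lemma minor_le_wedge_norm:
  assumes "row_choice n j \<sigma>" "j \<le> Suc n"
  shows "\<bar>minor j w \<sigma>\<bar> \<le> wedge_norm n j w"
proof (cases "inj_on \<sigma> {..<j}")
  case True
  then have "\<bar>minor j w \<sigma>\<bar> \<in> {\<bar>minor j w (\<lambda>a. sorted_list_of_set I ! a)\<bar> | I. I \<subseteq> {0..n} \<and> card I = j}"
    using assms(1) minor_sorted[OF True, of w]
    by (auto simp: row_choice_def card_image atLeast0AtMost intro!: exI[of _ "\<sigma> ` {..<j}"])
  then show ?thesis unfolding wedge_norm_alt by (rule Max_ge[OF finite_minors])
qed (simp add: minor_not_inj wedge_norm_nonneg assms(2))

lemma minor_lincomb:
  assumes "\<And>k i. k < j \<Longrightarrow> i \<le> n \<Longrightarrow> w k i = (\<Sum>l<j. A k l * w' l i)" "row_choice n j \<sigma>"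
  shows "minor j w \<sigma> = ldet j A * minor j w' \<sigma>"
proof -
  have "minor j w \<sigma> = ldet j (\<lambda>a k. \<Sum>l<j. w' l (\<sigma> a) * A k l)"
    unfolding minor_def
    by (rule ldet_cong) (use assms in \<open>auto simp: row_choice_def mult.commute image_subset_iff\<close>)
  also have "\<dots> = minor j w' \<sigma> * ldet j (\<lambda>l k. A k l)"
    unfolding minor_def by (rule ldet_mult)
  finally show ?thesis using ldet_transpose[of j A] by simp
qed

text \<open>A change of vectors multiplies all minors by the same determinant. Hence norms of
  families with one common span keep their ratio under every linear map.\<close>

lemma wedge_norm_lincomb:
  assumes A: "\<And>k i. k < j \<Longrightarrow> i \<le> n \<Longrightarrow> w k i = (\<Sum>l<j. A k l * w' l i)" and j: "j \<le> Suc n"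
  shows "wedge_norm n j w = \<bar>ldet j A\<bar> * wedge_norm n j w'"
proof (rule antisym)
  obtain \<sigma> where s: "row_choice n j \<sigma>" "wedge_norm n j w = \<bar>minor j w \<sigma>\<bar>"
    using wedge_norm_attained[OF j] by metis
  then show "wedge_norm n j w \<le> \<bar>ldet j A\<bar> * wedge_norm n j w'"
    using minor_lincomb[OF A s(1)] minor_le_wedge_norm[OF s(1) j, of w']
    by (simp add: abs_mult mult_left_mono)
  obtain \<sigma> where s: "row_choice n j \<sigma>" "wedge_norm n j w' = \<bar>minor j w' \<sigma>\<bar>"
    using wedge_norm_attained[OF j] by metis
  then show "\<bar>ldet j A\<bar> * wedge_norm n j w' \<le> wedge_norm n j w"
    using minor_lincomb[OF A s(1)] minor_le_wedge_norm[OF s(1) j, of w] by (simp add: abs_mult)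
qed

text \<open>Independence is encoded by a nonvanishing minor, so that it amounts to positivity of the
  wedge norm and can be extended by adding a row and a column.\<close>

definition indep :: "nat \<Rightarrow> nat \<Rightarrow> (nat \<Rightarrow> nat \<Rightarrow> real) \<Rightarrow> bool" where
  "indep n j w \<longleftrightarrow> (\<exists>\<sigma>. row_choice n j \<sigma> \<and> minor j w \<sigma> \<noteq> 0)"

text \<open>Coordinates beyond \<open>n\<close> are left free, so equality of these sets is equality
  of subspaces of R^(n+1).\<close>

definition lspan :: "nat \<Rightarrow> nat \<Rightarrow> (nat \<Rightarrow> nat \<Rightarrow> real) \<Rightarrow> (nat \<Rightarrow> real) set" where
  "lspan n j w = {v. \<exists>c. \<forall>i\<le>n. v i = (\<Sum>k<j. c k * w k i)}"

lemma indep_le: "indep n j w \<Longrightarrow> j \<le> Suc n"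
proof -
  assume "indep n j w"
  then obtain \<sigma> where s: "\<sigma> ` {..<j} \<subseteq> {..n}" "minor j w \<sigma> \<noteq> 0"
    by (auto simp: indep_def row_choice_def)
  then have "inj_on \<sigma> {..<j}" using minor_not_inj by blast
  then have "card (\<sigma> ` {..<j}) = j" by (simp add: card_image)
  then show ?thesis using card_mono[OF _ s(1)] by simp
qed

lemma indep_iff_wedge_norm: "j \<le> Suc n \<Longrightarrow> indep n j w \<longleftrightarrow> 0 < wedge_norm n j w"
proof -
  assume j: "j \<le> Suc n"
  obtain \<sigma> where s: "row_choice n j \<sigma>" "wedge_norm n j w = \<bar>minor j w \<sigma>\<bar>"
    using wedge_norm_attained[OF j] by metis
  have "0 < wedge_norm n j w" if "row_choice n j \<tau>" "minor j w \<tau> \<noteq> 0" for \<tau>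
    using minor_le_wedge_norm[OF that(1) j, of w] that(2) by linarith
  then show ?thesis unfolding indep_def using s by auto
qed

lemma lspanI: "(\<And>i. i \<le> n \<Longrightarrow> v i = (\<Sum>k<j. c k * w k i)) \<Longrightarrow> v \<in> lspan n j w"
  unfolding lspan_def by (intro CollectI exI[of _ c]) simp

lemma lspan_coeffs:
  assumes "\<And>k. k < j \<Longrightarrow> w k \<in> lspan n m w'"
  obtains d where "\<And>k i. k < j \<Longrightarrow> i \<le> n \<Longrightarrow> w k i = (\<Sum>l<m. d k l * w' l i)"
proof -
  have "\<forall>k\<in>{..<j}. \<exists>d. \<forall>i\<le>n. w k i = (\<Sum>l<m. d l * w' l i)"
    using assms unfolding lspan_def by simp
  from bchoice[OF this] show ?thesis using that by auto
qed

lemma lspan_base: "k < j \<Longrightarrow> w k \<in> lspan n j w"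
  unfolding lspan_def
proof (intro CollectI exI allI impI)
  fix i assume "k < j"
  then have "w k i = (\<Sum>l<j. if l = k then w k i else 0)" by simp
  also have "\<dots> = (\<Sum>l<j. (if l = k then 1 else 0) * w l i)" by (rule sum.cong) auto
  finally show "w k i = (\<Sum>l<j. (if l = k then 1 else 0) * w l i)" .
qed

lemma lspan_mono:
  assumes "\<And>k. k < j \<Longrightarrow> w k \<in> lspan n j' w'"
  shows "lspan n j w \<subseteq> lspan n j' w'"
proof
  fix v assume "v \<in> lspan n j w"
  then obtain c where c: "\<And>i. i \<le> n \<Longrightarrow> v i = (\<Sum>k<j. c k * w k i)" by (auto simp: lspan_def)
  obtain d where d: "\<And>k i. k < j \<Longrightarrow> i \<le> n \<Longrightarrow> w k i = (\<Sum>l<j'. d k l * w' l i)"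
    using lspan_coeffs[of j w n j' w'] assms by blast
  have "v i = (\<Sum>l<j'. (\<Sum>k<j. c k * d k l) * w' l i)" if "i \<le> n" for i
  proof -
    have "v i = (\<Sum>k<j. \<Sum>l<j'. c k * d k l * w' l i)"
      unfolding c[OF that] by (rule sum.cong) (auto simp: d that sum_distrib_left mult_ac)
    also have "\<dots> = (\<Sum>l<j'. \<Sum>k<j. c k * d k l * w' l i)" by (rule sum.swap)
    finally show ?thesis by (simp add: sum_distrib_right)
  qed
  then show "v \<in> lspan n j' w'" by (rule lspanI)
qed

text \<open>Padding \<open>w'\<close> with zero vectors to length \<open>j\<close> makes every minor
  of \<open>w\<close> a multiple of a determinant with a zero column.\<close>

lemma not_indep_excess:
  assumes "\<And>k. k < j \<Longrightarrow> w k \<in> lspan n m w'" "m < j"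
  shows "\<not> indep n j w"
proof -
  obtain d where d: "\<And>k i. k < j \<Longrightarrow> i \<le> n \<Longrightarrow> w k i = (\<Sum>l<m. d k l * w' l i)"
    using lspan_coeffs[of j w n m w'] assms(1) by blast
  define w0 where "w0 l i = (if l < m then w' l i else 0)" for l i
  have "w k i = (\<Sum>l<j. d k l * w0 l i)" if "k < j" "i \<le> n" for k i
    unfolding d[OF that] by (rule sum.mono_neutral_cong_left) (use assms(2) in \<open>auto simp: w0_def\<close>)
  then have "minor j w \<sigma> = ldet j d * minor j w0 \<sigma>" if "row_choice n j \<sigma>" for \<sigma>
    by (rule minor_lincomb) (use that in auto)
  moreover have "minor j w0 \<sigma> = 0" for \<sigma>
    unfolding minor_def by (rule ldet_zero_column[of m]) (use assms(2) in \<open>auto simp: w0_def\<close>)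
  ultimately show ?thesis by (auto simp: indep_def)
qed

text \<open>Cramer's rule: if all minors of order j+1 vanish, expand the one with rows
  \<open>\<sigma>\<close> and \<open>i\<close> along row \<open>i\<close>. The coefficients do not
  depend on \<open>i\<close>, and that of \<open>v\<close> is the given nonzero minor.\<close>

lemma indep_extend:
  assumes "indep n j w" "v \<notin> lspan n j w"
  shows "indep n (Suc j) (w(j := v))"
proof (rule ccontr)
  assume dep: "\<not> ?thesis"
  obtain \<sigma> where s: "row_choice n j \<sigma>" "minor j w \<sigma> \<noteq> 0" using assms(1) by (auto simp: indep_def)
  \<comment> \<open>The conditional summand replaces column \<open>j\<close> by \<open>v\<close> and
    disappears in the leading block, so \<open>cof j\<close> is the old minor.\<close>
  obtain cof where cof: "cof j = minor j w \<sigma>"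
    "\<And>r. ldet (Suc j) (\<lambda>a b. if a = j then r b else w b (\<sigma> a) + (if b = j then v (\<sigma> a) - w b (\<sigma> a) else 0)) = (\<Sum>k\<le>j. r k * cof k)"
    using ldet_last_row_expansion[of j "\<lambda>a b. w b (\<sigma> a) + (if b = j then v (\<sigma> a) - w b (\<sigma> a) else 0)"]
    unfolding minor_def by (auto cong: ldet_cong)
  have "v i = (\<Sum>k<j. (- cof k / cof j) * w k i)" if "i \<le> n" for i
  proof -
    have "row_choice n (Suc j) (\<sigma>(j := i))"
      using s(1) that by (auto simp: row_choice_def image_subset_iff)
    then have "minor (Suc j) (w(j := v)) (\<sigma>(j := i)) = 0" using dep by (auto simp: indep_def)
    also have "minor (Suc j) (w(j := v)) (\<sigma>(j := i)) =
        ldet (Suc j) (\<lambda>a b. if a = j then (w(j := v)) b i else w b (\<sigma> a) + (if b = j then v (\<sigma> a) - w b (\<sigma> a) else 0))"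
      unfolding minor_def by (rule ldet_cong) auto
    also have "\<dots> = (\<Sum>k\<le>j. (w(j := v)) k i * cof k)" by (rule cof)
    also have "\<dots> = (\<Sum>k<j. w k i * cof k) + v i * cof j"
      by (simp add: lessThan_Suc_atMost[symmetric])
    finally have "v i = - (\<Sum>k<j. w k i * cof k) / cof j"
      using s(2) cof(1) by (simp add: field_simps)
    then show ?thesis by (simp add: sum_divide_distrib sum_negf mult.commute)
  qed
  then have "v \<in> lspan n j w" by (rule lspanI)
  then show False using assms(2) by contradiction
qed

lemma lspan_subset_length:
  assumes "indep n j w" "lspan n j w \<subseteq> lspan n j' w'"
  shows "j \<le> j'"
proof (rule ccontr)
  assume "\<not> j \<le> j'"
  then have "\<not> indep n j w"
    by (intro not_indep_excess[of j w n j' w'] subsetD[OF assms(2)] lspan_base) auto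
  then show False using assms(1) by contradiction
qed

text \<open>A vector of the larger span outside the smaller one would give j+1 independent vectors
  in a space spanned by j.\<close>

lemma lspan_subset_eq:
  assumes "indep n j w" "lspan n j w \<subseteq> lspan n j w'"
  shows "lspan n j w = lspan n j w'"
proof -
  have "w' k \<in> lspan n j w" if "k < j" for k
  proof (rule ccontr)
    assume "w' k \<notin> lspan n j w"
    then have "indep n (Suc j) (w(j := w' k))" by (rule indep_extend[OF assms(1)])
    moreover have "(w(j := w' k)) l \<in> lspan n j w'" if "l < Suc j" for l
    proof (cases "l = j")
      case False
      then show ?thesis using that subsetD[OF assms(2) lspan_base[of l j w n]] by simp
    qed (simp add: lspan_base \<open>k < j\<close>)
    then have "\<not> indep n (Suc j) (w(j := w' k))"
      by (rule not_indep_excess) auto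
    ultimately show False by contradiction
  qed
  then have "lspan n j w' \<subseteq> lspan n j w" by (rule lspan_mono)
  then show ?thesis using assms(2) by (rule subset_antisym[rotated])
qed

section \<open>The flow, integer lattices and covolumes\<close>

definition flow :: "nat \<Rightarrow> real \<Rightarrow> (nat \<Rightarrow> real) \<Rightarrow> nat \<Rightarrow> nat \<Rightarrow> real" where
  "flow n t y = mat_mult n (g_mat n t) (u_mat n y)"

definition flow_vec :: "nat \<Rightarrow> real \<Rightarrow> (nat \<Rightarrow> real) \<Rightarrow> (nat \<Rightarrow> real) \<Rightarrow> nat \<Rightarrow> real" where
  "flow_vec n t y v = mat_vec n (flow n t y) v"

lemma flow_entry: "i \<le> n \<Longrightarrow> flow n t y i k = g_mat n t i i * u_mat n y i k"
proof -
  assume i: "i \<le> n"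
  have "flow n t y i k = (\<Sum>l\<le>n. if l = i then g_mat n t i i * u_mat n y i k else 0)"
    unfolding flow_def mat_mult_def by (rule sum.cong) (auto simp: g_mat_def)
  then show ?thesis using i by simp
qed

text \<open>This is the only coordinate in which \<open>y\<close> occurs; compare
  \<open>flow_vec_pos\<close>. Covolumes are maxima of affine functions of \<open>y\<close> in
  absolute value for this reason.\<close>

lemma flow_vec_0: "flow_vec n t y v 0 = exp t * (v 0 + (\<Sum>i\<in>{1..n}. y i * v i))"
proof -
  have *: "{..n} = insert 0 {1..n}" by auto
  have "flow_vec n t y v 0 = (\<Sum>k\<le>n. exp t * (u_mat n y 0 k * v k))"
    unfolding flow_vec_def mat_vec_def by (simp add: flow_entry g_mat_def mult_ac)
  also have "\<dots> = exp t * (\<Sum>k\<le>n. u_mat n y 0 k * v k)" by (simp add: sum_distrib_left)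
  also have "(\<Sum>k\<le>n. u_mat n y 0 k * v k) = v 0 + (\<Sum>k\<in>{1..n}. u_mat n y 0 k * v k)"
    unfolding * by (simp add: u_mat_def)
  also have "(\<Sum>k\<in>{1..n}. u_mat n y 0 k * v k) = (\<Sum>i\<in>{1..n}. y i * v i)"
    by (rule sum.cong) (auto simp: u_mat_def)
  finally show ?thesis .
qed

lemma flow_vec_pos:
  assumes "1 \<le> i" "i \<le> n"
  shows "flow_vec n t y v i = exp (- t / n) * v i"
proof -
  have "flow_vec n t y v i = (\<Sum>k\<le>n. if k = i then exp (- t / n) * v i else 0)"
  proof -
    have "flow n t y i k * v k = (if k = i then exp (- t / n) * v i else 0)" if "k \<le> n" for k
      using assms that by (auto simp: flow_entry g_mat_def u_mat_def)
    then show ?thesis unfolding flow_vec_def mat_vec_def using assms by (auto intro!: sum.cong)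
  qed
  then show ?thesis using assms by simp
qed

lemma flow_vec_lincomb:
  assumes "\<And>i. i \<le> n \<Longrightarrow> v i = (\<Sum>l<j. c l * w l i)" "i \<le> n"
  shows "flow_vec n t y v i = (\<Sum>l<j. c l * flow_vec n t y (w l) i)"
proof -
  have "flow_vec n t y v i = (\<Sum>k\<le>n. \<Sum>l<j. c l * (flow n t y i k * w l k))"
    unfolding flow_vec_def mat_vec_def
    using assms by (auto simp: sum_distrib_left mult_ac intro!: sum.cong)
  also have "\<dots> = (\<Sum>l<j. \<Sum>k\<le>n. c l * (flow n t y i k * w l k))" by (rule sum.swap)
  finally show ?thesis
    unfolding flow_vec_def mat_vec_def using assms(2) by (simp add: sum_distrib_left)
qed

text \<open>
  With \<open>\<Gamma>\<close> the subgroup generated by the list \<open>vs\<close>, the number \<open>covol n t y vs\<close> below is the paper's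
  \<open>\<parallel>g\<^sub>t u\<^sub>y \<Gamma>\<parallel>\<close>, and \<open>height n vs\<close> is \<open>\<parallel>\<Gamma>\<parallel>\<close>.
\<close>

definition rvec :: "(nat \<Rightarrow> int) list \<Rightarrow> nat \<Rightarrow> nat \<Rightarrow> real" where
  "rvec vs k i = real_of_int ((vs ! k) i)"

definition covol :: "nat \<Rightarrow> real \<Rightarrow> (nat \<Rightarrow> real) \<Rightarrow> (nat \<Rightarrow> int) list \<Rightarrow> real" where
  "covol n t y vs = wedge_norm n (length vs) (\<lambda>k. flow_vec n t y (rvec vs k))"

definition height :: "nat \<Rightarrow> (nat \<Rightarrow> int) list \<Rightarrow> real" where
  "height n vs = wedge_norm n (length vs) (rvec vs)"

text \<open>The first conjunct places the vectors in Z^(n+1). Independence is asked over the reals,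
  where minors detect it; independence over the integers follows.\<close>

definition int_indep :: "nat \<Rightarrow> (nat \<Rightarrow> int) list \<Rightarrow> bool" where
  "int_indep n vs \<longleftrightarrow> (\<forall>v\<in>set vs. \<forall>i>n. v i = 0) \<and> indep n (length vs) (rvec vs)"

definition rspan :: "nat \<Rightarrow> (nat \<Rightarrow> int) list \<Rightarrow> (nat \<Rightarrow> real) set" where
  "rspan n vs = lspan n (length vs) (rvec vs)"

lemma int_indep_length: "int_indep n vs \<Longrightarrow> length vs \<le> Suc n"
  unfolding int_indep_def using indep_le by blast

lemma covol_lincomb:
  assumes "length vs = length ws" "length vs \<le> Suc n"
    "\<And>k i. k < length vs \<Longrightarrow> i \<le> n \<Longrightarrow> rvec vs k i = (\<Sum>l<length vs. A k l * rvec ws l i)"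
  shows "covol n t y vs = \<bar>ldet (length vs) A\<bar> * covol n t y ws"
proof -
  have "flow_vec n t y (rvec vs k) i = (\<Sum>l<length vs. A k l * flow_vec n t y (rvec ws l) i)"
    if "k < length vs" "i \<le> n" for k i
    by (rule flow_vec_lincomb) (use assms(3) that in auto)
  from wedge_norm_lincomb[OF this assms(2)] show ?thesis
    unfolding covol_def assms(1)[symmetric] by simp
qed

lemma height_lincomb:
  assumes "length vs = length ws" "length vs \<le> Suc n"
    "\<And>k i. k < length vs \<Longrightarrow> i \<le> n \<Longrightarrow> rvec vs k i = (\<Sum>l<length vs. A k l * rvec ws l i)"
  shows "height n vs = \<bar>ldet (length vs) A\<bar> * height n ws"
  using wedge_norm_lincomb[OF assms(3,2)] unfolding height_def assms(1)[symmetric] by simp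

lemma height_Ints: "length vs \<le> Suc n \<Longrightarrow> height n vs \<in> \<int>"
  unfolding height_def
  by (rule wedge_norm_attained[of "length vs" n "rvec vs"])
     (auto simp: minor_def rvec_def intro!: Ints_abs ldet_Ints)

lemma height_pos: "int_indep n vs \<Longrightarrow> 0 < height n vs"
  using indep_iff_wedge_norm[OF int_indep_length] unfolding int_indep_def height_def by blast

text \<open>Height and covolume are scaled by the same determinant of the base change, so a
  comparison that ignores \<open>t\<close> and \<open>y\<close> transfers to all of them.\<close>

lemma covol_le_of_height_le:
  assumes "int_indep n vs" "int_indep n ws" "length vs = length ws" "rspan n vs \<subseteq> rspan n ws"
    and h: "height n ws \<le> height n vs"
  shows "covol n t y ws \<le> covol n t y vs"
proof -
  note len = int_indep_length[OF assms(1)]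
  have "rvec vs k \<in> lspan n (length vs) (rvec ws)" if "k < length vs" for k
    using lspan_base[OF that, of "rvec vs" n] assms(3,4) by (auto simp: rspan_def)
  then obtain A where A: "\<And>k i. k < length vs \<Longrightarrow> i \<le> n \<Longrightarrow> rvec vs k i = (\<Sum>l<length vs. A k l * rvec ws l i)"
    using lspan_coeffs[of "length vs" "rvec vs" n "length vs" "rvec ws"] by blast
  have "1 * height n ws \<le> \<bar>ldet (length vs) A\<bar> * height n ws"
    using h height_lincomb[OF assms(3) len A] by simp
  then have "1 \<le> \<bar>ldet (length vs) A\<bar>"
    using height_pos[OF assms(2)] by (rule mult_right_le_imp_le)
  then have "1 * covol n t y ws \<le> \<bar>ldet (length vs) A\<bar> * covol n t y ws"
    unfolding covol_def using len assms(3) by (intro mult_right_mono wedge_norm_nonneg) auto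
  then show ?thesis using covol_lincomb[OF assms(3) len A] by simp
qed

text \<open>
  Instead of requiring \<open>\<Gamma>\<close> to be the intersection of \<open>\<int>\<^bsup>n+1\<^esup>\<close> with its real span, primitivity is expressed by
  minimal height within the span. Heights are integers, so a minimum exists, and covolumes
  within one span are proportional, so it minimises all of them at once.
\<close>

definition primitive :: "nat \<Rightarrow> (nat \<Rightarrow> int) list \<Rightarrow> bool" where
  "primitive n vs \<longleftrightarrow> int_indep n vs \<and>
     (\<forall>ws. int_indep n ws \<and> length ws = length vs \<and> rspan n ws = rspan n vs \<longrightarrow> height n vs \<le> height n ws)"

lemma primitive_exists:
  assumes "int_indep n vs"
  obtains p where "primitive n p" "length p = length vs" "rspan n p = rspan n vs"
    "\<And>t y. covol n t y p \<le> covol n t y vs"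
proof -
  define Q where "Q ws \<longleftrightarrow> int_indep n ws \<and> length ws = length vs \<and> rspan n ws = rspan n vs" for ws
  have "\<exists>p. Q p \<and> (\<forall>ws. Q ws \<longrightarrow> nat \<lfloor>height n p\<rfloor> \<le> nat \<lfloor>height n ws\<rfloor>)"
    by (rule ex_has_least_nat[of Q vs]) (simp add: Q_def assms)
  then obtain p where p: "Q p" "\<And>ws. Q ws \<Longrightarrow> nat \<lfloor>height n p\<rfloor> \<le> nat \<lfloor>height n ws\<rfloor>" by blast
  have le: "height n p \<le> height n ws" if "Q ws" for ws
  proof -
    have "real_of_int \<lfloor>height n us\<rfloor> = height n us" "0 < height n us" if "Q us" for us
      using that height_Ints[of us n] height_pos[of n us] int_indep_length[of n us]
      unfolding Q_def by (auto simp: Ints_def)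
    moreover have "\<lfloor>height n p\<rfloor> \<le> \<lfloor>height n ws\<rfloor>"
      using p(2)[OF that] calculation[OF that] by linarith
    ultimately show ?thesis using p(1) that by (metis of_int_le_iff)
  qed
  show ?thesis
  proof (rule that)
    show "primitive n p" using p(1) le unfolding primitive_def Q_def by simp
    show "length p = length vs" "rspan n p = rspan n vs" using p(1) by (auto simp: Q_def)
    show "covol n t y p \<le> covol n t y vs" for t y
      using p(1) assms le[of vs] by (intro covol_le_of_height_le) (auto simp: Q_def)
  qed
qed

section \<open>Integer spans, bases and the norm of a subgroup\<close>

definition zspan :: "(nat \<Rightarrow> int) list \<Rightarrow> (nat \<Rightarrow> int) set" where
  "zspan vs = {(\<lambda>i. \<Sum>k<length vs. c k * (vs ! k) i) | c :: nat \<Rightarrow> int. True}"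

lemma zspan_base:
  assumes k: "k < length vs"
  shows "vs ! k \<in> zspan vs"
proof -
  have "(vs ! k) i = (\<Sum>l<length vs. (if l = k then 1 else 0) * (vs ! l) i)" for i
  proof -
    have "(vs ! k) i = (\<Sum>l<length vs. if l = k then (vs ! k) i else 0)" using k by simp
    also have "\<dots> = (\<Sum>l<length vs. (if l = k then 1 else 0) * (vs ! l) i)" by (rule sum.cong) auto
    finally show ?thesis .
  qed
  then show ?thesis
    unfolding zspan_def by (intro CollectI exI[of _ "\<lambda>l. if l = k then 1 else 0"]) auto
qed

lemma is_zbasis_zspan: "is_zbasis n \<Gamma> vs \<Longrightarrow> \<Gamma> = zspan vs"
  by (simp add: is_zbasis_def zspan_def)

lemma zspanD: "v \<in> zspan vs \<Longrightarrow> \<exists>c. \<forall>i. v i = (\<Sum>k<length vs. c k * (vs ! k) i)"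
  unfolding zspan_def by auto

lemma is_zbasis_length:
  assumes "is_zbasis n \<Gamma> vs" "is_zbasis n \<Gamma> ws"
  shows "length vs = length ws"
proof -
  have coeffs: "\<exists>A. \<forall>k<length us. \<forall>i. (us ! k) i = (\<Sum>l<length xs. A k l * (xs ! l) i)"
    if us: "is_zbasis n \<Gamma> us" and xs: "is_zbasis n \<Gamma> xs" for us xs
  proof -
    have "\<exists>c. \<forall>i. (us ! k) i = (\<Sum>l<length xs. c l * (xs ! l) i)" if k: "k < length us" for k
    proof -
      have "us ! k \<in> zspan xs"
        using zspan_base[OF k] is_zbasis_zspan[OF us] is_zbasis_zspan[OF xs] by simp
      then show ?thesis by (rule zspanD)
    qed
    then have "\<forall>k\<in>{..<length us}. \<exists>c. \<forall>i. (us ! k) i = (\<Sum>l<length xs. c l * (xs ! l) i)" by simp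
    from bchoice[OF this] show ?thesis unfolding Ball_def lessThan_iff .
  qed
  \<comment> \<open>The change of basis matrices are inverse to each other; comparing the traces of \<open>AB\<close> and \<open>BA\<close> shows that they are square.\<close>
  have comp: "(\<Sum>l<length xs. A k l * B l m) = (if k = m then 1 else 0)"
    if us: "is_zbasis n \<Gamma> us" and A: "\<forall>k<length us. \<forall>i. (us ! k) i = (\<Sum>l<length xs. A k l * (xs ! l) i)"
      and B: "\<forall>k<length xs. \<forall>i. (xs ! k) i = (\<Sum>l<length us. B k l * (us ! l) i)"
      and km: "k < length us" "m < length us" for us xs A B k m
  proof -
    define c where "c m = (\<Sum>l<length xs. A k l * B l m) - (if k = m then 1 else 0)" for m
    have "(\<Sum>m<length us. c m * (us ! m) i) = 0" for i
    proof -
      have "(us ! k) i = (\<Sum>l<length xs. \<Sum>m<length us. A k l * B l m * (us ! m) i)"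
        using A B km by (auto simp: sum_distrib_left mult_ac intro!: sum.cong)
      also have "\<dots> = (\<Sum>m<length us. \<Sum>l<length xs. A k l * B l m * (us ! m) i)" by (rule sum.swap)
      finally have 1: "(us ! k) i = (\<Sum>m<length us. (\<Sum>l<length xs. A k l * B l m) * (us ! m) i)"
        by (simp add: sum_distrib_right)
      have "(us ! k) i = (\<Sum>m<length us. if m = k then (us ! k) i else 0)" using km by simp
      also have "\<dots> = (\<Sum>m<length us. (if k = m then 1 else 0) * (us ! m) i)"
        by (rule sum.cong) auto
      finally show ?thesis using 1 by (simp add: c_def left_diff_distrib sum_subtractf)
    qed
    then have "c m = 0" using us km(2) unfolding is_zbasis_def by blast
    then show ?thesis by (simp add: c_def)
  qed
  obtain A where A: "\<forall>k<length vs. \<forall>i. (vs ! k) i = (\<Sum>l<length ws. A k l * (ws ! l) i)"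
    using coeffs[OF assms] by blast
  obtain B where B: "\<forall>k<length ws. \<forall>i. (ws ! k) i = (\<Sum>l<length vs. B k l * (vs ! l) i)"
    using coeffs[OF assms(2,1)] by blast
  have "int (length vs) = (\<Sum>k<length vs. \<Sum>l<length ws. A k l * B l k)"
    using comp[OF assms(1) A B] by simp
  also have "\<dots> = (\<Sum>l<length ws. \<Sum>k<length vs. A k l * B l k)" by (rule sum.swap)
  also have "\<dots> = (\<Sum>l<length ws. \<Sum>k<length vs. B l k * A k l)" by (simp only: mult.commute)
  also have "\<dots> = int (length ws)" using comp[OF assms(2) B A] by simp
  finally show ?thesis by simp
qed

lemma int_indep_zbasis:
  assumes "int_indep n vs"
  shows "is_zbasis n (zspan vs) vs"
proof -
  obtain \<sigma> where s: "minor (length vs) (rvec vs) \<sigma> \<noteq> 0"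
    using assms by (auto simp: int_indep_def indep_def)
  have "c k = 0" if c: "\<forall>i. (\<Sum>k<length vs. c k * (vs ! k) i) = 0" and k: "k < length vs" for c :: "nat \<Rightarrow> int" and k
  proof -
    have "(\<Sum>k<length vs. rvec vs k (\<sigma> a) * real_of_int (c k)) = 0" for a
    proof -
      have "(\<Sum>k<length vs. rvec vs k (\<sigma> a) * real_of_int (c k)) = real_of_int (\<Sum>k<length vs. c k * (vs ! k) (\<sigma> a))"
        by (simp add: rvec_def mult.commute)
      then show ?thesis using c by simp
    qed
    then have "real_of_int (c k) = 0"
      using ldet_kernel_trivial[OF s[unfolded minor_def], of "\<lambda>k. real_of_int (c k)"] k by blast
    then show ?thesis by simp
  qed
  then show ?thesis using assms unfolding is_zbasis_def zspan_def int_indep_def by blast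
qed

lemma zspan_in_S_set: "int_indep n vs \<Longrightarrow> 1 \<le> length vs \<Longrightarrow> length vs \<le> n \<Longrightarrow> zspan vs \<in> S_set n"
  unfolding S_set_def using int_indep_zbasis by blast

lemma subgroup_norm_eq_covol:
  "subgroup_norm n (flow n t y) \<Gamma> = covol n t y (SOME vs. is_zbasis n \<Gamma> vs)"
  unfolding subgroup_norm_def covol_def flow_vec_def rvec_def Let_def ..

text \<open>The norm uses a basis picked by choice. The list \<open>vs\<close> is obtained from it
  by a nonsingular integer matrix, whose determinant is at least 1 in absolute value. In this
  direction lower bounds for norms become lower bounds for covolumes.\<close>

lemma subgroup_norm_le_covol:
  assumes vs: "int_indep n vs"
  shows "subgroup_norm n (flow n t y) (zspan vs) \<le> covol n t y vs"
proof -
  define ws where "ws = (SOME ws. is_zbasis n (zspan vs) ws)"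
  have ws: "is_zbasis n (zspan vs) ws"
    unfolding ws_def by (rule someI) (rule int_indep_zbasis[OF vs])
  have len: "length vs = length ws" by (rule is_zbasis_length[OF int_indep_zbasis[OF vs] ws])
  note len' = int_indep_length[OF vs]
  have "\<exists>c. \<forall>i. (vs ! k) i = (\<Sum>l<length vs. c l * (ws ! l) i)" if k: "k < length vs" for k
  proof -
    have "vs ! k \<in> zspan ws" using zspan_base[OF k] is_zbasis_zspan[OF ws] by simp
    from zspanD[OF this] show ?thesis by (simp add: len)
  qed
  then have "\<forall>k\<in>{..<length vs}. \<exists>c. \<forall>i. (vs ! k) i = (\<Sum>l<length vs. c l * (ws ! l) i)" by simp
  from bchoice[OF this] obtain A
    where A: "\<And>k i. k < length vs \<Longrightarrow> (vs ! k) i = (\<Sum>l<length vs. A k l * (ws ! l) i)"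
    by auto
  define A' where "A' k l = real_of_int (A k l)" for k l
  have A': "rvec vs k i = (\<Sum>l<length vs. A' k l * rvec ws l i)" if "k < length vs" "i \<le> n" for k i
    using A[OF that(1), of i] by (simp add: rvec_def A'_def)
  have "ldet (length vs) A' \<in> \<int>" by (rule ldet_Ints) (simp add: A'_def)
  moreover have "ldet (length vs) A' \<noteq> 0"
    using height_pos[OF vs] height_lincomb[OF len len' A'] by auto
  ultimately have "1 \<le> \<bar>ldet (length vs) A'\<bar>" by (rule Ints_nonzero_abs_ge1)
  then have "1 * covol n t y ws \<le> \<bar>ldet (length vs) A'\<bar> * covol n t y ws"
    unfolding covol_def using len len' by (intro mult_right_mono wedge_norm_nonneg) auto
  then show ?thesis
    using covol_lincomb[OF len len' A'] unfolding subgroup_norm_eq_covol ws_def[symmetric] by simp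
qed

section \<open>Flags of primitive subgroups and short vectors\<close>

text \<open>Injectivity lets row 0, the only one depending on \<open>x\<close>, occur at most once.
  The minor is linear in that row, hence affine in the values of \<open>f\<close>; without row 0 it
  is constant.\<close>

lemma minor_flow_affine:
  assumes s: "row_choice n j \<sigma>" "inj_on \<sigma> {..<j}"
  shows "\<exists>c. \<forall>x. minor j (\<lambda>k. flow_vec n t (\<lambda>i. f i x) (v k)) \<sigma> = lin_comb n f c x"
proof (cases "\<exists>a<j. \<sigma> a = 0")
  case True
  then obtain a0 where a0: "a0 < j" "\<sigma> a0 = 0" by blast
  \<comment> \<open>The value 0 in place of \<open>f\<close> is a placeholder: rows other than
    \<open>a0\<close> do not see it.\<close>
  define M where "M a b = flow_vec n t (\<lambda>_. 0) (v b) (\<sigma> a)" for a b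
  obtain cof where cof: "\<And>r. ldet j (\<lambda>a b. if a = a0 then r b else M a b) = (\<Sum>k<j. r k * cof k)"
    using ldet_row_linear[OF a0(1), of M] by blast
  define c where "c i = (\<Sum>k<j. exp t * v k i * cof k)" for i
  have "minor j (\<lambda>k. flow_vec n t (\<lambda>i. f i x) (v k)) \<sigma> = lin_comb n f c x" for x
  proof -
    have "flow_vec n t (\<lambda>i. f i x) (v b) (\<sigma> a) = M a b" if "a < j" "a \<noteq> a0" for a b
    proof -
      have "\<sigma> a \<noteq> 0" using that a0 inj_onD[OF s(2), of a a0] by auto
      moreover have "\<sigma> a \<le> n" using s(1) that by (auto simp: row_choice_def)
      ultimately show ?thesis unfolding M_def by (simp add: flow_vec_pos)
    qed
    then have "minor j (\<lambda>k. flow_vec n t (\<lambda>i. f i x) (v k)) \<sigma> =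
        ldet j (\<lambda>a b. if a = a0 then flow_vec n t (\<lambda>i. f i x) (v b) 0 else M a b)"
      unfolding minor_def by (intro ldet_cong) (auto simp: a0)
    also have "\<dots> = (\<Sum>k<j. flow_vec n t (\<lambda>i. f i x) (v k) 0 * cof k)" by (rule cof)
    also have "\<dots> = (\<Sum>k<j. exp t * v k 0 * cof k + (\<Sum>i\<in>{1..n}. f i x * (exp t * v k i * cof k)))"
      by (rule sum.cong) (simp_all add: flow_vec_0 distrib_left distrib_right sum_distrib_left sum_distrib_right mult_ac)
    also have "\<dots> = c 0 + (\<Sum>k<j. \<Sum>i\<in>{1..n}. f i x * (exp t * v k i * cof k))"
      by (simp add: sum.distrib c_def)
    also have "(\<Sum>k<j. \<Sum>i\<in>{1..n}. f i x * (exp t * v k i * cof k)) =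
        (\<Sum>i\<in>{1..n}. \<Sum>k<j. f i x * (exp t * v k i * cof k))" by (rule sum.swap)
    also have "\<dots> = (\<Sum>i\<in>{1..n}. c i * f i x)"
      unfolding c_def by (simp only: sum_distrib_left[symmetric] mult.commute)
    finally show ?thesis unfolding lin_comb_def .
  qed
  then show ?thesis by blast
next
  case False
  have "minor j (\<lambda>k. flow_vec n t (\<lambda>i. f i x) (v k)) \<sigma> = minor j (\<lambda>k. flow_vec n t (\<lambda>_. 0) (v k)) \<sigma>" for x
    unfolding minor_def
  proof (rule ldet_cong)
    fix a b assume "a < j"
    then have "1 \<le> \<sigma> a" "\<sigma> a \<le> n" using False s(1) by (auto simp: row_choice_def Suc_le_eq)
    then show "flow_vec n t (\<lambda>i. f i x) (v b) (\<sigma> a) = flow_vec n t (\<lambda>_. 0) (v b) (\<sigma> a)"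
      by (simp add: flow_vec_pos)
  qed
  then show ?thesis
    by (intro exI[of _ "\<lambda>i. if i = 0 then minor j (\<lambda>k. flow_vec n t (\<lambda>_. 0) (v k)) \<sigma> else 0"])
       (simp add: lin_comb_def)
qed

text \<open>The empty list stands for the trivial subgroup, from which
  \<open>flag_short_vector_bound\<close> starts when every flag member contains the short
  vector.\<close>

lemma covol_Nil: "covol n t y [] = 1"
proof -
  obtain \<sigma> where "covol n t y [] = \<bar>minor 0 (\<lambda>k. flow_vec n t y (rvec [] k)) \<sigma>\<bar>"
    unfolding covol_def using wedge_norm_attained[of 0 n] by (metis le0 list.size(3))
  then show ?thesis by (simp add: minor_def ldet_def)
qed

text \<open>The new vector is the last column of the minors: its entries are bounded by
  \<open>c\<close>, their cofactors are minors of \<open>vs\<close>.\<close>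

lemma covol_extend:
  assumes len: "length vs \<le> n" and c: "\<And>i. i \<le> n \<Longrightarrow> \<bar>flow_vec n t y (\<lambda>i. real_of_int (v i)) i\<bar> \<le> c"
  shows "covol n t y (vs @ [v]) \<le> real (Suc (length vs)) * c * covol n t y vs"
proof -
  let ?j = "length vs"
  let ?w = "\<lambda>k. flow_vec n t y (rvec (vs @ [v]) k)"
  have "Suc ?j \<le> Suc n" using len by simp
  then obtain \<sigma> where s: "row_choice n (Suc ?j) \<sigma>" "wedge_norm n (Suc ?j) ?w = \<bar>minor (Suc ?j) ?w \<sigma>\<bar>"
    using wedge_norm_attained by metis
  \<comment> \<open>The default value 0 keeps all values within the admissible rows, also after
    composition with an arbitrary \<open>\<tau>\<close>.\<close>
  define \<sigma>' where "\<sigma>' a = (if a < Suc ?j then \<sigma> a else 0)" for a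
  have s': "\<sigma>' a \<le> n" for a using s(1) by (auto simp: \<sigma>'_def row_choice_def image_subset_iff)
  have "minor (Suc ?j) ?w \<sigma> = minor (Suc ?j) ?w \<sigma>'"
    unfolding minor_def by (rule ldet_cong) (simp add: \<sigma>'_def)
  also have "\<bar>\<dots>\<bar> \<le> real (Suc ?j) * c * covol n t y vs"
    unfolding minor_def
  proof (rule ldet_last_column_bound)
    fix \<tau>
    have "ldet ?j (\<lambda>a k. ?w k (\<sigma>' (\<tau> a))) = minor ?j (\<lambda>k. flow_vec n t y (rvec vs k)) (\<lambda>a. \<sigma>' (\<tau> a))"
      unfolding minor_def by (rule ldet_cong) (simp add: rvec_def[abs_def] nth_append)
    also have "\<bar>\<dots>\<bar> \<le> covol n t y vs"
      unfolding covol_def by (rule minor_le_wedge_norm) (use len s' in \<open>auto simp: row_choice_def\<close>)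
    finally show "\<bar>ldet ?j (\<lambda>a k. ?w k (\<sigma>' (\<tau> a)))\<bar> \<le> covol n t y vs" .
  next
    fix a
    show "\<bar>?w ?j (\<sigma>' a)\<bar> \<le> c" using c[OF s'[of a]] by (simp add: rvec_def[abs_def])
  qed
  finally show ?thesis using s(2) by (simp add: covol_def)
qed

lemma ldet_flow:
  assumes "1 \<le> n"
  shows "ldet (Suc n) (flow n t y) = 1"
proof -
  have *: "{..<Suc n} = insert 0 {1..n}" by auto
  have "ldet (Suc n) (flow n t y) = (\<Prod>a<Suc n. flow n t y a a)"
    by (rule ldet_upper_triangular) (auto simp: flow_entry u_mat_def)
  also have "\<dots> = exp t * (\<Prod>a\<in>{1..n}. flow n t y a a)"
    unfolding * by (simp add: flow_entry g_mat_def u_mat_def)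
  also have "(\<Prod>a\<in>{1..n}. flow n t y a a) = (\<Prod>a\<in>{1..n}. exp (- t / n))"
    by (rule prod.cong) (auto simp: flow_entry g_mat_def u_mat_def)
  also have "\<dots> = exp (- t)" using assms by (simp add: exp_of_nat_mult[symmetric])
  finally show ?thesis by (simp add: exp_minus)
qed

text \<open>The flow has determinant 1, so the only minor, up to sign, with distinct rows is a
  nonzero integer determinant, unchanged by \<open>t\<close> and \<open>y\<close>.\<close>

lemma covol_full_rank:
  assumes vs: "int_indep n vs" "length vs = Suc n" and n: "1 \<le> n"
  shows "1 \<le> covol n t y vs"
proof -
  let ?V = "\<lambda>k a. rvec vs a k"
  obtain \<sigma> where s: "row_choice n (Suc n) \<sigma>" "minor (Suc n) (rvec vs) \<sigma> \<noteq> 0"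
    using vs by (auto simp: int_indep_def indep_def)
  have inj: "inj_on \<sigma> {..<Suc n}" using s(2) minor_not_inj by blast
  define p where "p a = (if a < Suc n then \<sigma> a else a)" for a
  have "\<sigma> ` {..<Suc n} \<subseteq> {..<Suc n}" using s(1) by (auto simp: row_choice_def)
  then have "bij_betw \<sigma> {..<Suc n} {..<Suc n}"
    using inj by (simp add: bij_betw_def endo_inj_surj)
  then have "bij_betw p {..<Suc n} {..<Suc n}"
    by (rule bij_betw_cong[THEN iffD1, rotated]) (auto simp: p_def)
  then have p: "p permutes {..<Suc n}" by (rule bij_imp_permutes) (auto simp: p_def)
  have "minor (Suc n) (rvec vs) \<sigma> = ldet (Suc n) (\<lambda>a k. ?V (p a) k)"
    unfolding minor_def by (rule ldet_cong) (simp add: p_def)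
  then have "ldet (Suc n) ?V \<noteq> 0" using s(2) ldet_permute_rows[OF p, of ?V] by auto
  moreover have "ldet (Suc n) ?V \<in> \<int>" by (rule ldet_Ints) (simp add: rvec_def)
  ultimately have 1: "1 \<le> \<bar>ldet (Suc n) ?V\<bar>" by (intro Ints_nonzero_abs_ge1)
  have "minor (Suc n) (\<lambda>k. flow_vec n t y (rvec vs k)) (\<lambda>a. a) =
      ldet (Suc n) (\<lambda>a k. \<Sum>l<Suc n. flow n t y a l * ?V l k)"
    unfolding minor_def flow_vec_def mat_vec_def
    by (rule ldet_cong) (simp add: lessThan_Suc_atMost)
  also have "\<dots> = ldet (Suc n) ?V" 
    using ldet_mult[of "Suc n" "flow n t y" ?V] ldet_flow[OF n, of t y] by (simp only: mult_1)
  finally have "\<bar>ldet (Suc n) ?V\<bar> \<le> covol n t y vs"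
    unfolding covol_def vs(2) using minor_le_wedge_norm[of n "Suc n" "\<lambda>a. a"]
    by (metis atMost_iff image_ident le_refl lessThan_Suc_atMost row_choice_def subset_refl)
  then show ?thesis using 1 by linarith
qed

definition flag_elems :: "nat \<Rightarrow> (nat \<Rightarrow> int) list set" where
  "flag_elems n = {p. primitive n p \<and> 1 \<le> length p \<and> length p \<le> n}"

text \<open>Inclusion must be proper. Two lists with the same span are therefore not nested, so a
  pairwise nested family meets each span, and indeed each rank, at most once.\<close>

definition nested :: "nat \<Rightarrow> (nat \<Rightarrow> int) list \<Rightarrow> (nat \<Rightarrow> int) list \<Rightarrow> bool" where
  "nested n p q \<longleftrightarrow> rspan n p \<subset> rspan n q \<or> rspan n q \<subset> rspan n p"

lemma rspan_subset_length: "int_indep n p \<Longrightarrow> rspan n p \<subseteq> rspan n q \<Longrightarrow> length p \<le> length q"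
  unfolding int_indep_def rspan_def using lspan_subset_length by blast

lemma rspan_subset_eq:
  "int_indep n p \<Longrightarrow> rspan n p \<subseteq> rspan n q \<Longrightarrow> length p = length q \<Longrightarrow> rspan n p = rspan n q"
  unfolding int_indep_def rspan_def using lspan_subset_eq by metis

lemma nested_length: "int_indep n p \<Longrightarrow> int_indep n q \<Longrightarrow> nested n p q \<Longrightarrow> length p \<noteq> length q"
  unfolding nested_def using rspan_subset_eq[of n p q] rspan_subset_eq[of n q p] by auto

lemma int_indep_Nil: "int_indep n []"
  by (auto simp: int_indep_def indep_def row_choice_def minor_def ldet_def)

lemma rspan_append:
  "rspan n vs \<subseteq> rspan n (vs @ [v])" "(\<lambda>i. real_of_int (v i)) \<in> rspan n (vs @ [v])"
proof -
  have *: "rvec (vs @ [v]) k \<in> rspan n (vs @ [v])" if "k < Suc (length vs)" for k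
    unfolding rspan_def using that by (intro lspan_base) simp
  show "rspan n vs \<subseteq> rspan n (vs @ [v])"
    unfolding rspan_def[of n vs] rspan_def[of n "vs @ [v]"]
  proof (rule lspan_mono)
    fix k assume "k < length vs"
    then show "rvec vs k \<in> lspan n (length (vs @ [v])) (rvec (vs @ [v]))"
      using *[of k] by (simp add: rspan_def rvec_def[abs_def] nth_append)
  qed
  show "(\<lambda>i. real_of_int (v i)) \<in> rspan n (vs @ [v])"
    using *[of "length vs"] by (simp add: rvec_def[abs_def])
qed

lemma rspan_append_subset:
  assumes "rspan n vs \<subseteq> rspan n ws" "(\<lambda>i. real_of_int (v i)) \<in> rspan n ws"
  shows "rspan n (vs @ [v]) \<subseteq> rspan n ws"
  unfolding rspan_def[of n "vs @ [v]"] rspan_def[of n ws]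
proof (rule lspan_mono)
  fix k assume k: "k < length (vs @ [v])"
  show "rvec (vs @ [v]) k \<in> lspan n (length ws) (rvec ws)"
  proof (cases "k < length vs")
    case True
    then have "rvec vs k \<in> rspan n vs" unfolding rspan_def by (rule lspan_base)
    then have "rvec vs k \<in> rspan n ws" using assms(1) by blast
    then show ?thesis using True by (simp add: rspan_def rvec_def[abs_def] nth_append)
  next
    case False
    then show ?thesis using k assms(2) by (simp add: rspan_def rvec_def[abs_def] nth_append)
  qed
qed

lemma int_indep_append:
  assumes vs: "int_indep n vs" and v: "\<forall>i>n. v i = 0" "(\<lambda>i. real_of_int (v i)) \<notin> rspan n vs"
  shows "int_indep n (vs @ [v])"
proof -
  have "indep n (Suc (length vs)) ((rvec vs)(length vs := (\<lambda>i. real_of_int (v i))))"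
    using vs v(2) by (intro indep_extend) (auto simp: int_indep_def rspan_def)
  then obtain \<sigma> where s: "row_choice n (Suc (length vs)) \<sigma>"
    "minor (Suc (length vs)) ((rvec vs)(length vs := (\<lambda>i. real_of_int (v i)))) \<sigma> \<noteq> 0"
    unfolding indep_def by blast
  have "minor (Suc (length vs)) ((rvec vs)(length vs := (\<lambda>i. real_of_int (v i)))) \<sigma> =
      minor (Suc (length vs)) (rvec (vs @ [v])) \<sigma>"
    unfolding minor_def by (rule ldet_cong) (auto simp: rvec_def nth_append)
  then show ?thesis using s vs v(1) by (auto simp: int_indep_def indep_def)
qed

text \<open>
  A vector \<open>v\<close> of small image extends the largest member of the flag not containing it to a subgroup of
  small covolume. That subgroup is compatible with the flag, or spans the same space as a
  member of it, or has full rank; each case bounds its covolume from below.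
\<close>

lemma flag_short_vector_bound:
  assumes n: "1 \<le> n" and F: "finite F" "F \<subseteq> flag_elems n"
    and chain: "\<And>p q. p \<in> F \<Longrightarrow> q \<in> F \<Longrightarrow> p \<noteq> q \<Longrightarrow> nested n p q"
    and bounds: "\<And>q. q \<in> F \<Longrightarrow> \<epsilon> \<le> covol n t y q \<and> covol n t y q \<le> K"
    and other: "\<And>p. p \<in> flag_elems n \<Longrightarrow> (\<And>q. q \<in> F \<Longrightarrow> nested n p q) \<Longrightarrow> \<epsilon> \<le> covol n t y p"
    and eps: "\<epsilon> \<le> 1" and K: "1 \<le> K"
    and v: "\<forall>i>n. v i = 0" "\<exists>i\<le>n. v i \<noteq> 0"
    and c: "\<And>i. i \<le> n \<Longrightarrow> \<bar>flow_vec n t y (\<lambda>i. real_of_int (v i)) i\<bar> \<le> c"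
  shows "\<epsilon> \<le> real (Suc n) * c * K"
proof -
  let ?v = "\<lambda>i. real_of_int (v i)"
  have c0: "0 \<le> c" using c[of 0] by simp
  define F0 where "F0 = {q \<in> F. ?v \<notin> rspan n q}"
  have v0: "?v \<notin> rspan n []" using v(2) by (auto simp: rspan_def lspan_def)
  have ind: "int_indep n q" if "q \<in> F" for q using that F(2) by (auto simp: flag_elems_def primitive_def)
  obtain q where q: "int_indep n q" "?v \<notin> rspan n q" "length q \<le> n" "covol n t y q \<le> K"
    and below: "\<And>q'. q' \<in> F0 \<Longrightarrow> rspan n q' \<subseteq> rspan n q"
    and above: "\<And>q'. q' \<in> F \<Longrightarrow> q' \<notin> F0 \<Longrightarrow> rspan n q \<subseteq> rspan n q'"
  proof (cases "F0 = {}")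
    case True
    show ?thesis
    proof (rule that[of "[]"])
      show "rspan n [] \<subseteq> rspan n q'" for q'
        unfolding rspan_def by (rule lspan_mono) simp
    qed (use True int_indep_Nil v0 K in \<open>auto simp: covol_Nil\<close>)
  next
    case False
    have "finite F0" using F(1) by (simp add: F0_def)
    \<comment> \<open>Pairwise nested spans are ordered by rank, so the longest member of
      \<open>F0\<close> has the largest span.\<close>
    define m where "m = Max (length ` F0)"
    have "m \<in> length ` F0" unfolding m_def using \<open>finite F0\<close> False by (intro Max_in) auto
    then obtain q where "q \<in> F0" "length q = m" by blast
    then have q: "q \<in> F0" "\<And>q'. q' \<in> F0 \<Longrightarrow> length q' \<le> length q"
      using \<open>finite F0\<close> by (auto simp: m_def)
    then have qF: "q \<in> F" "?v \<notin> rspan n q" by (auto simp: F0_def)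
    show ?thesis
    proof (rule that[of q])
      show "int_indep n q" by (rule ind[OF qF(1)])
      show "length q \<le> n" using qF(1) F(2) by (auto simp: flag_elems_def)
      show "covol n t y q \<le> K" using bounds[OF qF(1)] by simp
      show "rspan n q' \<subseteq> rspan n q" if "q' \<in> F0" for q'
      proof (rule ccontr)
        assume not: "\<not> ?thesis"
        then have "nested n q' q" using chain[of q' q] that qF(1) by (auto simp: F0_def)
        then have "rspan n q \<subset> rspan n q'" using not by (auto simp: nested_def)
        moreover then have "length q = length q'"
          using rspan_subset_length[OF ind[OF qF(1)], of q'] q(2)[OF that] by auto
        ultimately show False using rspan_subset_eq[OF ind[OF qF(1)], of q'] by blast
      qed
      show "rspan n q \<subseteq> rspan n q'" if "q' \<in> F" "q' \<notin> F0" for q'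
      proof -
        have v': "?v \<in> rspan n q'" using that by (simp add: F0_def)
        then have "nested n q q'" using chain[OF qF(1) that(1)] qF(2) by auto
        then show ?thesis using v' qF(2) by (auto simp: nested_def)
      qed
    qed (rule qF(2))
  qed
  let ?w = "q @ [v]"
  have w: "int_indep n ?w" by (rule int_indep_append) (use q v in auto)
  have "covol n t y ?w \<le> real (Suc (length q)) * c * covol n t y q"
    by (rule covol_extend) (use q c in auto)
  also have "\<dots> \<le> real (Suc n) * c * K"
    using q c0 wedge_norm_nonneg[of "length q" n] by (intro mult_mono) (auto simp: covol_def)
  finally have upper: "covol n t y ?w \<le> real (Suc n) * c * K" .
  have "\<epsilon> \<le> covol n t y ?w"
  proof (cases "length q = n")
    case True
    then show ?thesis using covol_full_rank[OF w _ n, of t y] eps by simp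
  next
    case False
    obtain p where p: "primitive n p" "length p = length ?w" "rspan n p = rspan n ?w"
      "covol n t y p \<le> covol n t y ?w"
      using primitive_exists[OF w] by metis
    have pP: "p \<in> flag_elems n" using p(1,2) False q(3) by (simp add: flag_elems_def)
    have "\<epsilon> \<le> covol n t y p"
    proof (cases "\<forall>q'\<in>F. nested n p q'")
      case True
      then show ?thesis using other[OF pP] by blast
    next
      case False
      \<comment> \<open>Members of \<open>F0\<close> lie inside \<open>q\<close> and are nested with
        \<open>p\<close>. So \<open>q'\<close> contains \<open>v\<close> and \<open>q\<close>, hence
        \<open>p\<close>; not being nested it has the same span, and its minimal height gives the
        comparison.\<close>
      then obtain q' where q': "q' \<in> F" "\<not> nested n p q'" by blast
      have "q' \<notin> F0"
      proof
        assume "q' \<in> F0"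
        then have "rspan n q' \<subset> rspan n p"
          using below[of q'] rspan_append[where n = n and vs = q and v = v] q(2) unfolding p(3) by blast
        then show False using q'(2) by (simp add: nested_def)
      qed
      then have "?v \<in> rspan n q'" using q'(1) by (simp add: F0_def)
      then have "rspan n p \<subseteq> rspan n q'"
        unfolding p(3) using above[OF q'(1) \<open>q' \<notin> F0\<close>] by (intro rspan_append_subset)
      then have eq: "rspan n p = rspan n q'" using q'(2) by (auto simp: nested_def)
      have ip: "int_indep n p" using p(1) by (simp add: primitive_def)
      have len: "length p = length q'"
        using rspan_subset_length[OF ip, of q'] rspan_subset_length[OF ind[OF q'(1)], of p] eq by simp
      have "primitive n q'" using q'(1) F(2) by (auto simp: flag_elems_def)
      then have "height n q' \<le> height n p" using ip eq len by (simp add: primitive_def)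
      then have "covol n t y q' \<le> covol n t y p"
        using eq by (intro covol_le_of_height_le[OF ip ind[OF q'(1)] len]) auto
      then show ?thesis using bounds[OF q'(1)] by linarith
    qed
    then show ?thesis using p(4) by linarith
  qed
  then show ?thesis using upper by linarith
qed

section \<open>Short vectors in lattices of small covolume\<close>

text \<open>Only the restriction of \<open>\<sigma>\<close> to the first \<open>j\<close> indices
  matters, which leaves finitely many minors. The bound serves as a scale in the degenerate branch
  of \<open>pivoted_LU\<close>.\<close>

lemma minors_bounded:
  assumes "finite R"
  shows "\<exists>B\<ge>1. \<forall>\<sigma>. \<sigma> ` {..<j} \<subseteq> R \<longrightarrow> \<bar>minor j w \<sigma>\<bar> \<le> B"
proof -
  let ?S = "(\<lambda>\<sigma>. \<bar>minor j w \<sigma>\<bar>) ` PiE {..<j} (\<lambda>_. R)"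
  have fin: "finite ?S" using assms by (intro finite_imageI finite_PiE) auto
  have "\<bar>minor j w \<sigma>\<bar> \<le> Max (insert 1 ?S)" if "\<sigma> ` {..<j} \<subseteq> R" for \<sigma>
  proof -
    have "minor j w \<sigma> = minor j w (restrict \<sigma> {..<j})"
      unfolding minor_def by (rule ldet_cong) simp
    moreover have "restrict \<sigma> {..<j} \<in> PiE {..<j} (\<lambda>_. R)" using that by auto
    ultimately have "\<bar>minor j w \<sigma>\<bar> \<in> insert 1 ?S" by auto
    then show ?thesis using fin by (intro Max_ge) auto
  qed
  moreover have "1 \<le> Max (insert 1 ?S)" using fin by (intro Max_ge) auto
  ultimately show ?thesis by blast
qed

text \<open>Elimination from the last column with the largest entry as pivot. The choice of pivot
  keeps the multipliers \<open>b\<close> at most 1, and every pivot divides the bound on the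
  remaining minors, so the pivots multiply to at most \<open>D\<close>. Thus shortness for the
  triangular \<open>Y\<close> carries over to \<open>w\<close>.\<close>

lemma pivoted_LU:
  assumes "finite R" "0 < D" "\<And>\<sigma>. \<sigma> ` {..<j} \<subseteq> R \<Longrightarrow> \<bar>minor j w \<sigma>\<bar> \<le> D"
  shows "\<exists>b Y. (\<forall>i\<in>R. \<forall>k<j. w k i = (\<Sum>a<j. b i a * Y a k)) \<and> (\<forall>i\<in>R. \<forall>a<j. \<bar>b i a\<bar> \<le> 1) \<and>
    (\<forall>a<j. Y a a \<noteq> 0) \<and> (\<forall>a<j. \<forall>k>a. Y a k = 0) \<and> (\<Prod>a<j. \<bar>Y a a\<bar>) \<le> D"
  using assms
proof (induction j arbitrary: w D)
  case 0
  have "\<bar>minor 0 w (\<lambda>_. 0)\<bar> \<le> D" using 0(3)[of "\<lambda>_. 0"] by simp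
  then show ?case by (simp add: minor_def ldet_def)
next
  case (Suc j)
  show ?case
  proof (cases "\<forall>i\<in>R. w j i = 0")
    case True
    \<comment> \<open>The new row of \<open>Y\<close> enters no row of \<open>w\<close>, so its diagonal entry may be chosen to make the product small.\<close>
    obtain B where B: "1 \<le> B" "\<And>\<sigma>. \<sigma> ` {..<j} \<subseteq> R \<Longrightarrow> \<bar>minor j w \<sigma>\<bar> \<le> B"
      using minors_bounded[OF Suc.prems(1)] by blast
    have B0: "0 < B" using B(1) by simp
    obtain b Y where Y: "\<forall>i\<in>R. \<forall>k<j. w k i = (\<Sum>a<j. b i a * Y a k)" "\<forall>i\<in>R. \<forall>a<j. \<bar>b i a\<bar> \<le> 1"
      "\<forall>a<j. Y a a \<noteq> 0" "\<forall>a<j. \<forall>k>a. Y a k = 0" "(\<Prod>a<j. \<bar>Y a a\<bar>) \<le> B"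
      using Suc.IH[OF Suc.prems(1) B0, of w] B(2) by blast
    define b' where "b' i a = (if a = j then 0 else b i a)" for i a
    define Y' where "Y' a k = (if a = j then (if k = j then D / B else 0) else Y a k)" for a k
    have D: "(\<Prod>a<Suc j. \<bar>Y' a a\<bar>) = (\<Prod>a<j. \<bar>Y a a\<bar>) * (D / B)"
      using B0 Suc.prems(2) by (simp add: Y'_def)
    have "(\<Prod>a<j. \<bar>Y a a\<bar>) * (D / B) \<le> B * (D / B)"
      using Y(5) B0 Suc.prems(2) by (intro mult_right_mono) auto
    then have 5: "(\<Prod>a<Suc j. \<bar>Y' a a\<bar>) \<le> D" using D B0 by simp
    have 1: "w k i = (\<Sum>a<Suc j. b' i a * Y' a k)" if "i \<in> R" "k < Suc j" for i k
    proof -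
      have "(\<Sum>a<Suc j. b' i a * Y' a k) = (\<Sum>a<j. b i a * Y a k)" by (simp add: b'_def Y'_def)
      also have "\<dots> = w k i"
      proof (cases "k = j")
        case True
        then have "(\<Sum>a<j. b i a * Y a k) = 0" using Y(4) by (intro sum.neutral) auto
        then show ?thesis using True \<open>\<forall>i\<in>R. w j i = 0\<close> that(1) by simp
      next
        case False
        then show ?thesis using Y(1) that by simp
      qed
      finally show ?thesis by simp
    qed
    show ?thesis
      by (rule exI[of _ b'], rule exI[of _ Y'], intro conjI)
         (use 1 5 Y B0 Suc.prems(2) in \<open>auto simp: b'_def Y'_def less_Suc_eq\<close>)
  next
    case False
    then have "R \<noteq> {}" by auto
    obtain i0 where i0: "i0 \<in> R" "\<And>i. i \<in> R \<Longrightarrow> \<bar>w j i\<bar> \<le> \<bar>w j i0\<bar>"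
    proof -
      have "Max ((\<lambda>i. \<bar>w j i\<bar>) ` R) \<in> (\<lambda>i. \<bar>w j i\<bar>) ` R"
        using \<open>R \<noteq> {}\<close> Suc.prems(1) by (intro Max_in) auto
      then obtain i0 where "i0 \<in> R" "Max ((\<lambda>i. \<bar>w j i\<bar>) ` R) = \<bar>w j i0\<bar>" by auto
      then show ?thesis using Suc.prems(1) that[of i0] by (metis Max_ge finite_imageI imageI)
    qed
    define p where "p = w j i0"
    have p: "p \<noteq> 0" using False i0(2) by (force simp: p_def)
    define w' where "w' k i = w k i - w j i / p * w k i0" for k i
    have "\<bar>minor j w' \<sigma>\<bar> \<le> D / \<bar>p\<bar>" if s: "\<sigma> ` {..<j} \<subseteq> R" for \<sigma>
    proof -
      let ?s = "\<sigma>(j := i0)"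
      have "minor (Suc j) w ?s = p * ldet j (\<lambda>a k. w k (?s a) - w j (?s a) / p * w k i0)"
        using ldet_pivot[of "\<lambda>a k. w k (?s a)" j] p by (simp add: minor_def p_def)
      also have "ldet j (\<lambda>a k. w k (?s a) - w j (?s a) / p * w k i0) = minor j w' \<sigma>"
        unfolding minor_def by (rule ldet_cong) (simp add: w'_def)
      finally have eq: "minor (Suc j) w ?s = p * minor j w' \<sigma>" .
      have "\<bar>minor (Suc j) w ?s\<bar> = \<bar>p\<bar> * \<bar>minor j w' \<sigma>\<bar>" unfolding eq by (rule abs_mult)
      moreover have "\<bar>minor (Suc j) w ?s\<bar> \<le> D"
        by (rule Suc.prems(3)) (use s i0(1) in \<open>auto simp: image_subset_iff\<close>)
      ultimately show ?thesis using p by (simp add: field_simps)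
    qed
    moreover have "0 < D / \<bar>p\<bar>" using p Suc.prems(2) by simp
    ultimately obtain b Y where Y: "\<forall>i\<in>R. \<forall>k<j. w' k i = (\<Sum>a<j. b i a * Y a k)" "\<forall>i\<in>R. \<forall>a<j. \<bar>b i a\<bar> \<le> 1"
      "\<forall>a<j. Y a a \<noteq> 0" "\<forall>a<j. \<forall>k>a. Y a k = 0" "(\<Prod>a<j. \<bar>Y a a\<bar>) \<le> D / \<bar>p\<bar>"
      using Suc.IH[OF Suc.prems(1), of "D / \<bar>p\<bar>" w'] by blast
    define b' where "b' i a = (if a = j then w j i / p else b i a)" for i a
    define Y' where "Y' a k = (if a = j then (if k \<le> j then w k i0 else 0) else Y a k)" for a k
    have "(\<Prod>a<Suc j. \<bar>Y' a a\<bar>) = (\<Prod>a<j. \<bar>Y a a\<bar>) * \<bar>p\<bar>" by (simp add: Y'_def p_def)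
    also have "\<dots> \<le> D" using Y(5) p by (simp add: field_simps)
    finally have 5: "(\<Prod>a<Suc j. \<bar>Y' a a\<bar>) \<le> D" .
    have 1: "w k i = (\<Sum>a<Suc j. b' i a * Y' a k)" if "i \<in> R" "k < Suc j" for i k
    proof -
      have "(\<Sum>a<Suc j. b' i a * Y' a k) = (\<Sum>a<j. b i a * Y a k) + w j i / p * w k i0"
        using that by (simp add: b'_def Y'_def)
      also have "(\<Sum>a<j. b i a * Y a k) = w k i - w j i / p * w k i0"
      proof (cases "k = j")
        case True
        then have "(\<Sum>a<j. b i a * Y a k) = 0" using Y(4) by (intro sum.neutral) auto
        then show ?thesis using True p by (simp add: p_def)
      next
        case False
        then have "(\<Sum>a<j. b i a * Y a k) = w' k i" using Y(1) that by simp
        then show ?thesis by (simp add: w'_def)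
      qed
      finally show ?thesis by simp
    qed
    have 2: "\<bar>b' i a\<bar> \<le> 1" if "i \<in> R" "a < Suc j" for i a
      using that Y(2) i0(2)[OF that(1)] p by (auto simp: b'_def less_Suc_eq p_def field_simps)
    show ?thesis
      by (rule exI[of _ b'], rule exI[of _ Y'], intro conjI)
         (use 1 2 5 Y p in \<open>auto simp: Y'_def less_Suc_eq p_def\<close>)
  qed
qed

text \<open>Row \<open>j\<close> involves \<open>c j\<close> and earlier coordinates only. Once
  these are fixed with contribution s, consecutive integers from the ceiling of -s/p on give values
  p(r+m) with r in [0,1), and the first floor(L/|p|) of them stay within \<open>L\<close>.
  Coefficients vanish from \<open>j\<close> on, so that the cardinality counts coefficient
  vectors.\<close>

lemma triangular_box_points:
  assumes "\<And>a. a < j \<Longrightarrow> Y a a \<noteq> (0::real)" "\<And>a k. a < j \<Longrightarrow> a < k \<Longrightarrow> Y a k = 0" "0 < L"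
  shows "\<exists>C::(nat \<Rightarrow> int) set. finite C \<and> (\<forall>c\<in>C. \<forall>k\<ge>j. c k = 0) \<and>
    (\<forall>c\<in>C. \<forall>a<j. \<bar>\<Sum>k<j. Y a k * real_of_int (c k)\<bar> \<le> L) \<and> card C = (\<Prod>a<j. nat \<lfloor>L / \<bar>Y a a\<bar>\<rfloor>)"
  using assms
proof (induction j)
  case 0
  show ?case by (rule exI[of _ "{\<lambda>_. 0}"]) auto
next
  case (Suc j)
  have "\<exists>C::(nat \<Rightarrow> int) set. finite C \<and> (\<forall>c\<in>C. \<forall>k\<ge>j. c k = 0) \<and>
    (\<forall>c\<in>C. \<forall>a<j. \<bar>\<Sum>k<j. Y a k * real_of_int (c k)\<bar> \<le> L) \<and> card C = (\<Prod>a<j. nat \<lfloor>L / \<bar>Y a a\<bar>\<rfloor>)"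
    by (rule Suc.IH) (use Suc.prems in auto)
  then obtain C :: "(nat \<Rightarrow> int) set" where C: "finite C" "\<forall>c\<in>C. \<forall>k\<ge>j. c k = 0"
    "\<forall>c\<in>C. \<forall>a<j. \<bar>\<Sum>k<j. Y a k * real_of_int (c k)\<bar> \<le> L"
    "card C = (\<Prod>a<j. nat \<lfloor>L / \<bar>Y a a\<bar>\<rfloor>)"
    by (elim exE conjE)
  have C2: "c k = 0" if "c \<in> C" "k \<ge> j" for c k
    using C(2) that by simp
  have C3: "\<bar>\<Sum>k<j. Y a k * real_of_int (c k)\<bar> \<le> L" if "c \<in> C" "a < j" for c a
    using C(3) that by simp
  define p where "p = Y j j"
  have p: "p \<noteq> 0" using Suc.prems(1)[of j] by (simp add: p_def)
  define N where "N = nat \<lfloor>L / \<bar>p\<bar>\<rfloor>"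
  define s where "s c = (\<Sum>k<j. Y j k * real_of_int (c k))" for c
  define g where "g = (\<lambda>(c, m). c(j := \<lceil>- s c / p\<rceil> + int m))"
  define C' where "C' = g ` (C \<times> {..<N})"
  have inj: "inj_on g (C \<times> {..<N})"
  proof (rule inj_onI, clarify)
    fix c m c' m' assume a: "c \<in> C" "c' \<in> C" "g (c, m) = g (c', m')"
    then have eq: "c(j := \<lceil>- s c / p\<rceil> + int m) = c'(j := \<lceil>- s c' / p\<rceil> + int m')" by (simp add: g_def)
    have "c = c'"
    proof
      fix k
      show "c k = c' k"
      proof (cases "k = j")
        case True
        then show ?thesis using C2[OF a(1)] C2[OF a(2)] by simp
      next
        case False
        then show ?thesis using fun_cong[OF eq, of k] by simp
      qed
    qed
    moreover then have "m = m'" using fun_cong[OF eq, of j] by simp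
    ultimately show "c = c' \<and> m = m'" by simp
  qed
  have "card C' = card C * N" unfolding C'_def using inj by (simp add: card_image card_cartesian_product)
  then have card: "card C' = (\<Prod>a<Suc j. nat \<lfloor>L / \<bar>Y a a\<bar>\<rfloor>)" using C(4) by (simp add: N_def p_def)
  have bound: "\<bar>\<Sum>k<Suc j. Y a k * real_of_int ((g (c, m)) k)\<bar> \<le> L"
    if c: "c \<in> C" and m: "m < N" and a: "a < Suc j" for c m a
  proof (cases "a = j")
    case False
    then have "a < j" using a by simp
    then have "(\<Sum>k<Suc j. Y a k * real_of_int ((g (c, m)) k)) = (\<Sum>k<j. Y a k * real_of_int (c k))"
      using Suc.prems(2) by (simp add: g_def)
    then show ?thesis using C3[OF c \<open>a < j\<close>] by simp
  next
    case True
    define r where "r = s c / p + real_of_int \<lceil>- s c / p\<rceil>"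
    have r: "0 \<le> r" "r < 1" unfolding r_def by linarith+
    have "(\<Sum>k<Suc j. Y a k * real_of_int ((g (c, m)) k)) = s c + p * (real_of_int \<lceil>- s c / p\<rceil> + real m)"
      using True by (simp add: g_def s_def p_def)
    also have "\<dots> = p * (r + real m)" using p by (simp add: r_def field_simps)
    finally have "\<bar>\<Sum>k<Suc j. Y a k * real_of_int ((g (c, m)) k)\<bar> = \<bar>p\<bar> * (r + real m)"
      using r by (simp add: abs_mult)
    also have "\<dots> \<le> \<bar>p\<bar> * real N" using m r by (intro mult_left_mono) auto
    also have "real N \<le> L / \<bar>p\<bar>" using Suc.prems(3) p by (simp add: N_def)
    then have "\<bar>p\<bar> * real N \<le> L" using p by (simp add: field_simps)
    finally show ?thesis .
  qed
  show ?case
  proof (intro exI[of _ C'] conjI)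
    show "finite C'" using C(1) by (simp add: C'_def)
    show "\<forall>c\<in>C'. \<forall>k\<ge>Suc j. c k = 0" using C2 by (auto simp: C'_def g_def)
    show "\<forall>c\<in>C'. \<forall>a<Suc j. \<bar>\<Sum>k<Suc j. Y a k * real_of_int (c k)\<bar> \<le> L"
      using bound unfolding C'_def by blast
  qed (rule card)
qed

lemma half_le_nat_floor: "1 \<le> x \<Longrightarrow> x / 2 \<le> real (nat \<lfloor>x\<rfloor>)" for x :: real
proof -
  assume "1 \<le> x"
  then have z: "1 \<le> \<lfloor>x\<rfloor>" by (simp add: le_floor_iff)
  have "x / 2 \<le> real_of_int \<lfloor>x\<rfloor>"
  proof -
    have "x < real_of_int \<lfloor>x\<rfloor> + 1" by (rule real_of_int_floor_add_one_gt)
    moreover have "1 \<le> real_of_int \<lfloor>x\<rfloor>" using z by (simp only: of_int_1_le_iff)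
    ultimately show ?thesis by argo
  qed
  also have "\<dots> = real (nat \<lfloor>x\<rfloor>)" using z by (intro of_nat_nat[symmetric]) presburger
  finally show ?thesis .
qed

text \<open>
  Pigeonhole: the cube of half-side \<open>m\<eta>\<close> contains at least \<open>(m/2)\<^sup>j\<close> of the points \<open>Yc\<close>, but is covered by
  fewer cubes of side \<open>8\<eta>\<close> once \<open>m > 8\<close>.
\<close>

lemma triangular_short_vector:
  assumes j: "1 \<le> j" and Y: "\<And>a. a < j \<Longrightarrow> Y a a \<noteq> (0::real)" "\<And>a k. a < j \<Longrightarrow> a < k \<Longrightarrow> Y a k = 0"
    and \<eta>: "0 < \<eta>" "(\<Prod>a<j. \<bar>Y a a\<bar>) \<le> \<eta> ^ j"
  shows "\<exists>c::nat \<Rightarrow> int. (\<exists>k<j. c k \<noteq> 0) \<and> (\<forall>a<j. \<bar>\<Sum>k<j. Y a k * real_of_int (c k)\<bar> \<le> 8 * \<eta>)"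
proof -
  \<comment> \<open>The second property makes every quotient L/|Y a a| at least 1, so taking floors
    loses at most a factor 2.\<close>
  obtain m :: nat where m: "8 < m" "\<And>a. a < j \<Longrightarrow> \<bar>Y a a\<bar> / \<eta> \<le> real m"
  proof -
    obtain m0 :: nat where "(\<Sum>a<j. \<bar>Y a a\<bar> / \<eta>) \<le> real m0" using real_arch_simple by blast
    moreover have "\<bar>Y a a\<bar> / \<eta> \<le> (\<Sum>a<j. \<bar>Y a a\<bar> / \<eta>)" if "a < j" for a
      using that \<eta>(1) by (intro member_le_sum) auto
    ultimately show ?thesis using that[of "m0 + 9"] by force
  qed
  define L where "L = real m * \<eta>"
  have L: "0 < L" using m(1) \<eta>(1) by (simp add: L_def)
  have "\<exists>C::(nat \<Rightarrow> int) set. finite C \<and> (\<forall>c\<in>C. \<forall>k\<ge>j. c k = 0) \<and>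
    (\<forall>c\<in>C. \<forall>a<j. \<bar>\<Sum>k<j. Y a k * real_of_int (c k)\<bar> \<le> L) \<and> card C = (\<Prod>a<j. nat \<lfloor>L / \<bar>Y a a\<bar>\<rfloor>)"
    by (rule triangular_box_points) (use Y L in auto)
  then obtain C :: "(nat \<Rightarrow> int) set" where C: "finite C" "\<forall>c\<in>C. \<forall>k\<ge>j. c k = 0"
    "\<forall>c\<in>C. \<forall>a<j. \<bar>\<Sum>k<j. Y a k * real_of_int (c k)\<bar> \<le> L"
    "card C = (\<Prod>a<j. nat \<lfloor>L / \<bar>Y a a\<bar>\<rfloor>)"
    by (elim exE conjE)
  have C2: "c k = 0" if "c \<in> C" "k \<ge> j" for c k
    using C(2) that by simp
  have C3: "\<bar>\<Sum>k<j. Y a k * real_of_int (c k)\<bar> \<le> L" if "c \<in> C" "a < j" for c a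
    using C(3) that by simp
  have "(real m / 2) ^ j * (\<Prod>a<j. \<bar>Y a a\<bar>) \<le> (real m / 2) ^ j * \<eta> ^ j"
    using \<eta>(2) by (intro mult_left_mono) auto
  also have "\<dots> = (\<Prod>a<j. L / 2)" by (simp add: L_def power_mult_distrib[symmetric])
  also have "\<dots> = (\<Prod>a<j. L / (2 * \<bar>Y a a\<bar>)) * (\<Prod>a<j. \<bar>Y a a\<bar>)"
    unfolding prod.distrib[symmetric] by (rule prod.cong) (use Y in auto)
  finally have "(real m / 2) ^ j \<le> (\<Prod>a<j. L / (2 * \<bar>Y a a\<bar>))"
    by (rule mult_right_le_imp_le) (use Y in \<open>auto intro!: prod_pos\<close>)
  also have "\<dots> \<le> (\<Prod>a<j. real (nat \<lfloor>L / \<bar>Y a a\<bar>\<rfloor>))"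
  proof (rule prod_mono)
    fix a assume "a \<in> {..<j}"
    then have a: "a < j" by simp
    have "1 \<le> L / \<bar>Y a a\<bar>" using m(2)[OF a] Y(1)[OF a] \<eta>(1) by (simp add: L_def field_simps)
    then have "L / \<bar>Y a a\<bar> / 2 \<le> real (nat \<lfloor>L / \<bar>Y a a\<bar>\<rfloor>)" by (rule half_le_nat_floor)
    then show "0 \<le> L / (2 * \<bar>Y a a\<bar>) \<and> L / (2 * \<bar>Y a a\<bar>) \<le> real (nat \<lfloor>L / \<bar>Y a a\<bar>\<rfloor>)"
      using L by (simp add: mult.commute)
  qed
  finally have cardC: "(real m / 2) ^ j \<le> real (card C)" using C(4) by simp
  define f where "f c = restrict (\<lambda>a. \<lfloor>(\<Sum>k<j. Y a k * real_of_int (c k)) / (8 * \<eta>)\<rfloor>) {..<j}" for c :: "nat \<Rightarrow> int"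
  \<comment> \<open>Values up to m\<open>\<eta>\<close> in cells of side 8\<open>\<eta>\<close> have
    indices of size about m/8. That is at most m/4 + 2 indices per coordinate, fewer than m/2
    exactly because m > 8.\<close>
  define I where "I = {\<lfloor>- real m / 8\<rfloor>..\<lfloor>real m / 8\<rfloor>}"
  have fI: "f ` C \<subseteq> PiE {..<j} (\<lambda>_. I)"
  proof (clarify)
    fix c assume c: "c \<in> C"
    have "\<lfloor>(\<Sum>k<j. Y a k * real_of_int (c k)) / (8 * \<eta>)\<rfloor> \<in> I" if "a < j" for a
    proof -
      have "- real m / 8 \<le> (\<Sum>k<j. Y a k * real_of_int (c k)) / (8 * \<eta>)"
        "(\<Sum>k<j. Y a k * real_of_int (c k)) / (8 * \<eta>) \<le> real m / 8"
        using C3[OF c that] \<eta>(1) by (auto simp: L_def field_simps abs_le_iff)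
      then show ?thesis unfolding I_def by (auto intro: floor_mono)
    qed
    then show "f c \<in> PiE {..<j} (\<lambda>_. I)" by (auto simp: f_def)
  qed
  have finI: "finite (PiE {..<j} (\<lambda>_. I))" by (intro finite_PiE) (auto simp: I_def)
  have "real (card I) \<le> real m / 4 + 2"
    unfolding I_def by simp linarith
  also have "\<dots> < real m / 2" using m(1) by simp
  finally have "real (card I) ^ j < (real m / 2) ^ j"
    using j by (intro power_strict_mono) auto
  moreover have "real (card (PiE {..<j} (\<lambda>_. I))) = real (card I) ^ j" by (simp add: card_PiE)
  ultimately have "real (card (PiE {..<j} (\<lambda>_. I))) < real (card C)"
    using cardC by linarith
  moreover have "card (f ` C) \<le> card (PiE {..<j} (\<lambda>_. I))" by (rule card_mono[OF finI fI])
  ultimately have "card (f ` C) < card C" by linarith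
  then have "\<not> inj_on f C" by (rule pigeonhole)
  then obtain c c' where cc: "c \<in> C" "c' \<in> C" "c \<noteq> c'" "f c = f c'" by (auto simp: inj_on_def)
  define d where "d k = c k - c' k" for k
  obtain k where "c k \<noteq> c' k" using cc(3) by blast
  moreover then have "k < j" using C2[OF cc(1), of k] C2[OF cc(2), of k] by force
  ultimately have "\<exists>k<j. d k \<noteq> 0" by (auto simp: d_def)
  moreover have "\<bar>\<Sum>k<j. Y a k * real_of_int (d k)\<bar> \<le> 8 * \<eta>" if "a < j" for a
  proof -
    let ?S = "\<lambda>c. (\<Sum>k<j. Y a k * real_of_int (c k))"
    have "\<lfloor>?S c / (8 * \<eta>)\<rfloor> = \<lfloor>?S c' / (8 * \<eta>)\<rfloor>"
      using fun_cong[OF cc(4), of a] that by (simp add: f_def)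
    then have "\<bar>?S c / (8 * \<eta>) - ?S c' / (8 * \<eta>)\<bar> \<le> 1" by linarith
    then have "\<bar>(?S c - ?S c') / (8 * \<eta>)\<bar> \<le> 1" by (simp add: diff_divide_distrib)
    then have "\<bar>?S c - ?S c'\<bar> \<le> 8 * \<eta>" using \<eta>(1) by (simp add: abs_divide)
    moreover have "?S d = ?S c - ?S c'"
      by (simp add: d_def right_diff_distrib sum_subtractf)
    ultimately show ?thesis by simp
  qed
  ultimately show ?thesis by blast
qed

text \<open>With rank j the pivots multiply to at most \<open>\<delta>\<close> =
  \<open>\<eta>\<close>^j, so pigeonhole makes Yc at most 8\<open>\<eta>\<close>, and multipliers of
  size at most 1 cost a factor j. The exponent 1/n, uniform in the rank, is available because
  \<open>\<delta>\<close> is at most 1.\<close>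

lemma short_vector_of_covol:
  assumes vs: "is_zbasis n \<Gamma> vs" "1 \<le> length vs" "length vs \<le> n"
    and \<delta>: "0 < \<delta>" "\<delta> \<le> 1" "covol n t y vs \<le> \<delta>"
  shows "\<exists>v::nat \<Rightarrow> int. (\<forall>i>n. v i = 0) \<and> (\<exists>i\<le>n. v i \<noteq> 0) \<and>
    (\<forall>i\<le>n. \<bar>flow_vec n t y (\<lambda>i. real_of_int (v i)) i\<bar> \<le> 8 * real n * \<delta> powr (1 / real n))"
proof -
  let ?j = "length vs"
  let ?w = "\<lambda>k. flow_vec n t y (rvec vs k)"
  define \<eta> where "\<eta> = \<delta> powr (1 / real ?j)"
  have \<eta>: "0 < \<eta>" "\<eta> ^ ?j = \<delta>" using \<delta>(1) vs(2)
    by (auto simp: \<eta>_def powr_realpow[symmetric] powr_powr)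
  have "\<bar>minor ?j ?w \<sigma>\<bar> \<le> \<delta>" if "\<sigma> ` {..<?j} \<subseteq> {..n}" for \<sigma>
    using minor_le_wedge_norm[of n ?j \<sigma> ?w] that \<delta>(3) vs(3) by (simp add: row_choice_def covol_def)
  then obtain b Y where Y: "\<forall>i\<in>{..n}. \<forall>k<?j. ?w k i = (\<Sum>a<?j. b i a * Y a k)" "\<forall>i\<in>{..n}. \<forall>a<?j. \<bar>b i a\<bar> \<le> 1"
      "\<forall>a<?j. Y a a \<noteq> 0" "\<forall>a<?j. \<forall>k>a. Y a k = 0" "(\<Prod>a<?j. \<bar>Y a a\<bar>) \<le> \<delta>"
    using pivoted_LU[of "{..n}" \<delta> ?j ?w] \<delta>(1) by blast
  obtain c :: "nat \<Rightarrow> int" where c: "\<exists>k<?j. c k \<noteq> 0"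
    "\<And>a. a < ?j \<Longrightarrow> \<bar>\<Sum>k<?j. Y a k * real_of_int (c k)\<bar> \<le> 8 * \<eta>"
    using triangular_short_vector[of ?j Y \<eta>] vs(2) Y \<eta> by auto
  define v where "v i = (\<Sum>k<?j. c k * (vs ! k) i)" for i
  have v0: "v i = 0" if "i > n" for i
    unfolding v_def using vs(1) that by (intro sum.neutral) (auto simp: is_zbasis_def)
  have "\<exists>i. v i \<noteq> 0" using vs(1) c(1) unfolding is_zbasis_def v_def by blast
  then have v1: "\<exists>i\<le>n. v i \<noteq> 0" using v0 by (meson not_le)
  have v2: "\<bar>flow_vec n t y (\<lambda>i. real_of_int (v i)) i\<bar> \<le> 8 * real n * \<delta> powr (1 / real n)" if i: "i \<le> n" for i
  proof -
    have "flow_vec n t y (\<lambda>i. real_of_int (v i)) i = (\<Sum>k<?j. real_of_int (c k) * ?w k i)"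
      by (rule flow_vec_lincomb) (auto simp: v_def rvec_def i)
    also have "\<dots> = (\<Sum>k<?j. \<Sum>a<?j. b i a * (Y a k * real_of_int (c k)))"
      using Y(1) i by (intro sum.cong) (auto simp: sum_distrib_left mult_ac)
    also have "\<dots> = (\<Sum>a<?j. \<Sum>k<?j. b i a * (Y a k * real_of_int (c k)))" by (rule sum.swap)
    also have "\<dots> = (\<Sum>a<?j. b i a * (\<Sum>k<?j. Y a k * real_of_int (c k)))" by (simp add: sum_distrib_left)
    also have "\<bar>\<dots>\<bar> \<le> (\<Sum>a<?j. 1 * (8 * \<eta>))"
    proof (intro order.trans[OF sum_abs] sum_mono)
      fix a assume "a \<in> {..<?j}"
      then have "\<bar>b i a\<bar> \<le> 1" "\<bar>\<Sum>k<?j. Y a k * real_of_int (c k)\<bar> \<le> 8 * \<eta>"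
        using Y(2) c(2)[of a] i by auto
      then show "\<bar>b i a * (\<Sum>k<?j. Y a k * real_of_int (c k))\<bar> \<le> 1 * (8 * \<eta>)"
        unfolding abs_mult by (intro mult_mono) auto
    qed
    also have "\<dots> = real ?j * (8 * \<eta>)" by simp
    also have "\<dots> \<le> real n * (8 * \<delta> powr (1 / real n))"
    proof -
      have "1 / real n \<le> 1 / real ?j" using vs(2,3) by (intro divide_left_mono mult_pos_pos) auto
      then have "\<eta> \<le> \<delta> powr (1 / real n)" unfolding \<eta>_def using \<delta> by (intro powr_mono') auto
      then show ?thesis using vs(3) \<eta>(1) by (intro mult_mono) auto
    qed
    finally show ?thesis by (simp add: mult_ac)
  qed
  show ?thesis by (intro exI[of _ v] conjI allI impI v0 v1 v2)
qed

section \<open>Very well approximable vectors and the flow\<close>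

lemma sup_norm_int_alt: "sup_norm_int n q = Max (insert 0 ((\<lambda>i. real_of_int \<bar>q i\<bar>) ` {1..n}))"
  unfolding sup_norm_int_def by (rule arg_cong[where f = Max]) auto

lemma sup_norm_int_ge: "i \<in> {1..n} \<Longrightarrow> real_of_int \<bar>q i\<bar> \<le> sup_norm_int n q"
  unfolding sup_norm_int_alt by (rule Max_ge) auto

lemma sup_norm_int_le:
  "0 \<le> B \<Longrightarrow> (\<And>i. i \<in> {1..n} \<Longrightarrow> real_of_int \<bar>q i\<bar> \<le> B) \<Longrightarrow> sup_norm_int n q \<le> B"
  unfolding sup_norm_int_alt by (subst Max_le_iff) auto

lemma finite_bounded_int_vectors:
  "finite {q :: nat \<Rightarrow> int. (\<forall>i. i \<notin> {1..n} \<longrightarrow> q i = 0) \<and> sup_norm_int n q \<le> B}"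
proof (rule finite_subset)
  show "finite {q. \<forall>i. (i \<in> {1..n} \<longrightarrow> q i \<in> {- \<lceil>B\<rceil>..\<lceil>B\<rceil>}) \<and> (i \<notin> {1..n} \<longrightarrow> q i = 0)}"
    by (rule finite_set_of_finite_funs) auto
  have "q i \<in> {- \<lceil>B\<rceil>..\<lceil>B\<rceil>}" if "sup_norm_int n q \<le> B" "i \<in> {1..n}" for q i
  proof -
    have "real_of_int \<bar>q i\<bar> \<le> B" using sup_norm_int_ge[OF that(2), of q] that(1) by linarith
    then have "\<bar>q i\<bar> \<le> \<lceil>B\<rceil>" by (metis le_of_int_ceiling of_int_le_iff order_trans)
    then show ?thesis by auto
  qed
  then show "{q. (\<forall>i. i \<notin> {1..n} \<longrightarrow> q i = 0) \<and> sup_norm_int n q \<le> B}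
      \<subseteq> {q. \<forall>i. (i \<in> {1..n} \<longrightarrow> q i \<in> {- \<lceil>B\<rceil>..\<lceil>B\<rceil>}) \<and> (i \<notin> {1..n} \<longrightarrow> q i = 0)}"
    by blast
qed

text \<open>Large times might keep returning the same \<open>q\<close>. If only finitely many
  \<open>q\<close> met exponent \<open>v\<close>, no nonzero one could have an exact relation, so
  their distances to the integers would have a positive minimum, contradicted at large
  \<open>t\<close>.\<close>

lemma VWA_if_approximations:
  assumes n: "1 \<le> n" and \<gamma>: "0 < \<gamma>"
    and approx: "\<And>T. \<exists>t\<ge>T. \<exists>q p. (\<forall>i. i \<notin> {1..n} \<longrightarrow> q i = 0) \<and> (\<exists>i. q i \<noteq> (0::int)) \<and>
      (\<forall>i\<in>{1..n}. real_of_int \<bar>q i\<bar> \<le> exp ((1 / real n - \<gamma>) * t)) \<and>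
      \<bar>(\<Sum>i\<in>{1..n}. y i * real_of_int (q i)) + real_of_int p\<bar> \<le> exp (- (1 + \<gamma>) * t)"
  shows "VWA n y"
proof (rule ccontr)
  assume notV: "\<not> VWA n y"
  \<comment> \<open>Chosen so that (1/n - \<open>\<gamma>\<close>) v is at most 1 +
    \<open>\<gamma>\<close>: the size bound on \<open>q\<close> then turns the error bound into
    exponent \<open>v\<close>.\<close>
  define v where "v = real n * (1 + \<gamma>)"
  have v: "real n < v" using n \<gamma> by (simp add: v_def)
  define dotp where "dotp q = (\<Sum>i\<in>{1..n}. y i * real_of_int (q i))" for q :: "nat \<Rightarrow> int"
  define Q where "Q = {q :: nat \<Rightarrow> int. (\<forall>i. i \<notin> {1..n} \<longrightarrow> q i = 0) \<and>
        (\<exists>p::int. \<bar>dotp q + real_of_int p\<bar> \<le> sup_norm_int n q powr (- v))}"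
  have finQ: "finite Q" using notV v unfolding VWA_def Q_def dotp_def by blast
  \<comment> \<open>An exact integer relation would put all multiples of \<open>q\<close> into the
    finite set \<open>Q\<close>.\<close>
  have pos: "dotp q + real_of_int p \<noteq> 0" if q: "\<forall>i. i \<notin> {1..n} \<longrightarrow> q i = 0" "q i0 \<noteq> 0" for q i0 p
  proof
    assume 0: "dotp q + real_of_int p = 0"
    have "(\<lambda>i. int k * q i) \<in> Q" for k :: nat
    proof -
      have "dotp (\<lambda>i. int k * q i) + real_of_int (int k * p) = real k * (dotp q + real_of_int p)"
        by (simp add: dotp_def sum_distrib_left algebra_simps)
      then have "\<bar>dotp (\<lambda>i. int k * q i) + real_of_int (int k * p)\<bar> \<le> sup_norm_int n (\<lambda>i. int k * q i) powr (- v)"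
        using 0 by simp
      then show ?thesis using q(1) unfolding Q_def by (intro CollectI conjI exI[of _ "int k * p"]) auto
    qed
    then have "range (\<lambda>k::nat. (\<lambda>i. int k * q i)) \<subseteq> Q" by blast
    moreover have "inj (\<lambda>k::nat. (\<lambda>i. int k * q i))"
      using q(2) by (intro injI) (auto dest!: fun_cong[of _ _ i0])
    ultimately show False using finQ finite_subset range_inj_infinite by blast
  qed
  define dst where "dst q = \<bar>dotp q - real_of_int (round (dotp q))\<bar>" for q
  \<comment> \<open>The zero vector lies in \<open>Q\<close>, as \<open>powr\<close> with base 0 has
    value 0, and would spoil the minimum.\<close>
  define Q' where "Q' = {q \<in> Q. \<exists>i. q i \<noteq> 0}"
  have finQ': "finite Q'" using finQ by (simp add: Q'_def)
  have dpos: "0 < dst q" if "q \<in> Q'" for q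
    using that pos[of q _ "- round (dotp q)"] by (auto simp: dst_def Q'_def Q_def)
  define m where "m = Min (insert 1 (dst ` Q'))"
  have m: "0 < m" "\<And>q. q \<in> Q' \<Longrightarrow> m \<le> dst q"
    using finQ' dpos by (auto simp: m_def)
  obtain t q p where t: "t \<ge> max 1 (- ln m + 1)" and q: "\<forall>i. i \<notin> {1..n} \<longrightarrow> q i = 0" "\<exists>i. q i \<noteq> (0::int)"
      "\<forall>i\<in>{1..n}. real_of_int \<bar>q i\<bar> \<le> exp ((1 / real n - \<gamma>) * t)"
      "\<bar>dotp q + real_of_int p\<bar> \<le> exp (- (1 + \<gamma>) * t)"
    using approx[of "max 1 (- ln m + 1)"] unfolding dotp_def by blast
  obtain i0 where i0: "q i0 \<noteq> 0" using q(2) by blast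
  have S1: "1 \<le> sup_norm_int n q"
  proof -
    have "i0 \<in> {1..n}" using i0 q(1) by blast
    moreover have "1 \<le> real_of_int \<bar>q i0\<bar>" using i0 by (simp flip: of_int_abs)
    ultimately show ?thesis using sup_norm_int_ge[of i0 n q] by linarith
  qed
  have S2: "sup_norm_int n q \<le> exp ((1 / real n - \<gamma>) * t)"
    by (rule sup_norm_int_le) (use q(3) in auto)
  have "exp (- (1 + \<gamma>) * t) \<le> exp ((1 / real n - \<gamma>) * t) powr (- v)"
  proof -
    have "(1 / real n - \<gamma>) * v \<le> 1 + \<gamma>"
    proof -
      have "(1 / real n - \<gamma>) * v = (1 + \<gamma>) - \<gamma> * v" using n by (simp add: v_def field_simps)
      also have "\<dots> \<le> 1 + \<gamma>" using \<gamma> v by simp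
      finally show ?thesis .
    qed
    then have "(1 / real n - \<gamma>) * v * t \<le> (1 + \<gamma>) * t" using t by (intro mult_right_mono) auto
    then show ?thesis by (simp add: powr_def algebra_simps)
  qed
  also have "\<dots> \<le> sup_norm_int n q powr (- v)"
    using S1 S2 v by (intro powr_mono2') auto
  finally have "\<bar>dotp q + real_of_int p\<bar> \<le> sup_norm_int n q powr (- v)" using q(4) by linarith
  then have "q \<in> Q" unfolding Q_def mem_Collect_eq by (intro conjI q(1) exI[of _ p])
  then have "q \<in> Q'" using q(2) by (simp add: Q'_def)
  then have "m \<le> dst q" by (rule m)
  also have "\<dots> \<le> \<bar>dotp q + real_of_int p\<bar>"
    using round_diff_minimal[of "dotp q" "- p"] by (simp add: dst_def)
  also have "\<dots> \<le> exp (- (1 + \<gamma>) * t)" by (rule q)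
  also have "\<dots> \<le> exp (- t)"
  proof -
    have "0 \<le> \<gamma> * t" using \<gamma> t by simp
    then show ?thesis by (simp add: algebra_simps)
  qed
  also have "\<dots> < exp (ln m)" using t by simp
  finally show False using m(1) by simp
qed

text \<open>Coordinate 0 of the image is the linear form and the others are \<open>q\<close>, each
  rescaled by the flow. Half of the rate \<open>\<beta>\<close> absorbs the constant
  \<open>c\<close> for large \<open>t\<close>.\<close>

lemma VWA_if_short_vectors:
  assumes n: "1 \<le> n" and \<beta>: "0 < \<beta>" and c: "0 < c"
    and short: "\<And>T. \<exists>t\<ge>T. \<exists>v. (\<forall>i>n. v i = 0) \<and> (\<exists>i\<le>n. v i \<noteq> (0::int)) \<and>
      (\<forall>i\<le>n. \<bar>flow_vec n t y (\<lambda>i. real_of_int (v i)) i\<bar> \<le> c * exp (- \<beta> * t))"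
  shows "VWA n y"
proof (rule VWA_if_approximations[OF n, of "\<beta> / 2"])
  fix T
  obtain t v where t: "t \<ge> max T (max 1 (2 * ln c / \<beta>))" and v: "\<forall>i>n. v i = 0" "\<exists>i\<le>n. v i \<noteq> (0::int)"
      "\<And>i. i \<le> n \<Longrightarrow> \<bar>flow_vec n t y (\<lambda>i. real_of_int (v i)) i\<bar> \<le> c * exp (- \<beta> * t)"
    using short[of "max T (max 1 (2 * ln c / \<beta>))"] by blast
  have "ln c \<le> \<beta> / 2 * t" using t \<beta> by (simp add: field_simps)
  then have "c \<le> exp (\<beta> / 2 * t)" using c by (metis exp_le_cancel_iff exp_ln)
  then have "c * exp (- \<beta> * t) \<le> exp (\<beta> / 2 * t) * exp (- \<beta> * t)" by (intro mult_right_mono) auto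
  also have "\<dots> = exp (- (\<beta> / 2) * t)" by (simp add: exp_add[symmetric] field_simps)
  finally have small: "c * exp (- \<beta> * t) \<le> exp (- (\<beta> / 2) * t)" .
  define q where "q i = (if i \<in> {1..n} then v i else 0)" for i
  have eqs: "(\<Sum>i\<in>{1..n}. y i * real_of_int (q i)) = (\<Sum>i\<in>{1..n}. y i * real_of_int (v i))"
    by (rule sum.cong) (auto simp: q_def)
  define z where "z = \<bar>(\<Sum>i\<in>{1..n}. y i * real_of_int (q i)) + real_of_int (v 0)\<bar>"
  have "exp t * z \<le> exp (- (\<beta> / 2) * t)"
    using v(3)[of 0] small unfolding z_def eqs flow_vec_0 by (simp add: abs_mult add.commute)
  then have "exp (- t) * (exp t * z) \<le> exp (- t) * exp (- (\<beta> / 2) * t)" by (intro mult_left_mono) auto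
  also have "\<dots> = exp (- (1 + \<beta> / 2) * t)" by (simp add: exp_add[symmetric] algebra_simps)
  also have "exp (- t) * (exp t * z) = z" by (simp add: exp_minus)
  finally have b0: "\<bar>(\<Sum>i\<in>{1..n}. y i * real_of_int (q i)) + real_of_int (v 0)\<bar> \<le> exp (- (1 + \<beta> / 2) * t)"
    by (simp add: z_def)
  have bq: "real_of_int \<bar>q i\<bar> \<le> exp ((1 / real n - \<beta> / 2) * t)" if "i \<in> {1..n}" for i
  proof -
    have "exp (- t / real n) * \<bar>real_of_int (v i)\<bar> \<le> exp (- (\<beta> / 2) * t)"
      using v(3)[of i] small that by (simp add: flow_vec_pos abs_mult)
    then have "exp (t / real n) * (exp (- t / real n) * \<bar>real_of_int (v i)\<bar>) \<le> exp (t / real n) * exp (- (\<beta> / 2) * t)"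
      by (intro mult_left_mono) auto
    moreover have "exp (t / real n) * (exp (- t / real n) * \<bar>real_of_int (v i)\<bar>) = \<bar>real_of_int (v i)\<bar>"
      by (simp add: exp_minus)
    moreover have "exp (t / real n) * exp (- (\<beta> / 2) * t) = exp ((1 / real n - \<beta> / 2) * t)"
      unfolding exp_add[symmetric] by (simp add: left_diff_distrib)
    ultimately have "\<bar>real_of_int (v i)\<bar> \<le> exp ((1 / real n - \<beta> / 2) * t)" by (simp only:)
    then show ?thesis using that by (simp add: q_def)
  qed
  \<comment> \<open>Otherwise \<open>v 0\<close> is an integer of absolute value below 1, and the
    whole vector vanishes.\<close>
  have "\<exists>i. q i \<noteq> 0"
  proof (rule ccontr)
    assume "\<not> ?thesis"
    then have q0: "q i = 0" for i by blast
    then have "\<bar>real_of_int (v 0)\<bar> \<le> exp (- (1 + \<beta> / 2) * t)" using b0 by simp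
    also have "\<dots> < 1"
    proof -
      have "0 < (1 + \<beta> / 2) * t" using t \<beta> by (intro mult_pos_pos) auto
      then show ?thesis by (simp only: mult_minus_left exp_less_one_iff neg_less_0_iff_less)
    qed
    finally have "v 0 = 0" by linarith
    moreover obtain i where "i \<le> n" "v i \<noteq> 0" using v(2) by blast
    ultimately show False using q0[of i] by (cases "i = 0") (auto simp: q_def)
  qed
  then have q1: "\<exists>i. q i \<noteq> 0" .
  have q0: "\<forall>i. i \<notin> {1..n} \<longrightarrow> q i = 0" by (auto simp: q_def)
  have "T \<le> t" using t by simp
  then show "\<exists>t\<ge>T. \<exists>q p. (\<forall>i. i \<notin> {1..n} \<longrightarrow> q i = 0) \<and> (\<exists>i. q i \<noteq> (0::int)) \<and>
      (\<forall>i\<in>{1..n}. real_of_int \<bar>q i\<bar> \<le> exp ((1 / real n - \<beta> / 2) * t)) \<and>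
      \<bar>(\<Sum>i\<in>{1..n}. y i * real_of_int (q i)) + real_of_int p\<bar> \<le> exp (- (1 + \<beta> / 2) * t)"
    by (rule exI[of _ t, OF conjI], intro exI[of _ q] exI[of _ "v 0"] conjI ballI q0 q1 b0 bq)
qed (use \<beta> in simp)

text \<open>For an approximation of norm S and exponent w the time t = \<open>\<kappa>\<close> ln S
  balances the linear form against the remaining coordinates: both become
  e^(-\<open>\<gamma>\<close> t). Rounding t down to an integer costs the factor e.\<close>

lemma short_vectors_if_VWA:
  assumes n: "1 \<le> n" and "VWA n y"
  shows "\<exists>\<gamma>>0. \<forall>N::nat. \<exists>m\<ge>N. \<exists>v. (\<forall>i>n. v i = 0) \<and> (\<exists>i\<le>n. v i \<noteq> (0::int)) \<and>
    (\<forall>i\<le>n. \<bar>flow_vec n (real m) y (\<lambda>i. real_of_int (v i)) i\<bar> \<le> exp 1 * exp (- \<gamma> * real m))"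
proof -
  define Q where "Q w = {q :: nat \<Rightarrow> int. (\<forall>i. i \<notin> {1..n} \<longrightarrow> q i = 0) \<and>
        (\<exists>p::int. \<bar>(\<Sum>i\<in>{1..n}. y i * real_of_int (q i)) + real_of_int p\<bar> \<le> sup_norm_int n q powr (- w))}" for w
  obtain w where w: "w > real n" and inf: "infinite (Q w)"
    using assms(2) unfolding VWA_def Q_def by blast
  have n0: "0 < real n" and w0: "0 < w" using n w by auto
  \<comment> \<open>The solution of \<open>\<kappa>\<close> - w = 1 - \<open>\<kappa>\<close>/n;
    \<open>\<gamma>\<close> is the negative of the common value divided by \<open>\<kappa>\<close>,
    positive since w > n.\<close>
  define \<kappa> where "\<kappa> = (1 + w) * real n / (real n + 1)"
  define \<gamma> where "\<gamma> = (w - real n) / (real n * (1 + w))"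
  have \<kappa>: "0 < \<kappa>" using n0 w0 by (simp add: \<kappa>_def)
  have \<gamma>: "0 < \<gamma>" using n0 w0 w by (simp add: \<gamma>_def)
  have k1: "\<kappa> - w = - \<gamma> * \<kappa>" and k2: "1 - \<kappa> / real n = - \<gamma> * \<kappa>"
    using n0 w0 by (simp_all add: \<kappa>_def \<gamma>_def divide_simps) (simp_all add: algebra_simps)
  have main: "\<exists>m\<ge>N. \<exists>v. (\<forall>i>n. v i = 0) \<and> (\<exists>i\<le>n. v i \<noteq> (0::int)) \<and>
    (\<forall>i\<le>n. \<bar>flow_vec n (real m) y (\<lambda>i. real_of_int (v i)) i\<bar> \<le> exp 1 * exp (- \<gamma> * real m))" for N :: nat
  proof -
    \<comment> \<open>Norms above \<open>X\<close> give times at least \<open>N\<close>, and only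
      finitely many of the infinitely many \<open>q\<close> lie below.\<close>
    define X where "X = exp (real N / \<kappa>)"
    have X1: "1 \<le> X" using \<kappa> by (simp add: X_def)
    define A where "A = {q :: nat \<Rightarrow> int. (\<forall>i. i \<notin> {1..n} \<longrightarrow> q i = 0) \<and> sup_norm_int n q \<le> X}"
    have "finite A" unfolding A_def by (rule finite_bounded_int_vectors)
    then have "\<not> Q w \<subseteq> A" using inf finite_subset by blast
    then obtain q where qQ: "q \<in> Q w" "q \<notin> A" by blast
    from qQ(1) have q1: "\<forall>i. i \<notin> {1..n} \<longrightarrow> q i = 0"
      and "\<exists>p::int. \<bar>(\<Sum>i\<in>{1..n}. y i * real_of_int (q i)) + real_of_int p\<bar> \<le> sup_norm_int n q powr (- w)"
      unfolding Q_def mem_Collect_eq by (rule conjunct1) (use qQ(1) in \<open>simp only: Q_def mem_Collect_eq\<close>)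
    then obtain p :: int where q3: "\<bar>(\<Sum>i\<in>{1..n}. y i * real_of_int (q i)) + real_of_int p\<bar> \<le> sup_norm_int n q powr (- w)"
      by (elim exE)
    have q2: "\<not> sup_norm_int n q \<le> X" using qQ(2) q1 unfolding A_def mem_Collect_eq by blast
    note q = q1 q2 q3
    define S where "S = sup_norm_int n q"
    define t where "t = \<kappa> * ln S"
    define m where "m = nat \<lfloor>t\<rfloor>"
    have S: "X < S" using q(2) by (simp add: S_def)
    have "ln X < ln S" using S X1 by simp
    then have t: "real N \<le> t" using \<kappa> by (simp add: X_def t_def field_simps)
    then have m: "real m \<le> t" "t - 1 \<le> real m" "N \<le> m" unfolding m_def by linarith+
    have lnS: "0 \<le> ln S" using S X1 by simp
    define v where "v i = (if i = 0 then p else q i)" for i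
    have v0: "v i = 0" if "i > n" for i using that q(1) by (simp add: v_def)
    have v1: "\<exists>i\<le>n. v i \<noteq> 0"
    proof (rule ccontr)
      assume "\<not> ?thesis"
      then have "q i = 0" if "i \<in> {1..n}" for i using that by (force simp: v_def)
      then have "S \<le> 0" unfolding S_def by (intro sup_norm_int_le) auto
      then show False using S X1 by simp
    qed
    have v2: "\<bar>flow_vec n (real m) y (\<lambda>i. real_of_int (v i)) i\<bar> \<le> exp 1 * exp (- \<gamma> * real m)" if i: "i \<le> n" for i
    proof -
      have gt: "exp (- \<gamma> * t) \<le> exp (- \<gamma> * real m)" using \<gamma> m by simp
      show ?thesis
      proof (cases "i = 0")
        case True
        have "(\<Sum>i\<in>{1..n}. y i * real_of_int (v i)) = (\<Sum>i\<in>{1..n}. y i * real_of_int (q i))"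
          by (rule sum.cong) (auto simp: v_def)
        then have "\<bar>flow_vec n (real m) y (\<lambda>i. real_of_int (v i)) i\<bar> =
            exp (real m) * \<bar>(\<Sum>i\<in>{1..n}. y i * real_of_int (q i)) + real_of_int p\<bar>"
          unfolding True flow_vec_0 by (simp add: abs_mult v_def add.commute)
        also have "\<dots> \<le> exp t * S powr (- w)" using q(3) m by (intro mult_mono) (auto simp: S_def)
        also have "\<dots> = exp (t - w * ln S)" using S X1 by (simp add: powr_def exp_diff exp_minus field_simps)
        also have "t - w * ln S = - \<gamma> * t"
          using k1 by (simp add: t_def left_diff_distrib[symmetric] mult.assoc[symmetric])
        also have "exp (- \<gamma> * t) \<le> 1 * exp (- \<gamma> * real m)" using gt by simp
        also have "\<dots> \<le> exp 1 * exp (- \<gamma> * real m)" by (intro mult_right_mono) auto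
        finally show ?thesis .
      next
        case False
        then have "\<bar>flow_vec n (real m) y (\<lambda>i. real_of_int (v i)) i\<bar> = exp (- real m / real n) * real_of_int \<bar>q i\<bar>"
          using i by (simp add: flow_vec_pos abs_mult v_def)
        also have "\<dots> \<le> exp (1 - t / real n) * S"
        proof (intro mult_mono)
          have "- real m / real n \<le> (1 - t) / real n" using m n0 by (intro divide_right_mono) auto
          also have "\<dots> \<le> 1 - t / real n" using n0 n by (simp add: diff_divide_distrib)
          finally show "exp (- real m / real n) \<le> exp (1 - t / real n)" by simp
          show "real_of_int \<bar>q i\<bar> \<le> S" unfolding S_def by (rule sup_norm_int_ge) (use False i in auto)
        qed auto
        also have "\<dots> = exp 1 * exp (ln S - t / real n)"
          using S X1 by (simp add: exp_diff)
        also have "ln S - t / real n = - \<gamma> * t"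
        proof -
          have "ln S - t / real n = (1 - \<kappa> / real n) * ln S" by (simp add: t_def left_diff_distrib)
          then show ?thesis unfolding k2 by (simp add: t_def)
        qed
        also have "exp 1 * exp (- \<gamma> * t) \<le> exp 1 * exp (- \<gamma> * real m)" using gt by simp
        finally show ?thesis .
      qed
    qed
    show ?thesis
      by (rule exI[of _ m], rule conjI[OF m(3)], rule exI[of _ v]) (intro conjI allI impI v0 v1 v2)
  qed
  show ?thesis by (rule exI[of _ \<gamma>], rule conjI[OF \<gamma>], rule allI, rule main)
qed

section \<open>Quantitative nondivergence\<close>

lemma emeasure_lebesgue_ball_scale:
  fixes z y :: "'a::euclidean_space"
  assumes "0 \<le> s" "0 \<le> a"
  shows "emeasure lebesgue (ball y (a * s)) = ennreal (a ^ DIM('a)) * emeasure lebesgue (ball z s)"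
  using assms by (simp add: emeasure_ball power_mult_distrib ennreal_mult[symmetric] mult_ac)

lemma measure_lebesgue_ball_scale:
  fixes z y :: "'a::euclidean_space"
  assumes "0 \<le> s" "0 \<le> a"
  shows "measure lebesgue (ball y (a * s)) = a ^ DIM('a) * measure lebesgue (ball z s)"
  using assms by (simp add: measure_def emeasure_lebesgue_ball_scale[OF assms, of y z] enn2real_mult)

lemma emeasure_countable_cover_le:
  assumes D: "countable D" and X: "\<And>y. y \<in> D \<Longrightarrow> X y \<in> sets M" and Y: "\<And>y. y \<in> D \<Longrightarrow> Y y \<in> sets M"
    and disj: "disjoint_family_on Y D" and le: "\<And>y. y \<in> D \<Longrightarrow> emeasure M (X y) \<le> c * emeasure M (Y y)"
  shows "emeasure M (\<Union>y\<in>D. X y) \<le> c * emeasure M (\<Union>y\<in>D. Y y)"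
proof -
  \<comment> \<open>The member of \<open>D\<close> with number \<open>k\<close>, or nothing; this
    turns the family into a sequence.\<close>
  define S where "S k = {y \<in> D. to_nat_on D y = k}" for k
  have S: "S k = {} \<or> (\<exists>y\<in>D. S k = {y})" for k
    using inj_on_to_nat_on[OF D] unfolding S_def inj_on_def by blast
  have UN: "(\<Union>y\<in>D. Z y) = (\<Union>k. \<Union>y\<in>S k. Z y)" for Z :: "'a \<Rightarrow> 'b set"
    unfolding S_def by blast
  have XS: "(\<Union>y\<in>S k. X y) \<in> sets M" and YS: "(\<Union>y\<in>S k. Y y) \<in> sets M"
    and leS: "emeasure M (\<Union>y\<in>S k. X y) \<le> c * emeasure M (\<Union>y\<in>S k. Y y)" for k
    using S[of k] X Y le by auto
  have disjS: "disjoint_family (\<lambda>k. \<Union>y\<in>S k. Y y)"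
    using disj unfolding disjoint_family_on_def S_def by fastforce
  have "emeasure M (\<Union>y\<in>D. X y) \<le> (\<Sum>k. emeasure M (\<Union>y\<in>S k. X y))"
    unfolding UN by (rule emeasure_subadditive_countably) (use XS in auto)
  also have "\<dots> \<le> (\<Sum>k. c * emeasure M (\<Union>y\<in>S k. Y y))"
    by (intro suminf_le leS) auto
  also have "\<dots> = c * (\<Sum>k. emeasure M (\<Union>y\<in>S k. Y y))" by (rule ennreal_suminf_cmult)
  also have "(\<Sum>k. emeasure M (\<Union>y\<in>S k. Y y)) = emeasure M (\<Union>k. \<Union>y\<in>S k. Y y)"
    by (rule suminf_emeasure) (use YS disjS in auto)
  finally show ?thesis unfolding UN .
qed

text \<open>Goodness measured against values at single points instead of the supremum. In this form
  it is stated in real numbers and passes to covolumes, where the minor to compare with depends on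
  \<open>w\<close>.\<close>

definition point_good :: "real \<Rightarrow> real \<Rightarrow> 'a::euclidean_space set \<Rightarrow> ('a \<Rightarrow> real) \<Rightarrow> bool" where
  "point_good C \<alpha> V \<psi> \<longleftrightarrow> (\<forall>z r w \<epsilon>. 0 < r \<longrightarrow> ball z r \<subseteq> V \<longrightarrow> w \<in> ball z r \<longrightarrow> 0 < \<epsilon> \<longrightarrow>
     measure lebesgue {x \<in> ball z r. \<psi> x < \<epsilon> * \<psi> w} \<le> C * \<epsilon> powr \<alpha> * measure lebesgue (ball z r))"

lemma open_sublevel:
  fixes \<psi> :: "'a::euclidean_space \<Rightarrow> real"
  assumes "continuous_on V \<psi>" "ball z r \<subseteq> V"
  shows "open {x \<in> ball z r. \<psi> x < c}"
proof -
  have "open (ball z r \<inter> \<psi> -` {..<c})"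
    using continuous_on_subset[OF assms] by (intro continuous_open_preimage) auto
  then show ?thesis by (simp add: vimage_def Int_def)
qed

lemma sublevel_measure:
  fixes \<psi> :: "'a::euclidean_space \<Rightarrow> real"
  assumes "continuous_on V \<psi>" "ball z r \<subseteq> V" "point_good C \<alpha> V \<psi>" "0 < r" "0 < \<epsilon>" "0 < \<rho>" "0 \<le> C"
    and w: "w \<in> ball z r" "\<rho> \<le> \<psi> w"
  shows "{x \<in> ball z r. \<psi> x < \<epsilon>} \<in> sets lebesgue"
    and "emeasure lebesgue {x \<in> ball z r. \<psi> x < \<epsilon>} \<le> ennreal (C * (\<epsilon> / \<rho>) powr \<alpha>) * emeasure lebesgue (ball z r)"
proof -
  let ?A = "{x \<in> ball z r. \<psi> x < \<epsilon>}" and ?B = "{x \<in> ball z r. \<psi> x < \<epsilon> / \<rho> * \<psi> w}"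
  have op: "open ?A" "open ?B" using open_sublevel[OF assms(1,2)] by blast+
  then show "?A \<in> sets lebesgue" by auto
  have lm: "?A \<in> lmeasurable" "?B \<in> lmeasurable" "ball z r \<in> lmeasurable"
    using op by (auto intro!: lmeasurable_open bounded_subset[OF bounded_ball[of z r]])
  have "\<epsilon> \<le> \<epsilon> / \<rho> * \<psi> w" using assms(5,6) w(2) by (simp add: field_simps)
  then have "?A \<subseteq> ?B" by auto
  then have "measure lebesgue ?A \<le> measure lebesgue ?B"
    using lm by (intro measure_mono_fmeasurable) (auto simp: fmeasurableD)
  also have "\<dots> \<le> C * (\<epsilon> / \<rho>) powr \<alpha> * measure lebesgue (ball z r)"
    using assms(2-6) w(1) unfolding point_good_def by (meson divide_pos_pos)
  finally have "ennreal (measure lebesgue ?A) \<le> ennreal (C * (\<epsilon> / \<rho>) powr \<alpha> * measure lebesgue (ball z r))"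
    by (rule ennreal_leI)
  then show "emeasure lebesgue ?A \<le> ennreal (C * (\<epsilon> / \<rho>) powr \<alpha>) * emeasure lebesgue (ball z r)"
    using lm assms(7) by (simp add: emeasure_eq_measure2 ennreal_mult)
qed

text \<open>Were \<open>\<psi> w\<close> larger, the inner ball would lie in a sublevel set of the
  fivefold ball whose measure, by goodness, is below the share 5^(-d) that the inner ball occupies.
  \<open>K\<close> is the value at which C 5^d K^(-\<open>\<alpha>\<close>) drops to 1.\<close>

lemma point_good_doubling:
  fixes \<psi> :: "'a::euclidean_space \<Rightarrow> real"
  assumes cont: "continuous_on V \<psi>" and V: "ball y (5 * s) \<subseteq> V" and good: "point_good C \<alpha> V \<psi>"
    and pos: "0 < s" "0 < \<rho>" "0 < C" "0 < \<alpha>"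
    and small: "\<And>x. x \<in> ball y s \<Longrightarrow> \<psi> x < \<rho>" and w: "w \<in> ball y (5 * s)"
  shows "\<psi> w \<le> max 1 ((C * 5 ^ DIM('a)) powr (1 / \<alpha>)) * \<rho>"
proof (rule ccontr)
  define K where "K = max 1 ((C * 5 ^ DIM('a)) powr (1 / \<alpha>))"
  have K: "1 \<le> K" by (simp add: K_def)
  assume "\<not> ?thesis"
  then have big: "K * \<rho> < \<psi> w" by (simp add: K_def)
  have "0 < K * \<rho>" using K pos by (intro mult_pos_pos) auto
  then have pw: "0 < \<psi> w" using big by linarith
  define \<epsilon> where "\<epsilon> = \<rho> / \<psi> w"
  have e: "0 < \<epsilon>" "K * \<epsilon> < 1" using pos pw big by (auto simp: \<epsilon>_def)
  let ?B = "{x \<in> ball y (5 * s). \<psi> x < \<epsilon> * \<psi> w}"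
  have "open ?B" by (rule open_sublevel[OF cont V])
  then have lm: "?B \<in> lmeasurable"
    by (intro lmeasurable_open bounded_subset[OF bounded_ball[of y "5 * s"]]) auto
  have "\<epsilon> * \<psi> w = \<rho>" using pw by (simp add: \<epsilon>_def)
  moreover have "ball y s \<subseteq> ball y (5 * s)" using pos by (intro subset_ball) simp
  ultimately have "ball y s \<subseteq> ?B" using small by auto
  then have "measure lebesgue (ball y s) \<le> measure lebesgue ?B"
    using lm by (intro measure_mono_fmeasurable) auto
  also have "\<dots> \<le> C * \<epsilon> powr \<alpha> * measure lebesgue (ball y (5 * s))"
    using good V w e(1) pos(1) unfolding point_good_def by simp
  also have "\<dots> = (C * 5 ^ DIM('a)) * \<epsilon> powr \<alpha> * measure lebesgue (ball y s)"
    using pos(1) by (subst measure_lebesgue_ball_scale[of s 5 y y]) auto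
  finally have "1 * measure lebesgue (ball y s) \<le> (C * 5 ^ DIM('a)) * \<epsilon> powr \<alpha> * measure lebesgue (ball y s)"
    by simp
  moreover have "0 < measure lebesgue (ball y s)" using pos(1) by (simp add: content_ball_pos)
  ultimately have 1: "1 \<le> (C * 5 ^ DIM('a)) * \<epsilon> powr \<alpha>" by (rule mult_right_le_imp_le)
  have "C * 5 ^ DIM('a) = ((C * 5 ^ DIM('a)) powr (1 / \<alpha>)) powr \<alpha>"
    using pos by (simp add: powr_powr)
  also have "\<dots> \<le> K powr \<alpha>" using pos by (intro powr_mono2) (auto simp: K_def)
  finally have "(C * 5 ^ DIM('a)) * \<epsilon> powr \<alpha> \<le> K powr \<alpha> * \<epsilon> powr \<alpha>" by (intro mult_right_mono) auto
  also have "\<dots> = (K * \<epsilon>) powr \<alpha>" using K e(1) by (simp add: powr_mult)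
  also have "\<dots> < 1 powr \<alpha>"
    by (rule powr_less_mono2) (use e K pos(4) in auto)
  finally show False using 1 by simp
qed

text \<open>The marked points of Kleinbock and Margulis, with an abstract comparability
  \<open>R\<close>. The upper bound on flag members has the factor \<open>K\<close> because balls
  are maximal only up to a factor and doubling is invoked.\<close>

definition marked :: "('p \<Rightarrow> 'p \<Rightarrow> bool) \<Rightarrow> ('p \<Rightarrow> 'a \<Rightarrow> real) \<Rightarrow> real \<Rightarrow> real \<Rightarrow> real \<Rightarrow> 'p set \<Rightarrow> 'a \<Rightarrow> bool" where
  "marked R \<psi> \<epsilon> K \<rho> Q x \<longleftrightarrow> (\<exists>F. finite F \<and> F \<subseteq> Q \<and> (\<forall>p\<in>F. \<forall>q\<in>F. p \<noteq> q \<longrightarrow> R p q) \<and>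
     (\<forall>q\<in>F. \<epsilon> \<le> \<psi> q x \<and> \<psi> q x \<le> K * \<rho>) \<and> (\<forall>p\<in>Q. (\<forall>q\<in>F. R p q) \<longrightarrow> \<rho> \<le> \<psi> p x))"

text \<open>15 = 5 * 3: the Vitali enlargement, and the inclusion of the disjoint balls in the ball
  of radius 3r. The sum collects the recursive exceptional set and the set where the chosen member
  falls below \<open>\<epsilon>\<close>.\<close>

primrec nondiv_const :: "nat \<Rightarrow> real \<Rightarrow> nat \<Rightarrow> real" where
  "nondiv_const d C 0 = 0"
| "nondiv_const d C (Suc k) = 15 ^ d * (nondiv_const d C k + C)"

lemma nondiv_const_nonneg: "0 \<le> C \<Longrightarrow> 0 \<le> nondiv_const d C k"
  by (induction k) auto

text \<open>
  Taking the radius maximal only up to a factor 2 avoids the discreteness of the set of small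
  covolumes, and the loss is harmless because good functions are doubling (lemma \<open>point_good_doubling\<close>).
  This also allows Vitali's covering lemma in place of Besicovitch's in the next proof.
\<close>

lemma maximal_radius:
  fixes \<psi> :: "'p \<Rightarrow> 'a::euclidean_space \<Rightarrow> real"
  assumes r: "0 < r" and big: "\<And>p. p \<in> Q \<Longrightarrow> \<exists>x\<in>ball z r. \<rho> \<le> \<psi> p x"
    and cont: "\<And>p. p \<in> Q \<Longrightarrow> continuous_on (ball z r) (\<psi> p)"
    and y: "y \<in> ball z r" "p0 \<in> Q" "\<psi> p0 y < \<rho>"
  shows "\<exists>s p. 0 < s \<and> s \<le> 2 * r \<and> p \<in> Q \<and> (\<forall>x\<in>ball y s. \<psi> p x < \<rho>) \<and>
    (\<forall>q\<in>Q. \<exists>x\<in>ball y (2 * s). \<rho> \<le> \<psi> q x)"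
proof -
  \<comment> \<open>The cap 2r keeps \<open>T\<close> bounded and loses nothing: a ball about
    \<open>y\<close> of larger radius contains \<open>ball z r\<close>, where every member reaches
    \<open>\<rho>\<close>.\<close>
  define T where "T = {s. 0 < s \<and> s \<le> 2 * r \<and> (\<exists>p\<in>Q. \<forall>x\<in>ball y s. \<psi> p x < \<rho>)}"
  have "open {x \<in> ball z r. \<psi> p0 x < \<rho>}" by (rule open_sublevel[OF cont[OF y(2)]]) simp
  then obtain \<delta> where \<delta>: "0 < \<delta>" "ball y \<delta> \<subseteq> {x \<in> ball z r. \<psi> p0 x < \<rho>}"
    by (rule openE[where x = y]) (use y in auto)
  have "\<forall>x\<in>ball y (min \<delta> (2 * r)). \<psi> p0 x < \<rho>"
    using \<delta>(2) subset_ball[of "min \<delta> (2 * r)" \<delta> y] by auto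
  then have "min \<delta> (2 * r) \<in> T"
    unfolding T_def mem_Collect_eq using \<delta>(1) r y(2) by (intro conjI bexI[of _ p0]) auto
  then have ne: "T \<noteq> {}" by blast
  have bdd: "bdd_above T" by (rule bdd_aboveI[of _ "2 * r"]) (simp add: T_def)
  have "0 < Sup T"
    using cSup_upper[OF \<open>min \<delta> (2 * r) \<in> T\<close> bdd] \<delta>(1) r by linarith
  then have "Sup T / 2 < Sup T" by simp
  then obtain s where s: "s \<in> T" "Sup T / 2 < s" using less_cSup_iff[OF ne bdd] by blast
  then obtain p where p: "p \<in> Q" "\<forall>x\<in>ball y s. \<psi> p x < \<rho>" and s': "0 < s" "s \<le> 2 * r"
    by (auto simp: T_def)
  have "\<exists>x\<in>ball y (2 * s). \<rho> \<le> \<psi> q x" if q: "q \<in> Q" for q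
  proof (rule ccontr)
    assume "\<not> ?thesis"
    then have lt: "\<forall>x\<in>ball y (2 * s). \<psi> q x < \<rho>" by (auto simp: not_le)
    show False
    proof (cases "2 * s \<le> 2 * r")
      case True
      then have "2 * s \<in> T" using lt q s' by (auto simp: T_def)
      then show False using cSup_upper[OF _ bdd, of "2 * s"] s(2) by linarith
    next
      case False
      then have "ball z r \<subseteq> ball y (2 * s)"
        using y(1) by (intro ball_subset_ball_iff[THEN iffD2]) (auto simp: dist_commute)
      then show False using big[OF q] lt by force
    qed
  qed
  then show ?thesis using p s' by blast
qed

text \<open>Induction on the number of ranks in \<open>Q\<close>. Vitali selects nearly maximal
  balls around the bad points; on each fivefold ball the induction hypothesis gives a flag among the
  members related to the chosen one, which is then added. Each round dilates by at most 11, hence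
  the room required in \<open>V\<close>.\<close>

lemma nondivergence:
  fixes \<psi> :: "'p \<Rightarrow> 'a::euclidean_space \<Rightarrow> real" and rk :: "'p \<Rightarrow> nat"
  assumes pos: "0 < C" "0 < \<alpha>" "0 < \<epsilon>" "0 < \<rho>"
    and K: "K = max 1 ((C * 5 ^ DIM('a)) powr (1 / \<alpha>))"
    and sym: "\<And>p q. R p q \<Longrightarrow> R q p"
    and rk: "\<And>p q. p \<in> P \<Longrightarrow> q \<in> P \<Longrightarrow> R p q \<Longrightarrow> rk p \<noteq> rk q"
    and cont: "\<And>p. p \<in> P \<Longrightarrow> continuous_on V (\<psi> p)"
    and good: "\<And>p. p \<in> P \<Longrightarrow> point_good C \<alpha> V (\<psi> p)"
    and Q: "Q \<subseteq> P" "finite (rk ` Q)" "card (rk ` Q) \<le> k"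
    and r: "0 < r" "ball z (11 ^ k * r) \<subseteq> V"
    and big: "\<And>p. p \<in> Q \<Longrightarrow> \<exists>x\<in>ball z r. \<rho> \<le> \<psi> p x"
  shows "\<exists>N\<in>sets lebesgue.
      emeasure lebesgue N \<le> ennreal (nondiv_const DIM('a) C k * (\<epsilon> / \<rho>) powr \<alpha>) * emeasure lebesgue (ball z r) \<and>
      (\<forall>x\<in>ball z r - N. marked R \<psi> \<epsilon> K \<rho> Q x)"
  using Q r big
proof (induction k arbitrary: Q z r)
  case 0
  then have "Q = {}" by simp
  then have "marked R \<psi> \<epsilon> K \<rho> Q x" for x unfolding marked_def by (intro exI[of _ "{}"]) simp
  then show ?case by (intro bexI[of _ "{}"]) auto
next
  case (Suc k)
  note Q = Suc.prems(1,2,3) and r = Suc.prems(4) and BV = Suc.prems(5) and big = Suc.prems(6)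
  define E where "E = {x \<in> ball z r. \<exists>p\<in>Q. \<psi> p x < \<rho>}"
  have one: "(1::real) \<le> 11 ^ k" by simp
  have zV: "ball z r \<subseteq> V"
  proof -
    have "1 * r \<le> 11 ^ Suc k * r" using r by (intro mult_right_mono one_le_power) auto
    then show ?thesis using BV subset_ball[of r "11 ^ Suc k * r" z] by simp
  qed
  have "\<forall>y\<in>E. \<exists>sp. 0 < fst sp \<and> fst sp \<le> 2 * r \<and> snd sp \<in> Q \<and> (\<forall>x\<in>ball y (fst sp). \<psi> (snd sp) x < \<rho>) \<and>
    (\<forall>q\<in>Q. \<exists>x\<in>ball y (2 * fst sp). \<rho> \<le> \<psi> q x)"
  proof
    fix y assume "y \<in> E"
    then obtain p0 where p0: "y \<in> ball z r" "p0 \<in> Q" "\<psi> p0 y < \<rho>" by (auto simp: E_def)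
    have contz: "continuous_on (ball z r) (\<psi> p)" if "p \<in> Q" for p
      using cont[of p] that Q(1) zV continuous_on_subset by blast
    have "\<exists>s p. 0 < s \<and> s \<le> 2 * r \<and> p \<in> Q \<and> (\<forall>x\<in>ball y s. \<psi> p x < \<rho>) \<and>
      (\<forall>q\<in>Q. \<exists>x\<in>ball y (2 * s). \<rho> \<le> \<psi> q x)"
      by (rule maximal_radius[where \<psi> = \<psi> and \<rho> = \<rho>, OF r big contz p0])
    then obtain s p where "0 < s \<and> s \<le> 2 * r \<and> p \<in> Q \<and> (\<forall>x\<in>ball y s. \<psi> p x < \<rho>) \<and>
      (\<forall>q\<in>Q. \<exists>x\<in>ball y (2 * s). \<rho> \<le> \<psi> q x)" by (elim exE)
    then show "\<exists>sp. 0 < fst sp \<and> fst sp \<le> 2 * r \<and> snd sp \<in> Q \<and> (\<forall>x\<in>ball y (fst sp). \<psi> (snd sp) x < \<rho>) \<and>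
      (\<forall>q\<in>Q. \<exists>x\<in>ball y (2 * fst sp). \<rho> \<le> \<psi> q x)" by (intro exI[of _ "(s, p)"]) simp
  qed
  from bchoice[OF this] obtain sp where sp: "\<forall>y\<in>E. 0 < fst (sp y) \<and> fst (sp y) \<le> 2 * r \<and> snd (sp y) \<in> Q \<and>
    (\<forall>x\<in>ball y (fst (sp y)). \<psi> (snd (sp y)) x < \<rho>) \<and>
    (\<forall>q\<in>Q. \<exists>x\<in>ball y (2 * fst (sp y)). \<rho> \<le> \<psi> q x)" by (elim exE)
  define s where "s y = fst (sp y)" for y
  define p where "p y = snd (sp y)" for y
  have s: "0 < s y" "s y \<le> 2 * r" and p: "p y \<in> Q" "\<And>x. x \<in> ball y (s y) \<Longrightarrow> \<psi> (p y) x < \<rho>"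
    and sbig: "\<And>q. q \<in> Q \<Longrightarrow> \<exists>x\<in>ball y (2 * s y). \<rho> \<le> \<psi> q x" if "y \<in> E" for y
    using bspec[OF sp that] by (simp_all add: s_def p_def)
  have "E \<subseteq> (\<Union>y\<in>E. ball y (s y))" using s(1) by force
  then obtain D where D: "countable D" "D \<subseteq> E"
    "pairwise (\<lambda>i j. disjnt (ball i (s i)) (ball j (s j))) D" "E \<subseteq> (\<Union>y\<in>D. ball y (5 * s y))"
    by (rule Vitali_covering_lemma_balls[where a = "\<lambda>y. y" and r = s and B = "2 * r"]) (use s in blast)
  define c where "c = (nondiv_const DIM('a) C k + C) * (\<epsilon> / \<rho>) powr \<alpha>"
  have c0: "0 \<le> nondiv_const DIM('a) C k * (\<epsilon> / \<rho>) powr \<alpha>" "0 \<le> C * (\<epsilon> / \<rho>) powr \<alpha>"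
    using pos nondiv_const_nonneg[of C "DIM('a)" k] by auto
  have "\<forall>y\<in>D. \<exists>N. N \<in> sets lebesgue \<and>
      emeasure lebesgue N \<le> ennreal c * emeasure lebesgue (ball y (5 * s y)) \<and>
      (\<forall>x\<in>ball y (5 * s y) - N. marked R \<psi> \<epsilon> K \<rho> Q x)"
  proof
    fix y assume "y \<in> D"
    then have y: "y \<in> E" using D(2) by blast
    then have yz: "dist z y < r" by (simp add: E_def)
    \<comment> \<open>Related members differ in rank from \<open>p y\<close>, so at least one rank
      disappears.\<close>
    define Q' where "Q' = {q \<in> Q. R (p y) q}"
    have pP: "p y \<in> P" using p(1)[OF y] Q(1) by blast
    have "rk ` Q' \<subseteq> rk ` Q - {rk (p y)}"
      using rk[OF pP] Q(1) unfolding Q'_def by force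
    then have "card (rk ` Q') \<le> card (rk ` Q - {rk (p y)})" by (rule card_mono[rotated]) (use Q(2) in simp)
    also have "\<dots> < card (rk ` Q)" using p(1)[OF y] Q(2) by (intro card_Diff1_less) auto
    finally have card: "card (rk ` Q') \<le> k" using Q(3) by linarith
    have "rk ` Q' \<subseteq> rk ` Q" by (auto simp: Q'_def)
    then have Q': "Q' \<subseteq> P" "finite (rk ` Q')"
      using Q(1) finite_subset[OF _ Q(2)] by (auto simp: Q'_def)
    have s5: "0 < 5 * s y" using s(1)[OF y] by simp
    \<comment> \<open>Radius 5 s is at most 10 r and the centre is within r of \<open>z\<close>:
      this is the origin of 11.\<close>
    have yV: "ball y (11 ^ k * (5 * s y)) \<subseteq> V"
    proof -
      have 1: "11 ^ k * (5 * s y) \<le> 11 ^ k * (10 * r)" using s(2)[OF y] by (intro mult_left_mono) auto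
      have 2: "1 * r \<le> 11 ^ k * r" using r one by (intro mult_right_mono) auto
      have 3: "11 ^ Suc k * r = 11 ^ k * (10 * r) + 11 ^ k * r" by (simp add: algebra_simps)
      have "dist y z < r" using yz by (simp add: dist_commute)
      then have "dist y z + 11 ^ k * (5 * s y) \<le> 11 ^ Suc k * r" unfolding 3 using 1 2 by linarith
      then have "ball y (11 ^ k * (5 * s y)) \<subseteq> ball z (11 ^ Suc k * r)"
        by (intro ball_subset_ball_iff[THEN iffD2]) simp
      then show ?thesis using BV by blast
    qed
    have y5V: "ball y (5 * s y) \<subseteq> V"
    proof -
      have "1 * (5 * s y) \<le> 11 ^ k * (5 * s y)" using s5 one by (intro mult_right_mono) auto
      then show ?thesis using yV subset_ball[of "5 * s y" "11 ^ k * (5 * s y)" y] by simp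
    qed
    \<comment> \<open>Near-maximality already provides the large values within radius 2 s; the
      Vitali factor 5 preserves them, so the induction hypothesis applies to the enlarged
      ball.\<close>
    have big5: "\<exists>x\<in>ball y (5 * s y). \<rho> \<le> \<psi> q x" if "q \<in> Q" for q
    proof -
      have "ball y (2 * s y) \<subseteq> ball y (5 * s y)" using s(1)[OF y] by (intro subset_ball) simp
      then show ?thesis using sbig[OF y that] by blast
    qed
    have "\<exists>N\<in>sets lebesgue.
      emeasure lebesgue N \<le> ennreal (nondiv_const DIM('a) C k * (\<epsilon> / \<rho>) powr \<alpha>) * emeasure lebesgue (ball y (5 * s y)) \<and>
      (\<forall>x\<in>ball y (5 * s y) - N. marked R \<psi> \<epsilon> K \<rho> Q' x)"
      by (rule Suc.IH[OF Q' card s5 yV]) (use big5 in \<open>simp add: Q'_def\<close>)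
    then obtain N where N: "N \<in> sets lebesgue"
      "emeasure lebesgue N \<le> ennreal (nondiv_const DIM('a) C k * (\<epsilon> / \<rho>) powr \<alpha>) * emeasure lebesgue (ball y (5 * s y))"
      "\<forall>x\<in>ball y (5 * s y) - N. marked R \<psi> \<epsilon> K \<rho> Q' x" by blast
    define M where "M = {x \<in> ball y (5 * s y). \<psi> (p y) x < \<epsilon>}"
    obtain w where w: "w \<in> ball y (5 * s y)" "\<rho> \<le> \<psi> (p y) w" using big5[OF p(1)[OF y]] by blast
    have M: "M \<in> sets lebesgue"
      "emeasure lebesgue M \<le> ennreal (C * (\<epsilon> / \<rho>) powr \<alpha>) * emeasure lebesgue (ball y (5 * s y))"
      unfolding M_def
      by (rule sublevel_measure[OF cont[OF pP] y5V good[OF pP] s5 pos(3,4) _ w], use pos in simp)+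
    have "emeasure lebesgue (N \<union> M) \<le> emeasure lebesgue N + emeasure lebesgue M"
      by (rule emeasure_subadditive[OF N(1) M(1)])
    also have "\<dots> \<le> ennreal (nondiv_const DIM('a) C k * (\<epsilon> / \<rho>) powr \<alpha>) * emeasure lebesgue (ball y (5 * s y)) +
        ennreal (C * (\<epsilon> / \<rho>) powr \<alpha>) * emeasure lebesgue (ball y (5 * s y))"
      by (rule add_mono[OF N(2) M(2)])
    also have "\<dots> = ennreal c * emeasure lebesgue (ball y (5 * s y))"
      unfolding c_def distrib_right using c0 by (simp add: distrib_right[symmetric] ennreal_plus[symmetric] del: ennreal_plus)
    finally have NM: "emeasure lebesgue (N \<union> M) \<le> ennreal c * emeasure lebesgue (ball y (5 * s y))" .
    have "marked R \<psi> \<epsilon> K \<rho> Q x" if x: "x \<in> ball y (5 * s y)" "x \<notin> N" "x \<notin> M" for x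
    proof -
      have "marked R \<psi> \<epsilon> K \<rho> Q' x" using N(3) x by blast
      then obtain F where F: "finite F" "F \<subseteq> Q'" "\<forall>p\<in>F. \<forall>q\<in>F. p \<noteq> q \<longrightarrow> R p q"
        "\<forall>q\<in>F. \<epsilon> \<le> \<psi> q x \<and> \<psi> q x \<le> K * \<rho>" "\<forall>p\<in>Q'. (\<forall>q\<in>F. R p q) \<longrightarrow> \<rho> \<le> \<psi> p x"
        unfolding marked_def by (elim exE conjE)
      have up: "\<psi> (p y) x \<le> K * \<rho>"
        unfolding K by (rule point_good_doubling[OF cont[OF pP] y5V good[OF pP] s(1)[OF y] pos(4,1,2) p(2)[OF y] x(1)])
      have lo: "\<epsilon> \<le> \<psi> (p y) x" using x unfolding M_def by simp
      show ?thesis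
        unfolding marked_def
      proof (intro exI[of _ "insert (p y) F"] conjI)
        show "finite (insert (p y) F)" using F(1) by simp
        show "insert (p y) F \<subseteq> Q" using F(2) p(1)[OF y] by (auto simp: Q'_def)
        show "\<forall>p'\<in>insert (p y) F. \<forall>q\<in>insert (p y) F. p' \<noteq> q \<longrightarrow> R p' q"
          using F(2,3) sym by (auto simp: Q'_def)
        show "\<forall>q\<in>insert (p y) F. \<epsilon> \<le> \<psi> q x \<and> \<psi> q x \<le> K * \<rho>" using F(4) up lo by simp
        \<comment> \<open>Whatever is compatible with the enlarged flag is related to
          \<open>p y\<close> and hence lies in \<open>Q'\<close>.\<close>
        show "\<forall>p'\<in>Q. (\<forall>q\<in>insert (p y) F. R p' q) \<longrightarrow> \<rho> \<le> \<psi> p' x"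
          using F(5) sym by (auto simp: Q'_def)
      qed
    qed
    then show "\<exists>N. N \<in> sets lebesgue \<and>
      emeasure lebesgue N \<le> ennreal c * emeasure lebesgue (ball y (5 * s y)) \<and>
      (\<forall>x\<in>ball y (5 * s y) - N. marked R \<psi> \<epsilon> K \<rho> Q x)"
      using N(1) M(1) NM by (intro exI[of _ "N \<union> M"]) auto
  qed
  from bchoice[OF this] obtain N where N: "\<forall>y\<in>D. N y \<in> sets lebesgue \<and>
      emeasure lebesgue (N y) \<le> ennreal c * emeasure lebesgue (ball y (5 * s y)) \<and>
      (\<forall>x\<in>ball y (5 * s y) - N y. marked R \<psi> \<epsilon> K \<rho> Q x)" by (elim exE)
  have c: "0 \<le> c" using c0 by (simp add: c_def distrib_right)
  have "emeasure lebesgue (N y) \<le> ennreal (c * 5 ^ DIM('a)) * emeasure lebesgue (ball y (s y))" if "y \<in> D" for y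
  proof -
    have "emeasure lebesgue (N y) \<le> ennreal c * emeasure lebesgue (ball y (5 * s y))" using N that by blast
    also have "emeasure lebesgue (ball y (5 * s y)) = ennreal (5 ^ DIM('a)) * emeasure lebesgue (ball y (s y))"
      using s(1) that D(2) by (intro emeasure_lebesgue_ball_scale) force+
    finally show ?thesis using c by (simp add: ennreal_mult mult.assoc)
  qed
  then have "emeasure lebesgue (\<Union>y\<in>D. N y) \<le> ennreal (c * 5 ^ DIM('a)) * emeasure lebesgue (\<Union>y\<in>D. ball y (s y))"
    using N D(1,3)
    by (intro emeasure_countable_cover_le) (auto simp: disjoint_family_on_def pairwise_def disjnt_def)
  also have "\<dots> \<le> ennreal (c * 5 ^ DIM('a)) * emeasure lebesgue (ball z (3 * r))"
  proof (intro mult_left_mono emeasure_mono)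
    show "(\<Union>y\<in>D. ball y (s y)) \<subseteq> ball z (3 * r)"
    proof (rule UN_least)
      fix y assume "y \<in> D"
      then have "y \<in> E" using D(2) by blast
      then have "dist y z < r" "s y \<le> 2 * r" using s(2) by (auto simp: E_def dist_commute)
      then show "ball y (s y) \<subseteq> ball z (3 * r)" by (intro ball_subset_ball_iff[THEN iffD2]) simp
    qed
  qed auto
  also have "emeasure lebesgue (ball z (3 * r)) = ennreal (3 ^ DIM('a)) * emeasure lebesgue (ball z r)"
    using r by (intro emeasure_lebesgue_ball_scale) auto
  also have "ennreal (c * 5 ^ DIM('a)) * (ennreal (3 ^ DIM('a)) * emeasure lebesgue (ball z r)) =
      ennreal (nondiv_const DIM('a) C (Suc k) * (\<epsilon> / \<rho>) powr \<alpha>) * emeasure lebesgue (ball z r)"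
  proof -
    have "(15::real) ^ DIM('a) = 5 ^ DIM('a) * 3 ^ DIM('a)" by (simp add: power_mult_distrib[symmetric])
    then have "c * 5 ^ DIM('a) * 3 ^ DIM('a) = nondiv_const DIM('a) C (Suc k) * (\<epsilon> / \<rho>) powr \<alpha>"
      by (simp add: c_def mult_ac)
    moreover have "ennreal (c * 5 ^ DIM('a)) * ennreal (3 ^ DIM('a)) = ennreal (c * 5 ^ DIM('a) * 3 ^ DIM('a))"
      using c by (intro ennreal_mult[symmetric]) auto
    ultimately show ?thesis by (simp only: mult.assoc[symmetric])
  qed
  finally have bound: "emeasure lebesgue (\<Union>y\<in>D. N y)
      \<le> ennreal (nondiv_const DIM('a) C (Suc k) * (\<epsilon> / \<rho>) powr \<alpha>) * emeasure lebesgue (ball z r)" .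
  have "marked R \<psi> \<epsilon> K \<rho> Q x" if x: "x \<in> ball z r - (\<Union>y\<in>D. N y)" for x
  proof (cases "x \<in> E")
    case True
    then obtain y where "y \<in> D" "x \<in> ball y (5 * s y)" using D(4) by blast
    then show ?thesis using N x by blast
  next
    case False
    then have "\<forall>p\<in>Q. \<rho> \<le> \<psi> p x" using x by (auto simp: E_def not_less)
    then show ?thesis unfolding marked_def by (intro exI[of _ "{}"]) simp
  qed
  then show ?case using bound N D(1) by (intro bexI[of _ "\<Union>y\<in>D. N y"] conjI ballI sets.countable_UN') auto
qed

section \<open>Proof of the equivalences\<close>

lemma continuous_on_Max_image:
  fixes g :: "'i \<Rightarrow> 'a::topological_space \<Rightarrow> real"
  assumes "finite S" "S \<noteq> {}" "\<And>i. i \<in> S \<Longrightarrow> continuous_on V (g i)"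
  shows "continuous_on V (\<lambda>x. Max ((\<lambda>i. g i x) ` S))"
  using assms
proof (induction S rule: finite_ne_induct)
  case (singleton i)
  then show ?case by simp
next
  case (insert i S)
  have "Max ((\<lambda>j. g j x) ` insert i S) = max (g i x) (Max ((\<lambda>j. g j x) ` S))" for x
    using insert.hyps by simp
  then show ?case using insert by (simp add: continuous_on_max)
qed

lemma continuous_on_lin_comb:
  assumes "\<And>i. i \<in> {1..n} \<Longrightarrow> continuous_on V (f i)"
  shows "continuous_on V (lin_comb n f c)"
  unfolding lin_comb_def[abs_def] using assms by (intro continuous_intros) auto

lemma continuous_on_covol:
  assumes f: "\<And>i. i \<in> {1..n} \<Longrightarrow> continuous_on V (f i)" and p: "length p \<le> Suc n"
  shows "continuous_on V (\<lambda>x. covol n t (\<lambda>i. f i x) p)"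
proof -
  let ?S = "{I. I \<subseteq> {0..n} \<and> card I = length p}"
  let ?m = "\<lambda>I x. \<bar>minor (length p) (\<lambda>k. flow_vec n t (\<lambda>i. f i x) (rvec p k)) (\<lambda>a. sorted_list_of_set I ! a)\<bar>"
  have eq: "covol n t (\<lambda>i. f i x) p = Max ((\<lambda>I. ?m I x) ` ?S)" for x
    unfolding covol_def wedge_norm_alt by (rule arg_cong[where f = Max]) auto
  have "finite ?S" by (rule finite_subset[of _ "Pow {0..n}"]) auto
  moreover have "?S \<noteq> {}"
    using obtain_subset_with_card_n[of "length p" "{0..n}"] p by auto
  moreover have "continuous_on V (?m I)" if "I \<in> ?S" for I
  proof -
    have I: "I \<subseteq> {0..n}" "card I = length p" "finite I" using that finite_subset[of I "{0..n}"] by auto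
    then have "bij_betw (\<lambda>a. sorted_list_of_set I ! a) {..<length p} I"
      by (intro bij_betw_nth) auto
    then have "row_choice n (length p) (\<lambda>a. sorted_list_of_set I ! a)"
      "inj_on (\<lambda>a. sorted_list_of_set I ! a) {..<length p}"
      using I(1) by (auto simp: row_choice_def bij_betw_def)
    from minor_flow_affine[OF this, of t f "rvec p"] obtain c
      where "\<forall>x. minor (length p) (\<lambda>k. flow_vec n t (\<lambda>i. f i x) (rvec p k)) (\<lambda>a. sorted_list_of_set I ! a) = lin_comb n f c x"
      by (elim exE)
    then show ?thesis using continuous_on_lin_comb[of n V f c] f
      by (simp add: continuous_on_rabs)
  qed
  ultimately show ?thesis unfolding eq by (rule continuous_on_Max_image)
qed

text \<open>The minor attaining the covolume at \<open>w\<close> is a combination h with |h| below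
  the covolume everywhere and equal to it at \<open>w\<close>. A sublevel set of the covolume thus
  lies in one of |h|.\<close>

lemma point_good_covol:
  fixes V :: "'a::euclidean_space set"
  assumes f: "\<And>i. i \<in> {1..n} \<Longrightarrow> continuous_on V (f i)" and p: "length p \<le> Suc n"
    and good: "\<And>c. C_alpha_good_on C \<alpha> V (lin_comb n f c)"
  shows "point_good C \<alpha> V (\<lambda>x. covol n t (\<lambda>i. f i x) p)"
  unfolding point_good_def
proof (intro allI impI)
  fix z r w \<epsilon>
  assume r: "0 < r" and BV: "ball z r \<subseteq> V" and w: "w \<in> ball z r" and e: "0 < (\<epsilon>::real)"
  let ?w = "\<lambda>x k. flow_vec n t (\<lambda>i. f i x) (rvec p k)"
  obtain \<sigma> where s: "row_choice n (length p) \<sigma>" "inj_on \<sigma> {..<length p}"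
    "covol n t (\<lambda>i. f i w) p = \<bar>minor (length p) (?w w) \<sigma>\<bar>"
    unfolding covol_def using wedge_norm_attained[OF p] by metis
  from minor_flow_affine[OF s(1,2), of t f "rvec p"] obtain c
    where c: "\<forall>x. minor (length p) (?w x) \<sigma> = lin_comb n f c x" by (elim exE)
  define h where "h = lin_comb n f c"
  have hle: "\<bar>h x\<bar> \<le> covol n t (\<lambda>i. f i x) p" for x
    using minor_le_wedge_norm[OF s(1) p, of "?w x"] c by (simp add: covol_def h_def)
  have hw: "covol n t (\<lambda>i. f i w) p = \<bar>h w\<bar>" using s(3) c by (simp add: h_def)
  let ?A = "{x \<in> ball z r. covol n t (\<lambda>i. f i x) p < \<epsilon> * covol n t (\<lambda>i. f i w) p}"
  define b where "b = ereal \<epsilon> * (SUP y\<in>ball z r. ereal \<bar>h y\<bar>)"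
  let ?B = "{x \<in> ball z r. ereal \<bar>h x\<bar> < b}"
  have "continuous_on (ball z r) h"
    unfolding h_def using f BV by (intro continuous_on_lin_comb continuous_on_subset[OF _ BV])
  then have "continuous_on (ball z r) (\<lambda>x. ereal \<bar>h x\<bar>)"
    by (intro continuous_on_ereal continuous_on_rabs)
  then have "open (ball z r \<inter> (\<lambda>x. ereal \<bar>h x\<bar>) -` {..<b})"
    by (intro continuous_open_preimage) auto
  then have "open ?B" by (simp add: vimage_def Int_def)
  moreover have "bounded ?B" by (rule bounded_subset[OF bounded_ball[of z r]]) auto
  ultimately have B: "?B \<in> lmeasurable" by (rule lmeasurable_open[rotated])
  have "open ?A" by (rule open_sublevel[OF continuous_on_covol BV]) (use f p in auto)
  then have A: "?A \<in> sets lebesgue" by auto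
  have "?A \<subseteq> ?B"
  proof clarify
    fix x assume x: "x \<in> ball z r" "covol n t (\<lambda>i. f i x) p < \<epsilon> * covol n t (\<lambda>i. f i w) p"
    then have "\<bar>h x\<bar> < \<epsilon> * \<bar>h w\<bar>" using hle[of x] hw by simp
    then have "ereal \<bar>h x\<bar> < ereal \<epsilon> * ereal \<bar>h w\<bar>" by simp
    also have "\<dots> \<le> b" unfolding b_def
      using e w by (intro ereal_mult_left_mono SUP_upper) auto
    finally show "ereal \<bar>h x\<bar> < b" .
  qed
  then have "measure lebesgue ?A \<le> measure lebesgue ?B"
    using A B by (intro measure_mono_fmeasurable)
  also have "\<dots> \<le> C * \<epsilon> powr \<alpha> * measure lebesgue (ball z r)"
    using good[of c] r BV e unfolding C_alpha_good_on_def b_def h_def by blast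
  finally show "measure lebesgue ?A \<le> C * \<epsilon> powr \<alpha> * measure lebesgue (ball z r)" .
qed

section \<open>Absence of short vectors at large integer times\<close>

definition short_at :: "nat \<Rightarrow> (nat \<Rightarrow> real) \<Rightarrow> real \<Rightarrow> real \<Rightarrow> bool" where
  "short_at n y t b \<longleftrightarrow> (\<exists>v. (\<forall>i>n. v i = 0) \<and> (\<exists>i\<le>n. v i \<noteq> (0::int)) \<and>
     (\<forall>i\<le>n. \<bar>flow_vec n t y (\<lambda>i. real_of_int (v i)) i\<bar> \<le> b))"

lemma short_at_mono: "short_at n y t b \<Longrightarrow> b \<le> b' \<Longrightarrow> short_at n y t b'"
  unfolding short_at_def by (meson order_trans)

text \<open>The supremum need not be attained, so a point can be produced only for a threshold
  strictly below \<open>a\<close>.\<close>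

lemma cond_star_covol:
  assumes star: "\<forall>\<Gamma>\<in>S_set n.
        (SUP x\<in>B. ereal (subgroup_norm n (mat_mult n (g_mat n t) (u_mat n (\<lambda>i. f i x))) \<Gamma>)) \<ge> ereal a"
    and p: "p \<in> flag_elems n" and \<rho>: "\<rho> < a"
  shows "\<exists>x\<in>B. \<rho> \<le> covol n t (\<lambda>i. f i x) p"
proof -
  have ind: "int_indep n p" using p by (simp add: flag_elems_def primitive_def)
  then have "zspan p \<in> S_set n" using p by (intro zspan_in_S_set) (auto simp: flag_elems_def)
  then have "ereal a \<le> (SUP x\<in>B. ereal (subgroup_norm n (flow n t (\<lambda>i. f i x)) (zspan p)))"
    using star unfolding flow_def by blast
  moreover have "ereal \<rho> < ereal a" using \<rho> by simp
  ultimately have "ereal \<rho> < (SUP x\<in>B. ereal (subgroup_norm n (flow n t (\<lambda>i. f i x)) (zspan p)))"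
    by (rule less_le_trans[rotated])
  then obtain x where "x \<in> B" "ereal \<rho> < ereal (subgroup_norm n (flow n t (\<lambda>i. f i x)) (zspan p))"
    unfolding less_SUP_iff by blast
  then show ?thesis using subgroup_norm_le_covol[OF ind, of t "\<lambda>i. f i x"] by (intro bexI[of _ x]) auto
qed

text \<open>The exceptional sets are dominated by a geometric series of ratio
  exp(-\<open>\<beta>\<close> \<open>\<alpha>\<close>). Off them a short vector at time m would
  force e^(-2\<open>\<beta>\<close>m) to be at most \<open>L\<close>
  e^(-4\<open>\<beta>\<close>m).\<close>

lemma AE_no_short_vectors:
  fixes V :: "'a::euclidean_space set"
  assumes n: "1 \<le> n" and f: "\<And>i. i \<in> {1..n} \<Longrightarrow> continuous_on V (f i)"
    and C: "0 < C" "0 < \<alpha>" and good: "\<And>c. C_alpha_good_on C \<alpha> V (lin_comb n f c)"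
    and r: "0 < r" "ball z (11 ^ n * r) \<subseteq> V" and star: "cond_star n f (ball z r)" and \<gamma>: "0 < \<gamma>"
  shows "AE x in lebesgue. x \<in> ball z r \<longrightarrow>
    (\<exists>N. \<forall>m\<ge>N. \<not> short_at n (\<lambda>i. f i x) (real m) (exp 1 * exp (- \<gamma> * real m)))"
proof -
  define K where "K = max 1 ((C * 5 ^ DIM('a)) powr (1 / \<alpha>))"
  have K: "1 \<le> K" by (simp add: K_def)
  \<comment> \<open>A quarter, since \<open>\<epsilon> m\<close> is of order
    e^(-2\<open>\<beta>\<close>m) and must beat e^(-\<open>\<gamma>\<close>m) by an exponential
    margin.\<close>
  define \<beta> where "\<beta> = \<gamma> / 4"
  have \<beta>: "0 < \<beta>" using \<gamma> by (simp add: \<beta>_def)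
  obtain T where T: "0 < T" "\<And>t. t \<ge> T \<Longrightarrow> \<forall>\<Gamma>\<in>S_set n.
        (SUP x\<in>ball z r. ereal (subgroup_norm n (mat_mult n (g_mat n t) (u_mat n (\<lambda>i. f i x))) \<Gamma>)) \<ge> ereal (exp (- \<beta> * t))"
    using star \<beta> unfolding cond_star_def by blast
  define L where "L = 2 * (real (Suc n) * exp 1 * K)"
  have L: "0 < L" using K by (simp add: L_def)
  obtain m0 :: nat where m0: "max T (ln L / (2 * \<beta>) + 1) \<le> real m0" using real_arch_simple by blast
  define A where "A = nondiv_const DIM('a) C n"
  \<comment> \<open>The factor 1/2 provides the strict inequality that
    \<open>cond_star_covol\<close> asks for.\<close>
  define \<rho> where "\<rho> m = exp (- \<beta> * real m) / 2" for m :: nat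
  \<comment> \<open>The extra exponential makes the ratio of thresholds, and with it the exceptional
    measure, decay.\<close>
  define \<epsilon> where "\<epsilon> m = \<rho> m * exp (- \<beta> * real m)" for m :: nat
  have rho: "0 < \<rho> m" "\<rho> m \<le> 1" for m
  proof -
    have "exp (- \<beta> * real m) \<le> 1" using \<beta> by simp
    then show "\<rho> m \<le> 1" unfolding \<rho>_def by linarith
  qed (simp add: \<rho>_def)
  have eps: "0 < \<epsilon> m" "\<epsilon> m \<le> \<rho> m" for m
    using rho[of m] \<beta> by (auto simp: \<epsilon>_def mult_le_cancel_left2)
  have ratio: "(\<epsilon> m / \<rho> m) powr \<alpha> = exp (- \<beta> * \<alpha>) ^ m" for m
    using rho[of m] by (simp add: \<epsilon>_def powr_def exp_of_nat_mult[symmetric] mult_ac)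
  have "\<exists>N\<in>sets lebesgue.
      emeasure lebesgue N \<le> ennreal (A * exp (- \<beta> * \<alpha>) ^ m) * emeasure lebesgue (ball z r) \<and>
      (\<forall>x\<in>ball z r - N. marked (nested n) (\<lambda>p x. covol n (real m) (\<lambda>i. f i x) p) (\<epsilon> m) K (\<rho> m) (flag_elems n) x)"
    if m: "m \<ge> m0" for m
    unfolding A_def ratio[symmetric]
  proof (rule nondivergence[where rk = length and P = "flag_elems n" and V = V])
    show "nested n q p" if "nested n p q" for p q using that by (auto simp: nested_def)
    show "length p \<noteq> length q" if "p \<in> flag_elems n" "q \<in> flag_elems n" "nested n p q" for p q
      using that nested_length[of n p q] by (auto simp: flag_elems_def primitive_def)
    show "continuous_on V (\<lambda>x. covol n (real m) (\<lambda>i. f i x) p)" if "p \<in> flag_elems n" for p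
      using that f by (intro continuous_on_covol) (auto simp: flag_elems_def)
    show "point_good C \<alpha> V (\<lambda>x. covol n (real m) (\<lambda>i. f i x) p)" if "p \<in> flag_elems n" for p
      using that f good by (intro point_good_covol) (auto simp: flag_elems_def)
    have sub: "length ` flag_elems n \<subseteq> {1..n}" by (auto simp: flag_elems_def)
    then show "finite (length ` flag_elems n)" by (rule finite_subset) simp
    show "card (length ` flag_elems n) \<le> n" using card_mono[OF _ sub] by simp
    show "\<exists>x\<in>ball z r. \<rho> m \<le> covol n (real m) (\<lambda>i. f i x) p" if "p \<in> flag_elems n" for p
    proof (rule cond_star_covol[OF T(2) that])
      show "T \<le> real m" using m m0 by simp
      show "\<rho> m < exp (- \<beta> * real m)" by (simp add: \<rho>_def)
    qed
  qed (use C eps rho r in \<open>auto simp: K_def\<close>)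
  then have "\<forall>m\<in>{m0..}. \<exists>N. N \<in> sets lebesgue \<and>
      emeasure lebesgue N \<le> ennreal (A * exp (- \<beta> * \<alpha>) ^ m) * emeasure lebesgue (ball z r) \<and>
      (\<forall>x\<in>ball z r - N. marked (nested n) (\<lambda>p x. covol n (real m) (\<lambda>i. f i x) p) (\<epsilon> m) K (\<rho> m) (flag_elems n) x)"
    by (auto simp only: atLeast_iff Bex_def)
  from bchoice[OF this] obtain N where N: "\<forall>m\<in>{m0..}. N m \<in> sets lebesgue \<and>
      emeasure lebesgue (N m) \<le> ennreal (A * exp (- \<beta> * \<alpha>) ^ m) * emeasure lebesgue (ball z r) \<and>
      (\<forall>x\<in>ball z r - N m. marked (nested n) (\<lambda>p x. covol n (real m) (\<lambda>i. f i x) p) (\<epsilon> m) K (\<rho> m) (flag_elems n) x)"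
    by (elim exE)
  define N' where "N' m = (if m \<ge> m0 then N m else {})" for m
  define c where "c = A * measure lebesgue (ball z r)"
  have A: "0 \<le> A" unfolding A_def using C by (intro nondiv_const_nonneg) simp
  have c: "0 \<le> c" using A by (simp add: c_def)
  have em: "emeasure lebesgue (N' m) \<le> ennreal (c * exp (- \<beta> * \<alpha>) ^ m)" for m
  proof (cases "m \<ge> m0")
    case True
    then have "emeasure lebesgue (N' m) \<le> ennreal (A * exp (- \<beta> * \<alpha>) ^ m) * emeasure lebesgue (ball z r)"
      using bspec[OF N, of m] unfolding N'_def by (simp only: atLeast_iff if_True simp_thms)
    also have "\<dots> = ennreal (A * exp (- \<beta> * \<alpha>) ^ m * measure lebesgue (ball z r))"
      using A by (simp add: emeasure_eq_measure2 ennreal_mult)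
    finally show ?thesis by (simp add: c_def mult_ac)
  qed (simp add: N'_def)
  have sets: "N' m \<in> sets lebesgue" for m using N by (simp add: N'_def)
  have fin: "emeasure lebesgue (N' m) < \<infinity>" for m using em[of m] by (simp add: le_less_trans)
  have le: "measure lebesgue (N' m) \<le> c * exp (- \<beta> * \<alpha>) ^ m" for m
    unfolding measure_def using em[of m] c by (intro enn2real_leI) auto
  have "summable (\<lambda>m. c * exp (- \<beta> * \<alpha>) ^ m)"
    using \<beta> C by (intro summable_mult summable_geometric) simp
  then have "summable (\<lambda>m. measure lebesgue (N' m))"
  proof (rule summable_comparison_test'[where N = 0])
    fix m
    show "norm (measure lebesgue (N' m)) \<le> c * exp (- \<beta> * \<alpha>) ^ m"
      unfolding real_norm_def abs_of_nonneg[OF measure_nonneg] by (rule le)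
  qed
  from borel_cantelli_AE1[OF sets fin this]
  have "AE x in lebesgue. eventually (\<lambda>m. x \<in> space lebesgue - N' m) sequentially" .
  then show ?thesis
  proof eventually_elim
    case (elim x)
    then obtain m1 where m1: "\<And>m. m \<ge> m1 \<Longrightarrow> x \<notin> N' m" unfolding eventually_sequentially by blast
    have "\<not> short_at n (\<lambda>i. f i x) (real m) (exp 1 * exp (- \<gamma> * real m))"
      if x: "x \<in> ball z r" and m: "m \<ge> max m0 m1" for m
    proof
      assume "short_at n (\<lambda>i. f i x) (real m) (exp 1 * exp (- \<gamma> * real m))"
      then obtain v where v': "(\<forall>i>n. v i = 0) \<and> (\<exists>i\<le>n. v i \<noteq> (0::int)) \<and>
        (\<forall>i\<le>n. \<bar>flow_vec n (real m) (\<lambda>i. f i x) (\<lambda>i. real_of_int (v i)) i\<bar> \<le> exp 1 * exp (- \<gamma> * real m))"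
        unfolding short_at_def ..
      note v = v'[THEN conjunct1] v'[THEN conjunct2, THEN conjunct1]
        v'[THEN conjunct2, THEN conjunct2, rule_format]
      have "x \<notin> N m" using m1[of m] m by (simp add: N'_def)
      then have "marked (nested n) (\<lambda>p x. covol n (real m) (\<lambda>i. f i x) p) (\<epsilon> m) K (\<rho> m) (flag_elems n) x"
        using N x m by simp
      then obtain F where F: "finite F" "F \<subseteq> flag_elems n" "\<forall>p\<in>F. \<forall>q\<in>F. p \<noteq> q \<longrightarrow> nested n p q"
        "\<forall>q\<in>F. \<epsilon> m \<le> covol n (real m) (\<lambda>i. f i x) q \<and> covol n (real m) (\<lambda>i. f i x) q \<le> K * \<rho> m"
        "\<forall>p\<in>flag_elems n. (\<forall>q\<in>F. nested n p q) \<longrightarrow> \<rho> m \<le> covol n (real m) (\<lambda>i. f i x) p"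
        unfolding marked_def by (elim exE conjE)
      have K\<rho>: "K * \<rho> m \<le> K" using K rho[of m] by (simp add: mult_le_cancel_left1)
      have "\<epsilon> m \<le> real (Suc n) * (exp 1 * exp (- \<gamma> * real m)) * K"
      proof (rule flag_short_vector_bound[OF n F(1,2)])
        show "nested n p q" if "p \<in> F" "q \<in> F" "p \<noteq> q" for p q using F(3) that by blast
        show "\<epsilon> m \<le> covol n (real m) (\<lambda>i. f i x) q \<and> covol n (real m) (\<lambda>i. f i x) q \<le> K"
          if "q \<in> F" for q using F(4) that K\<rho> by fastforce
        show "\<epsilon> m \<le> covol n (real m) (\<lambda>i. f i x) p" if "p \<in> flag_elems n" "\<And>q. q \<in> F \<Longrightarrow> nested n p q" for p
          using F(5) that eps(2)[of m] by fastforce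
        show "\<epsilon> m \<le> 1" using eps(2)[of m] rho(2)[of m] by linarith
      qed (use K v in auto)
      moreover have "\<epsilon> m = exp (- (2 * \<beta>) * real m) / 2"
        by (simp add: \<epsilon>_def \<rho>_def exp_add[symmetric])
      moreover have "L * exp (- \<gamma> * real m) = 2 * (real (Suc n) * (exp 1 * exp (- \<gamma> * real m)) * K)"
        by (simp only: L_def mult_ac)
      ultimately have "exp (- (2 * \<beta>) * real m) \<le> L * exp (- \<gamma> * real m)" by linarith
      moreover have "exp (- \<gamma> * real m) = exp (- (2 * \<beta>) * real m) * exp (- (2 * \<beta>) * real m)"
        by (simp add: \<beta>_def exp_add[symmetric])
      ultimately have "1 * exp (- (2 * \<beta>) * real m) \<le> (L * exp (- (2 * \<beta>) * real m)) * exp (- (2 * \<beta>) * real m)"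
        by (simp add: mult_ac)
      then have "1 \<le> L * exp (- (2 * \<beta>) * real m)" by (rule mult_right_le_imp_le) simp
      moreover have "ln L < 2 * \<beta> * real m"
      proof -
        have "ln L / (2 * \<beta>) < real m" using m m0 by linarith
        then show ?thesis using \<beta> by (simp add: field_simps)
      qed
      then have "exp (ln L) < exp (2 * \<beta> * real m)" by (simp only: exp_less_cancel_iff)
      then have "L * exp (- (2 * \<beta>) * real m) < 1"
        using L by (simp add: exp_minus field_simps)
      ultimately show False by linarith
    qed
    then show ?case by (intro impI exI[of _ "max m0 m1"]) simp
  qed
qed

text \<open>The null set depends on the rate \<open>\<gamma>\<close>; the rates 1/(k+1) are
  countably many and lie below every positive rate.\<close>

lemma AE_not_VWA_on_ball:
  fixes V :: "'a::euclidean_space set"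
  assumes n: "1 \<le> n" and f: "\<And>i. i \<in> {1..n} \<Longrightarrow> continuous_on V (f i)"
    and C: "0 < C" "0 < \<alpha>" and good: "\<And>c. C_alpha_good_on C \<alpha> V (lin_comb n f c)"
    and r: "0 < r" "ball z (11 ^ n * r) \<subseteq> V" and star: "cond_star n f (ball z r)"
  shows "AE x in lebesgue. x \<in> ball z r \<longrightarrow> \<not> VWA n (\<lambda>i. f i x)"
proof -
  have "AE x in lebesgue. \<forall>k::nat. x \<in> ball z r \<longrightarrow>
    (\<exists>N. \<forall>m\<ge>N. \<not> short_at n (\<lambda>i. f i x) (real m) (exp 1 * exp (- (1 / real (Suc k)) * real m)))"
    unfolding AE_all_countable
    using AE_no_short_vectors[OF n f C good r star, of "1 / real (Suc k)" for k] by simp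
  then show ?thesis
  proof eventually_elim
    case (elim x)
    show ?case
    proof (intro impI notI)
      assume x: "x \<in> ball z r" and "VWA n (\<lambda>i. f i x)"
      from short_vectors_if_VWA[OF n this(2)] obtain \<gamma> where \<gamma>: "0 < \<gamma>"
        "\<And>N::nat. \<exists>m\<ge>N. short_at n (\<lambda>i. f i x) (real m) (exp 1 * exp (- \<gamma> * real m))"
        unfolding short_at_def by blast
      obtain k :: nat where k: "1 / real (Suc k) < \<gamma>" using nat_approx_posE[OF \<gamma>(1)] by blast
      obtain N where N: "\<And>m. m \<ge> N \<Longrightarrow> \<not> short_at n (\<lambda>i. f i x) (real m) (exp 1 * exp (- (1 / real (Suc k)) * real m))"
        using elim x by blast
      obtain m where m: "m \<ge> N" "short_at n (\<lambda>i. f i x) (real m) (exp 1 * exp (- \<gamma> * real m))"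
        using \<gamma>(2) by blast
      have "(1 / real (Suc k)) * real m \<le> \<gamma> * real m" using k by (intro mult_right_mono) auto
      then have "exp 1 * exp (- \<gamma> * real m) \<le> exp 1 * exp (- (1 / real (Suc k)) * real m)"
        by (simp only: mult_le_cancel_left_pos exp_gt_zero exp_le_cancel_iff mult_minus_left neg_le_iff_le)
      then show False using short_at_mono[OF m(2)] N[OF m(1)] by blast
    qed
  qed
qed

text \<open>Uncountably many local null sets are reduced to countably many by Lindelof; points
  having no such ball form a null set by assumption.\<close>

lemma AE_locally_imp_AE:
  fixes U :: "'a::euclidean_space set"
  assumes "AE x0 in lebesgue. x0 \<in> U \<longrightarrow> (\<exists>r>0. AE x in lebesgue. x \<in> ball x0 r \<longrightarrow> P x)"
  shows "AE x in lebesgue. x \<in> U \<longrightarrow> P x"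
proof -
  define \<F> where "\<F> = {ball x r | x r. 0 < r \<and> (AE y in lebesgue. y \<in> ball x r \<longrightarrow> P y)}"
  have "\<And>S. S \<in> \<F> \<Longrightarrow> open S" by (auto simp: \<F>_def)
  then obtain \<F>' where F': "\<F>' \<subseteq> \<F>" "countable \<F>'" "\<Union>\<F>' = \<Union>\<F>" by (rule Lindelof)
  have "AE x in lebesgue. \<forall>S\<in>\<F>'. x \<in> S \<longrightarrow> P x"
    using F'(1) by (intro AE_ball_countable[OF F'(2), THEN iffD2] ballI) (auto simp: \<F>_def)
  with assms show ?thesis
  proof eventually_elim
    case (elim x)
    show ?case
    proof
      assume "x \<in> U"
      then obtain r where "0 < r" "AE y in lebesgue. y \<in> ball x r \<longrightarrow> P y" using elim(1) by blast
      then have "ball x r \<in> \<F>" "x \<in> ball x r" by (auto simp: \<F>_def)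
      then obtain S where "S \<in> \<F>'" "x \<in> S" using F'(3) by blast
      then show "P x" using elim(2) by blast
    qed
  qed
qed

text \<open>A point of \<open>U\<close> outside the closure would have a neighbourhood in
  \<open>U\<close> consisting of exceptional points, but nonempty open sets are not null.\<close>

lemma AE_imp_dense:
  fixes U :: "'a::euclidean_space set"
  assumes "open U" "AE x in lebesgue. x \<in> U \<longrightarrow> P x"
  shows "U \<subseteq> closure {x \<in> U. P x}"
proof
  fix x assume x: "x \<in> U"
  have "\<exists>y\<in>{x \<in> U. P x}. dist y x < e" if "0 < e" for e
  proof (rule ccontr)
    assume none: "\<not> ?thesis"
    have "open (U \<inter> ball x e)" "U \<inter> ball x e \<noteq> {}" using assms(1) x that by auto
    then have "\<not> negligible (U \<inter> ball x e)" by (rule open_not_negligible)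
    moreover obtain N where "N \<in> null_sets lebesgue" "{x \<in> space lebesgue. \<not> (x \<in> U \<longrightarrow> P x)} \<subseteq> N"
      using assms(2) unfolding eventually_ae_filter by blast
    moreover have "U \<inter> ball x e \<subseteq> {x \<in> space lebesgue. \<not> (x \<in> U \<longrightarrow> P x)}"
      using none by (auto simp: dist_commute)
    ultimately show False using negligible_iff_null_sets negligible_subset by (metis subset_trans)
  qed
  then show "x \<in> closure {x \<in> U. P x}" unfolding closure_approachable by blast
qed

text \<open>A small supremum bounds the norm at the given \<open>x\<close>. Passing from a covolume
  to a vector turns the rate \<open>\<beta>\<close> into \<open>\<beta>\<close>/n.\<close>

lemma VWA_if_not_cond_star:
  assumes n: "1 \<le> n" and "\<not> cond_star n f B" and x: "x \<in> B"
  shows "VWA n (\<lambda>i. f i x)"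
proof -
  obtain \<beta> where \<beta>: "0 < \<beta>" and ex: "\<And>T. 0 < T \<Longrightarrow> \<exists>t\<ge>T. \<exists>\<Gamma>\<in>S_set n.
      (SUP x\<in>B. ereal (subgroup_norm n (flow n t (\<lambda>i. f i x)) \<Gamma>)) < ereal (exp (- \<beta> * t))"
    using assms(2) unfolding cond_star_def flow_def not_le[symmetric] by blast
  show ?thesis
  proof (rule VWA_if_short_vectors[OF n, of "\<beta> / real n" "8 * real n"])
    show "0 < \<beta> / real n" "0 < 8 * real n" using \<beta> n by auto
    fix T :: real
    have "0 < max 1 T" by simp
    from ex[OF this] obtain t \<Gamma> where t: "max 1 T \<le> t" and \<Gamma>: "\<Gamma> \<in> S_set n"
      "(SUP x\<in>B. ereal (subgroup_norm n (flow n t (\<lambda>i. f i x)) \<Gamma>)) < ereal (exp (- \<beta> * t))"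
      by blast
    \<comment> \<open>The very basis used inside \<open>subgroup_norm\<close>; the bounds on its
      length come from \<open>ws\<close>.\<close>
    define vs where "vs = (SOME vs. is_zbasis n \<Gamma> vs)"
    obtain ws where ws: "is_zbasis n \<Gamma> ws" "1 \<le> length ws" "length ws \<le> n"
      using \<Gamma>(1) unfolding S_set_def by blast
    have vs: "is_zbasis n \<Gamma> vs" unfolding vs_def by (rule someI[of _ ws]) (rule ws(1))
    have len: "length vs = length ws" by (rule is_zbasis_length[OF vs ws(1)])
    have "ereal (subgroup_norm n (flow n t (\<lambda>i. f i x)) \<Gamma>) < ereal (exp (- \<beta> * t))"
      by (rule le_less_trans[OF SUP_upper[OF x] \<Gamma>(2)])
    then have "covol n t (\<lambda>i. f i x) vs \<le> exp (- \<beta> * t)"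
      by (simp add: subgroup_norm_eq_covol vs_def)
    moreover have "exp (- \<beta> * t) \<le> 1" using \<beta> t by simp
    ultimately have "\<exists>v::nat \<Rightarrow> int. (\<forall>i>n. v i = 0) \<and> (\<exists>i\<le>n. v i \<noteq> 0) \<and>
      (\<forall>i\<le>n. \<bar>flow_vec n t (\<lambda>i. f i x) (\<lambda>i. real_of_int (v i)) i\<bar> \<le> 8 * real n * exp (- \<beta> * t) powr (1 / real n))"
      using ws len by (intro short_vector_of_covol[OF vs]) auto
    moreover have "exp (- \<beta> * t) powr (1 / real n) = exp (- (\<beta> / real n) * t)" by (simp add: powr_def)
    ultimately show "\<exists>t\<ge>T. \<exists>v. (\<forall>i>n. v i = 0) \<and> (\<exists>i\<le>n. v i \<noteq> (0::int)) \<and>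
      (\<forall>i\<le>n. \<bar>flow_vec n t (\<lambda>i. f i x) (\<lambda>i. real_of_int (v i)) i\<bar> \<le> 8 * real n * exp (- (\<beta> / real n) * t))"
      using t by (intro exI[of _ t]) simp
  qed
qed

text \<open>For n = 0 only q = 0 is admissible. This case is treated apart because the argument with
  the flow divides by n.\<close>

lemma not_VWA_0: "\<not> VWA 0 y"
proof
  have "finite {q :: nat \<Rightarrow> int. (\<forall>i. i \<notin> {1..0} \<longrightarrow> q i = 0) \<and> P q}" for P
    by (rule finite_subset[of _ "{\<lambda>_. 0}"]) auto
  moreover assume "VWA 0 y"
  ultimately show False unfolding VWA_def by (elim exE conjE notE)
qed

lemma cond_star_0: "cond_star 0 f B"
proof -
  have "S_set 0 = {}" by (auto simp: S_set_def)
  then show ?thesis unfolding cond_star_def by (auto intro: exI[of _ 1])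
qed

theorem theorem3p8:
  fixes U :: "(real^'d) set" and n :: nat and f :: "nat \<Rightarrow> real^'d \<Rightarrow> real"
  assumes "open U"
    and "\<forall>i\<in>{1..n}. continuous_on U (f i)"
    and "good n U f"
  shows "(U \<subseteq> closure {x \<in> U. \<not> VWA n (\<lambda>i. f i x)} \<longleftrightarrow> extremal n U f)
       \<and> (extremal n U f \<longleftrightarrow>
           (AE x0 in lebesgue. x0 \<in> U \<longrightarrow>
              (\<forall>r>0. \<exists>\<rho>. 0 < \<rho> \<and> \<rho> < r \<and> ball x0 \<rho> \<subseteq> U \<and> cond_star n f (ball x0 \<rho>))))
       \<and> (extremal n U f \<longleftrightarrow>
           (\<forall>z \<rho>. 0 < \<rho> \<longrightarrow> ball z \<rho> \<subseteq> U \<longrightarrow> cond_star n f (ball z \<rho>)))"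
proof -
  let ?i = "U \<subseteq> closure {x \<in> U. \<not> VWA n (\<lambda>i. f i x)}"
  let ?ii = "extremal n U f"
  let ?iii = "AE x0 in lebesgue. x0 \<in> U \<longrightarrow>
              (\<forall>r>0. \<exists>\<rho>. 0 < \<rho> \<and> \<rho> < r \<and> ball x0 \<rho> \<subseteq> U \<and> cond_star n f (ball x0 \<rho>))"
  let ?iv = "\<forall>z \<rho>. 0 < \<rho> \<longrightarrow> ball z \<rho> \<subseteq> U \<longrightarrow> cond_star n f (ball z \<rho>)"
  have 21: "?ii \<Longrightarrow> ?i"
    unfolding extremal_def by (rule AE_imp_dense[OF assms(1)])
  have 14: "?i \<Longrightarrow> ?iv"
  proof (intro allI impI)
    fix z \<rho> assume i: ?i and \<rho>: "0 < (\<rho>::real)" and B: "ball z \<rho> \<subseteq> U"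
    show "cond_star n f (ball z \<rho>)"
    proof (cases "n = 0")
      case False
      have "z \<in> closure {x \<in> U. \<not> VWA n (\<lambda>i. f i x)}" using i B \<rho> centre_in_ball by blast
      then obtain x where "\<not> VWA n (\<lambda>i. f i x)" "dist x z < \<rho>"
        using \<rho> unfolding closure_approachable by blast
      then show ?thesis using VWA_if_not_cond_star[of n f "ball z \<rho>" x] False by (auto simp: dist_commute)
    qed (simp add: cond_star_0)
  qed
  have 43: "?iv \<Longrightarrow> ?iii"
  proof (intro AE_I2 impI allI)
    fix x0 r assume iv: ?iv and x0: "x0 \<in> U" and r: "0 < (r::real)"
    obtain e where e: "0 < e" "ball x0 e \<subseteq> U" using assms(1) x0 openE by blast
    define \<rho> where "\<rho> = min e (r / 2)"
    have "0 < \<rho>" "\<rho> < r" "ball x0 \<rho> \<subseteq> ball x0 e" using e r by (auto simp: \<rho>_def)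
    then show "\<exists>\<rho>. 0 < \<rho> \<and> \<rho> < r \<and> ball x0 \<rho> \<subseteq> U \<and> cond_star n f (ball x0 \<rho>)"
      using iv e(2) by (intro exI[of _ \<rho>]) auto
  qed
  have 32: "?iii \<Longrightarrow> ?ii"
  proof (cases "n = 0")
    case True
    then show ?ii by (simp add: extremal_def not_VWA_0)
  next
    case False
    assume iii: ?iii
    have "AE x0 in lebesgue. x0 \<in> U \<longrightarrow> (\<exists>r>0. AE x in lebesgue. x \<in> ball x0 r \<longrightarrow> \<not> VWA n (\<lambda>i. f i x))"
      using iii assms(3)[unfolded good_def]
    proof eventually_elim
      case (elim x0)
      show ?case
      proof
        assume x0: "x0 \<in> U"
        obtain V C \<alpha> where V: "open V" "x0 \<in> V" "V \<subseteq> U" "0 < C" "0 < \<alpha>"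
          "\<forall>c. C_alpha_good_on C \<alpha> V (lin_comb n f c)"
          using elim(2) x0 unfolding good_at_def by blast
        obtain e where e: "0 < e" "ball x0 e \<subseteq> V" using V(1,2) openE by blast
        \<comment> \<open>The radius leaves room in \<open>V\<close> for n dilations by 11.\<close>
        have "0 < e / 11 ^ n" using e(1) by simp
        then obtain \<rho> where \<rho>: "0 < \<rho>" "\<rho> < e / 11 ^ n" "cond_star n f (ball x0 \<rho>)"
          using elim(1) x0 by blast
        have "11 ^ n * \<rho> \<le> e" using \<rho>(2) by (simp add: field_simps)
        then have "ball x0 (11 ^ n * \<rho>) \<subseteq> V" using subset_ball[of "11 ^ n * \<rho>" e x0] e(2) by blast
        moreover have "continuous_on V (f i)" if "i \<in> {1..n}" for i
          using assms(2) that V(3) continuous_on_subset by blast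
        ultimately have "AE x in lebesgue. x \<in> ball x0 \<rho> \<longrightarrow> \<not> VWA n (\<lambda>i. f i x)"
          using False V(4-6) \<rho>(1,3) by (intro AE_not_VWA_on_ball[of n V f C \<alpha> \<rho> x0]) auto
        then show "\<exists>r>0. AE x in lebesgue. x \<in> ball x0 r \<longrightarrow> \<not> VWA n (\<lambda>i. f i x)"
          using \<rho>(1) by blast
      qed
    qed
    then show ?ii unfolding extremal_def by (rule AE_locally_imp_AE)
  qed
  show ?thesis using 21 14 43 32 by argo
qed

end
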